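(* For every constant $s\ge 1$, the Feedback Vertex Set problem and the Connected Feedback Vertex Set problem can both be solved in polynomial time on $sP_2$-free graphs.
   Context: All graphs are finite and simple. $P_2$ denotes the path on two vertices and $sP_2$ the disjoint union of $s$ copies of $P_2$. A graph is $sP_2$-free if it has no induced subgraph isomorphic to $sP_2$. A feedback vertex set of a graph $G$ is a set $S\subseteq V(G)$ such that $G-S$ is a forest; it is connected if the induced subgraph $G[S]$ is connected. Feedback Vertex Set: given a graph $G$ and an integer $k$, decide whether $G$ has a feedback vertex set of size at most $k$. Connected Feedback Vertex Set: given $G$ and $k$, decide whether $G$ has a connected feedback vertex set of size at most $k$. *)

theory Defs
  imports
    "HOL-Computational_Algebra.Polynomial"
    "HOL-Library.Log_Nat"
begin

section \<open>Finite simple graphs\<close>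

record 'a graph =
  verts :: "'a set"
  edges :: "'a set set"

definition simple_graph :: "'a graph \<Rightarrow> bool" where
  "simple_graph G \<longleftrightarrow> finite (verts G) \<and> (\<forall>e\<in>edges G. e \<subseteq> verts G \<and> card e = 2)"

definition induced_subgraph :: "'a graph \<Rightarrow> 'a set \<Rightarrow> 'a graph" where
  "induced_subgraph G W =
     \<lparr>verts = verts G \<inter> W, edges = {e \<in> edges G. e \<subseteq> W}\<rparr>"

definition delete_verts :: "'a graph \<Rightarrow> 'a set \<Rightarrow> 'a graph" where
  "delete_verts G S = induced_subgraph G (verts G - S)"

definition isomorphic :: "'a graph \<Rightarrow> 'b graph \<Rightarrow> bool" where
  "isomorphic G H \<longleftrightarrow>
     (\<exists>f. bij_betw f (verts G) (verts H) \<and>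
          (\<forall>u\<in>verts G. \<forall>v\<in>verts G. {u, v} \<in> edges G \<longleftrightarrow> {f u, f v} \<in> edges H))"

definition induced_free :: "'b graph \<Rightarrow> 'a graph \<Rightarrow> bool" where
  "induced_free H G \<longleftrightarrow> \<not> (\<exists>W\<subseteq>verts G. isomorphic (induced_subgraph G W) H)"

definition path_graph :: "nat \<Rightarrow> nat graph" where
  "path_graph n = \<lparr>verts = {..<n}, edges = {{i, Suc i} | i. Suc i < n}\<rparr>"

definition disjoint_copies :: "nat \<Rightarrow> 'a graph \<Rightarrow> (nat \<times> 'a) graph" where
  "disjoint_copies s H =
     \<lparr>verts = {..<s} \<times> verts H, edges = {Pair i ` e | i e. i < s \<and> e \<in> edges H}\<rparr>"

definition sP2_free :: "nat \<Rightarrow> 'a graph \<Rightarrow> bool" where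
  "sP2_free s G \<longleftrightarrow> induced_free (disjoint_copies s (path_graph 2)) G"

definition cycle_in :: "'a graph \<Rightarrow> 'a list \<Rightarrow> bool" where
  "cycle_in G xs \<longleftrightarrow>
     length xs \<ge> 3 \<and> distinct xs \<and> set xs \<subseteq> verts G \<and>
     (\<forall>i<length xs. {xs ! i, xs ! (Suc i mod length xs)} \<in> edges G)"

definition forest :: "'a graph \<Rightarrow> bool" where
  "forest G \<longleftrightarrow> (\<nexists>xs. cycle_in G xs)"

text \<open>The graph without vertices counts as connected.\<close>

definition connected_graph :: "'a graph \<Rightarrow> bool" where
  "connected_graph G \<longleftrightarrow>
     (\<forall>u\<in>verts G. \<forall>v\<in>verts G. (u, v) \<in> {(x, y). {x, y} \<in> edges G}\<^sup>*)"

definition feedback_vertex_set :: "'a graph \<Rightarrow> 'a set \<Rightarrow> bool" where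
  "feedback_vertex_set G S \<longleftrightarrow> S \<subseteq> verts G \<and> forest (delete_verts G S)"

definition connected_feedback_vertex_set :: "'a graph \<Rightarrow> 'a set \<Rightarrow> bool" where
  "connected_feedback_vertex_set G S \<longleftrightarrow>
     feedback_vertex_set G S \<and> connected_graph (induced_subgraph G S)"


section \<open>Random access machines\<close>

text \<open>
  Programs for a random access machine over the natural numbers. It has registers and arrays;
  as a program mentions only finitely many of them, they could be interleaved into a single
  memory. Every elementary instruction and every test has unit cost. The only arithmetic is
  addition and truncated subtraction, so in one step the largest stored number can at most
  double (or become a constant of the program): after t steps on an input of length n all
  numbers have O(t + log n) bits, and the machine is polynomially equivalent to Turing machines
  (Cook and Reckhow, Time bounded random access machines, 1973).
\<close>

datatype com =
    Skip
  | Const nat nat           \<comment> \<open>\<open>Const x c\<close>: \<open>x := c\<close>\<close>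
  | Add nat nat nat         \<comment> \<open>\<open>Add x y z\<close>: \<open>x := y + z\<close>\<close>
  | Sub nat nat nat         \<comment> \<open>\<open>Sub x y z\<close>: \<open>x := y - z\<close>\<close>
  | Load nat nat nat        \<comment> \<open>\<open>Load x a y\<close>: \<open>x := a[y]\<close>\<close>
  | Store nat nat nat       \<comment> \<open>\<open>Store a x y\<close>: \<open>a[x] := y\<close>\<close>
  | Seq com com
  | If nat com com          \<comment> \<open>the test is \<open>x \<noteq> 0\<close>\<close>
  | While nat com           \<comment> \<open>the test is \<open>x \<noteq> 0\<close>\<close>

text \<open>Register contents, and array contents (first argument: the array, second: the index).\<close>

type_synonym state = "(nat \<Rightarrow> nat) \<times> (nat \<Rightarrow> nat \<Rightarrow> nat)"

text \<open>\<open>exec c \<sigma> t \<tau>\<close>: started in \<open>\<sigma>\<close>, the program \<open>c\<close> halts after \<open>t\<close> steps in \<open>\<tau>\<close>.\<close>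

inductive exec :: "com \<Rightarrow> state \<Rightarrow> nat \<Rightarrow> state \<Rightarrow> bool" where
  Skip: "exec Skip \<sigma> 1 \<sigma>"
| Const: "exec (Const x c) (R, A) 1 (R(x := c), A)"
| Add: "exec (Add x y z) (R, A) 1 (R(x := R y + R z), A)"
| Sub: "exec (Sub x y z) (R, A) 1 (R(x := R y - R z), A)"
| Load: "exec (Load x a y) (R, A) 1 (R(x := A a (R y)), A)"
| Store: "exec (Store a x y) (R, A) 1 (R, A(a := (A a)(R x := R y)))"
| Seq: "exec c \<sigma> t \<sigma>' \<Longrightarrow> exec d \<sigma>' u \<sigma>'' \<Longrightarrow> exec (Seq c d) \<sigma> (t + u) \<sigma>''"
| IfTrue: "R x \<noteq> 0 \<Longrightarrow> exec c (R, A) t \<sigma> \<Longrightarrow> exec (If x c d) (R, A) (Suc t) \<sigma>"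
| IfFalse: "R x = 0 \<Longrightarrow> exec d (R, A) t \<sigma> \<Longrightarrow> exec (If x c d) (R, A) (Suc t) \<sigma>"
| WhileTrue: "R x \<noteq> 0 \<Longrightarrow> exec c (R, A) t \<sigma> \<Longrightarrow> exec (While x c) \<sigma> u \<sigma>'
    \<Longrightarrow> exec (While x c) (R, A) (Suc (t + u)) \<sigma>'"
| WhileFalse: "R x = 0 \<Longrightarrow> exec (While x c) (R, A) 1 (R, A)"

text \<open>
  The input word is stored bitwise in array 0 and its length in register 0; everything else
  is initially 0. The input is accepted if register 0 is nonzero on termination.
\<close>

definition init_state :: "bool list \<Rightarrow> state" where
  "init_state w =
     ((\<lambda>_. 0)(0 := length w),
      \<lambda>a i. if a = 0 \<and> i < length w then of_bool (w ! i) else 0)"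

definition accepting :: "state \<Rightarrow> bool" where
  "accepting \<sigma> \<longleftrightarrow> fst \<sigma> 0 \<noteq> 0"

lemma exec_deterministic:
  assumes "exec c \<sigma> t \<tau>" and "exec c \<sigma> t' \<tau>'"
  shows "t' = t \<and> \<tau>' = \<tau>"
  using assms
proof (induction arbitrary: t' \<tau>' rule: exec.induct)
  case Skip
  then show ?case by cases simp
next
  case Const
  then show ?case by cases simp
next
  case Add
  then show ?case by cases simp
next
  case Sub
  then show ?case by cases simp
next
  case Load
  then show ?case by cases simp
next
  case Store
  then show ?case by cases simp
next
  case (Seq c \<sigma> t \<sigma>' d u \<sigma>'')
  from Seq.prems obtain v \<rho> w
    where "exec c \<sigma> v \<rho>" "exec d \<rho> w \<tau>'" "t' = v + w" by cases simp
  with Seq.IH(1)[of v \<rho>] Seq.IH(2)[of w \<tau>'] show ?case by simp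
next
  case (IfTrue R x c A t \<sigma> d)
  from IfTrue.prems IfTrue.hyps(1) obtain v where "exec c (R, A) v \<tau>'" "t' = Suc v"
    by cases simp_all
  with IfTrue.IH[of v \<tau>'] show ?case by simp
next
  case (IfFalse R x d A t \<sigma> c)
  from IfFalse.prems IfFalse.hyps(1) obtain v where "exec d (R, A) v \<tau>'" "t' = Suc v"
    by cases simp_all
  with IfFalse.IH[of v \<tau>'] show ?case by simp
next
  case (WhileTrue R x c A t \<sigma> u \<sigma>')
  from WhileTrue.prems WhileTrue.hyps(1) obtain v \<rho> w
    where "exec c (R, A) v \<rho>" "exec (While x c) \<rho> w \<tau>'" "t' = Suc (v + w)"
    by cases simp_all
  with WhileTrue.IH(1)[of v \<rho>] WhileTrue.IH(2)[of w \<tau>'] show ?case by simp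
next
  case (WhileFalse R x c A)
  from WhileFalse.prems WhileFalse.hyps show ?case by cases simp_all
qed

text \<open>
  The decision problem with yes-instances \<open>Yes\<close>, restricted to the instances in \<open>D\<close>
  (encoded as words by \<open>enc\<close>), can be solved in polynomial time. Nothing is required of
  the program on inputs outside \<open>D\<close>.
\<close>

definition poly_time_solvable :: "('i \<Rightarrow> bool list) \<Rightarrow> 'i set \<Rightarrow> 'i set \<Rightarrow> bool" where
  "poly_time_solvable enc D Yes \<longleftrightarrow>
     (\<exists>(c :: com) (p :: nat poly). \<forall>x\<in>D. \<exists>t \<sigma>.
        exec c (init_state (enc x)) t \<sigma> \<and>
        t \<le> poly p (length (enc x)) \<and>
        (accepting \<sigma> \<longleftrightarrow> x \<in> Yes))"


section \<open>The two problems\<close>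

text \<open>
  As inputs, graphs have their vertices numbered from 0 to n - 1, and are given by n in unary
  followed by the adjacency matrix, row by row. The integer k is given in binary, least
  significant bit first, after a sign bit.
\<close>

definition input_graph :: "nat graph \<Rightarrow> bool" where
  "input_graph G \<longleftrightarrow> simple_graph G \<and> (\<exists>n. verts G = {..<n})"

definition encode_graph :: "nat graph \<Rightarrow> bool list" where
  "encode_graph G = (let n = card (verts G) in
     replicate n True @ [False] @
     map (\<lambda>(u, v). {u, v} \<in> edges G) (List.product [0..<n] [0..<n]))"

definition encode_int :: "int \<Rightarrow> bool list" where
  "encode_int k = (let m = nat \<bar>k\<bar> in (k < 0) # map (bit m) [0..<floorlog 2 m])"

definition encode_instance :: "nat graph \<times> int \<Rightarrow> bool list" where
  "encode_instance = (\<lambda>(G, k). encode_graph G @ encode_int k)"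

definition FVS :: "(nat graph \<times> int) set" where
  "FVS = {(G, k). \<exists>S. feedback_vertex_set G S \<and> int (card S) \<le> k}"

definition CFVS :: "(nat graph \<times> int) set" where
  "CFVS = {(G, k). \<exists>S. connected_feedback_vertex_set G S \<and> int (card S) \<le> k}"

definition sP2_free_instances :: "nat \<Rightarrow> (nat graph \<times> int) set" where
  "sP2_free_instances s = {(G, k). input_graph G \<and> sP2_free s G}"

end

theory Submission
  imports Defs
begin

text \<open>
  Let \<open>F\<close> be the forest left by a feedback vertex set of an \<open>sP\<^sub>2\<close>-free graph. Repeatedly
  choosing an edge at a vertex all of whose neighbours but one are leaves shows that at most \<open>2s\<close>
  vertices of \<open>F\<close> cover all its edges. In a forest at most as many vertices have two neighbours
  in such a cover as the cover has vertices; adding them gives \<open>U \<subseteq> F\<close> with at most \<open>4s\<close> vertices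
  such that \<open>F - U\<close> is independent and each of its vertices has at most one neighbour in \<open>U\<close>.
  Conversely a forest \<open>U\<close> stays a forest when any independent set of such vertices is added, so
  \<open>F - U\<close> may be enlarged to a maximal independent set \<open>J\<close> of them. Following Balas and Yu, \<open>J\<close>
  is the outcome of a greedy procedure controlled by an induced matching, hence by at most \<open>s\<close>
  pairs of vertices. If the feedback vertex set has to be connected, it contains \<open>V - U - J\<close> and
  some vertices of \<open>J\<close>; in a minimal set of such connecting vertices every vertex cuts off a part
  of the graph, and edges into these parts form large induced matchings, so \<open>2s\<close> vertices of \<open>J\<close>
  are enough. The algorithm enumerates all tuples of \<open>8s\<close> vertices, builds the corresponding
  candidate set and tests it.
\<close>

section \<open>Functions computable in polynomial time\<close>

text \<open>Neither the forest nor its complement has bounded size; only induced matchings do. So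
  the edge cover of the forest, the description of \<open>J\<close> and the number of connectors are
  all bounded by exhibiting an induced matching. Enlarging \<open>F - U\<close> to \<open>J\<close>
  loses no solution: \<open>F\<close> lies in \<open>U \<union> J\<close>, so
  \<open>V - U - J\<close> is contained in the given feedback vertex set, and
  \<open>U \<union> J\<close> is still a forest. Only vertices of \<open>J\<close> outside
  \<open>F\<close> leave the solution, and these are the ones that connectivity may call back. The 8
  is made up of 4 for \<open>U\<close>, 2 for the connectors and 2 for the ends of the
  \<open>s\<close> pairs that describe \<open>J\<close>. As every candidate is tested outright, a
  wrong guess does no harm. The exponent of the running time grows with \<open>s\<close>, which is
  why \<open>s\<close> has to be a constant. On the machine side, no program is written for the
  whole algorithm: a class of functions is shown to be closed under enough operations, and the
  algorithm is a HOL function in that class.\<close>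

text \<open>The only test is against 0, so the guard \<open>b\<close> holds the truncated difference
  of \<open>l\<close> and \<open>i\<close>; between two tests it serves as the constant 1 for the
  increment.\<close>

definition for_loop :: "nat \<Rightarrow> nat \<Rightarrow> nat \<Rightarrow> com \<Rightarrow> com" where
  "for_loop i b l c = Seq (Const i 0) (Seq (Sub b l i)
     (While b (Seq c (Seq (Const b 1) (Seq (Add i i b) (Sub b l i))))))"

text \<open>Induction on the remaining rounds \<open>N - k\<close>. Besides the body, a round costs
  4 steps: the loop test and three instructions that advance the counter and renew the guard.
  Entering and leaving costs 3. By \<open>stable\<close> the invariant ignores counter and guard,
  which change between rounds.\<close>

lemma exec_for_loop:
  fixes I :: "nat \<Rightarrow> state \<Rightarrow> bool"
  assumes step: "\<And>k \<sigma>. k < N \<Longrightarrow> I k \<sigma> \<Longrightarrow> fst \<sigma> i = k \<Longrightarrow> fst \<sigma> l = N \<Longrightarrow>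
      \<exists>t \<tau>. exec c \<sigma> t \<tau> \<and> t \<le> T \<and> I (Suc k) \<tau> \<and> fst \<tau> i = k \<and> fst \<tau> l = N"
    and stable: "\<And>k R A x y. I k (R, A) \<Longrightarrow> I k (R(i := x, b := y), A)"
    and regs: "i \<noteq> b" "i \<noteq> l" "b \<noteq> l"
    and init: "I 0 \<sigma>" "fst \<sigma> l = N"
  shows "\<exists>t \<tau>. exec (for_loop i b l c) \<sigma> t \<tau> \<and> t \<le> 3 + N * (T + 4) \<and> I N \<tau> \<and> fst \<tau> l = N"
proof -
  define w where "w = While b (Seq c (Seq (Const b 1) (Seq (Add i i b) (Sub b l i))))"
  have loop: "\<exists>t \<tau>. exec w \<sigma> t \<tau> \<and> t \<le> 1 + (N - k) * (T + 4) \<and> I N \<tau> \<and> fst \<tau> l = N"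
    if "k \<le> N" "I k \<sigma>" "fst \<sigma> i = k" "fst \<sigma> l = N" "fst \<sigma> b = N - k" for k \<sigma>
    using that
  proof (induction "N - k" arbitrary: k \<sigma>)
    case 0
    obtain R A where \<sigma>: "\<sigma> = (R, A)" by fastforce
    have "exec w (R, A) 1 (R, A)"
      unfolding w_def by (rule exec.WhileFalse) (use 0 \<sigma> in simp)
    moreover have "k = N" using 0 by simp
    ultimately show ?case
      using 0 \<sigma> by (intro exI[of _ 1] exI[of _ "(R, A)"]) auto
  next
    case (Suc j)
    then have "k < N" by simp
    from step[OF this Suc.prems(2,3,4)] obtain t R A where
      t: "exec c \<sigma> t (R, A)" "t \<le> T" "I (Suc k) (R, A)" "R i = k" "R l = N"
      by fastforce
    define R' where "R' = R(i := Suc k, b := N - Suc k)"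
    have "exec (Sub b l i) (R(b := 1, i := Suc k), A) 1 ((R(b := 1, i := Suc k))(b := N - Suc k), A)"
      using exec.Sub[of b l i "R(b := 1, i := Suc k)" A] t regs by simp
    moreover have "exec (Add i i b) (R(b := 1), A) 1 (R(b := 1, i := Suc k), A)"
      using exec.Add[of i i b "R(b := 1)" A] t regs by simp
    moreover have "(R(b := 1, i := Suc k))(b := N - Suc k) = R'"
      using regs by (auto simp: R'_def)
    ultimately have "exec (Seq c (Seq (Const b 1) (Seq (Add i i b) (Sub b l i)))) \<sigma> (t + (1 + (1 + 1))) (R', A)"
      using t by (metis exec.Seq exec.Const)
    moreover have "\<exists>t \<tau>. exec w (R', A) t \<tau> \<and> t \<le> 1 + (N - Suc k) * (T + 4) \<and> I N \<tau> \<and> fst \<tau> l = N"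
      by (rule Suc.hyps(1)) (use Suc.hyps(2) \<open>k < N\<close> t regs stable in \<open>auto simp: R'_def\<close>)
    then obtain u \<tau> where u: "exec w (R', A) u \<tau>" "u \<le> 1 + (N - Suc k) * (T + 4)" "I N \<tau>" "fst \<tau> l = N"
      by blast
    moreover obtain R0 A0 where "\<sigma> = (R0, A0)" by fastforce
    moreover have "fst \<sigma> b \<noteq> 0" using Suc.prems \<open>k < N\<close> by simp
    ultimately have "exec w \<sigma> (Suc (t + (1 + (1 + 1)) + u)) \<tau>"
      unfolding w_def by (metis exec.WhileTrue fst_conv)
    moreover have "N - k = Suc (N - Suc k)" using \<open>k < N\<close> by simp
    then have "Suc (t + (1 + (1 + 1)) + u) \<le> 1 + (N - k) * (T + 4)"
      using t(2) u(2) by simp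
    ultimately show ?case using u by blast
  qed
  obtain R A where \<sigma>: "\<sigma> = (R, A)" by fastforce
  define R' where "R' = R(i := 0, b := N)"
  have "exec (Sub b l i) (R(i := 0), A) 1 (R', A)"
    using exec.Sub[of b l i "R(i := 0)" A] regs init \<sigma> by (simp add: R'_def)
  moreover obtain t \<tau> where t: "exec w (R', A) t \<tau>" "t \<le> 1 + N * (T + 4)" "I N \<tau>" "fst \<tau> l = N"
    using loop[of 0 "(R', A)"] init \<sigma> regs stable[of 0 R A] by (auto simp: R'_def)
  ultimately have "exec (for_loop i b l c) \<sigma> (1 + (1 + t)) \<tau>"
    unfolding for_loop_def w_def[symmetric] \<sigma> by (meson exec.Seq exec.Const)
  then show ?thesis using t by (intro exI[of _ "1 + (1 + t)"] exI[of _ \<tau>]) auto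
qed

text \<open>
  Variables and arrays are named by numbers; \<open>V\<close> and \<open>W\<close> place the first \<open>m\<close> of them in the machine.
  Variable 0 always holds the length of the input, and arrays are 0 beyond it. A program
  compiled for depth \<open>d\<close> leaves everything below \<open>d\<close> intact and returns its result in register \<open>d\<close>;
  letting \<open>V\<close>, \<open>W\<close> and \<open>d\<close> vary makes programs composable.
\<close>

definition represents ::
    "nat \<Rightarrow> (nat \<Rightarrow> nat) \<Rightarrow> (nat \<Rightarrow> nat) \<Rightarrow> (nat \<Rightarrow> nat) \<Rightarrow> (nat \<Rightarrow> nat \<Rightarrow> nat) \<Rightarrow> state \<Rightarrow> bool" where
  "represents m V W \<rho> \<alpha> \<sigma> \<longleftrightarrow> (\<forall>i<m. fst \<sigma> (V i) = \<rho> i) \<and>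
     (\<forall>a<m. \<forall>i. \<alpha> a i = (if i < \<rho> 0 then snd \<sigma> (W a) i else 0))"

definition keeps :: "nat \<Rightarrow> state \<Rightarrow> state \<Rightarrow> bool" where
  "keeps d \<sigma> \<tau> \<longleftrightarrow> (\<forall>i<d. fst \<tau> i = fst \<sigma> i \<and> snd \<tau> i = snd \<sigma> i)"

text \<open>The time bound depends on \<open>\<rho> 0\<close> alone, whatever the other variables
  hold: steps have unit cost, and every loop that is ever compiled runs \<open>\<rho> 0\<close>
  rounds.\<close>

definition comp_with :: "nat \<Rightarrow> (nat \<Rightarrow> nat) \<Rightarrow> (nat \<Rightarrow> nat) \<Rightarrow> nat \<Rightarrow> com \<Rightarrow> nat poly \<Rightarrow>
    ((nat \<Rightarrow> nat) \<Rightarrow> (nat \<Rightarrow> nat \<Rightarrow> nat) \<Rightarrow> nat) \<Rightarrow> bool" where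
  "comp_with m V W d c q e \<longleftrightarrow> (\<forall>\<rho> \<alpha> \<sigma>. represents m V W \<rho> \<alpha> \<sigma> \<longrightarrow>
     (\<exists>t \<tau>. exec c \<sigma> t \<tau> \<and> t \<le> poly q (\<rho> 0) \<and> keeps d \<sigma> \<tau> \<and> fst \<tau> d = e \<rho> \<alpha>))"

text \<open>Two functions are compiled for a common \<open>m\<close> by taking the maximum of their
  thresholds; a binder redirects one variable or array in \<open>V\<close> or \<open>W\<close> and
  compiles its body above it. \<open>m0 > 0\<close> makes the input length available to every
  program.\<close>

definition ptime :: "((nat \<Rightarrow> nat) \<Rightarrow> (nat \<Rightarrow> nat \<Rightarrow> nat) \<Rightarrow> nat) \<Rightarrow> bool" where
  "ptime e \<longleftrightarrow> (\<exists>m0>0. \<forall>m\<ge>m0. \<forall>V W d. (\<forall>i<m. V i < d \<and> W i < d) \<longrightarrow> (\<exists>c q. comp_with m V W d c q e))"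

lemma keeps_refl: "keeps d \<sigma> \<sigma>"
  and keeps_trans: "keeps d \<sigma> \<tau> \<Longrightarrow> keeps d \<tau> \<upsilon> \<Longrightarrow> keeps d \<sigma> \<upsilon>"
  and keeps_mono: "keeps d' \<sigma> \<tau> \<Longrightarrow> d \<le> d' \<Longrightarrow> keeps d \<sigma> \<tau>"
  by (auto simp: keeps_def)

lemma keeps_upd: "d \<le> x \<Longrightarrow> keeps d \<sigma> (R, A) \<Longrightarrow> keeps d \<sigma> (R(x := v), A)"
  and keeps_upd_array: "d \<le> a \<Longrightarrow> keeps d \<sigma> (R, A) \<Longrightarrow> keeps d \<sigma> (R, A(a := f))"
  by (auto simp: keeps_def)

lemma represents_keeps:
  assumes "represents m V W \<rho> \<alpha> \<sigma>" "keeps d \<sigma> \<tau>" "\<forall>i<m. V i < d \<and> W i < d"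
  shows "represents m V W \<rho> \<alpha> \<tau>"
  using assms by (auto simp: represents_def keeps_def)

lemma runI:
  assumes "exec c \<sigma> t \<tau>" "t \<le> T" "keeps d \<sigma> \<tau>" "fst \<tau> d = v"
  shows "\<exists>t \<tau>. exec c \<sigma> t \<tau> \<and> t \<le> T \<and> keeps d \<sigma> \<tau> \<and> fst \<tau> d = v"
  using assms by blast

section \<open>Closure under arithmetic, branching, binding, array access and summation\<close>

lemma ptime_const: "ptime (\<lambda>_ _. k)"
  unfolding ptime_def comp_with_def
proof (intro exI[of _ 1] conjI allI impI)
  fix m d and V W :: "nat \<Rightarrow> nat"
  show "\<exists>c q. \<forall>\<rho> \<alpha> \<sigma>. represents m V W \<rho> \<alpha> \<sigma> \<longrightarrow>
      (\<exists>t \<tau>. exec c \<sigma> t \<tau> \<and> t \<le> poly q (\<rho> 0) \<and> keeps d \<sigma> \<tau> \<and> fst \<tau> d = k)"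
  proof (rule exI[of _ "Const d k"], rule exI[of _ 1], intro allI impI)
    fix \<rho> \<alpha> \<sigma> assume "represents m V W \<rho> \<alpha> \<sigma>"
    obtain R A where \<sigma>: "\<sigma> = (R, A)" by fastforce
    show "\<exists>t \<tau>. exec (Const d k) \<sigma> t \<tau> \<and> t \<le> poly 1 (\<rho> 0) \<and> keeps d \<sigma> \<tau> \<and> fst \<tau> d = k"
      unfolding \<sigma> by (rule runI, rule exec.Const) (auto simp: keeps_def)
  qed
qed simp

text \<open>There is no copy instruction; adding a zeroed scratch register replaces it.\<close>

lemma exec_move:
  assumes "x \<noteq> z" "y \<noteq> z"
  shows "exec (Seq (Const z 0) (Add x y z)) (R, A) 2 (R(z := 0, x := R y), A)"
  using exec.Seq[OF exec.Const[of z 0 R A] exec.Add[of x y z "R(z := 0)" A]] assms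
  by (simp add: numeral_2_eq_2)

lemma ptime_var: "ptime (\<lambda>\<rho> _. \<rho> x)"
  unfolding ptime_def comp_with_def
proof (intro exI[of _ "Suc x"] conjI allI impI)
  fix m d and V W :: "nat \<Rightarrow> nat"
  assume m: "Suc x \<le> m" and V: "\<forall>i<m. V i < d \<and> W i < d"
  have "V x < d" using m V by simp
  show "\<exists>c q. \<forall>\<rho> \<alpha> \<sigma>. represents m V W \<rho> \<alpha> \<sigma> \<longrightarrow>
      (\<exists>t \<tau>. exec c \<sigma> t \<tau> \<and> t \<le> poly q (\<rho> 0) \<and> keeps d \<sigma> \<tau> \<and> fst \<tau> d = \<rho> x)"
  proof (rule exI[of _ "Seq (Const (Suc d) 0) (Add d (V x) (Suc d))"], rule exI[of _ "2"], intro allI impI)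
    fix \<rho> \<alpha> \<sigma> assume r: "represents m V W \<rho> \<alpha> \<sigma>"
    obtain R A where \<sigma>: "\<sigma> = (R, A)" by fastforce
    have "exec (Seq (Const (Suc d) 0) (Add d (V x) (Suc d))) \<sigma> 2 (R(Suc d := 0, d := R (V x)), A)"
      unfolding \<sigma> by (rule exec_move) (use \<open>V x < d\<close> in auto)
    then show "\<exists>t \<tau>. exec (Seq (Const (Suc d) 0) (Add d (V x) (Suc d))) \<sigma> t \<tau> \<and> t \<le> poly 2 (\<rho> 0)
        \<and> keeps d \<sigma> \<tau> \<and> fst \<tau> d = \<rho> x"
      by (rule runI) (use r m \<sigma> in \<open>auto simp: keeps_def represents_def\<close>)
  qed
qed simp

lemma poly_numeral_nat [simp]: "poly (numeral k) (x::nat) = numeral k"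
  by (metis of_nat_numeral of_nat_poly poly_of_nat of_nat_id)

lemma comp_withD:
  assumes "comp_with m V W d c q e" "represents m V W \<rho> \<alpha> \<sigma>"
  obtains t R A where "exec c \<sigma> t (R, A)" "t \<le> poly q (\<rho> 0)" "keeps d \<sigma> (R, A)" "R d = e \<rho> \<alpha>"
  using assms unfolding comp_with_def by fastforce

lemma comp_with_run:
  assumes "comp_with m V W d c q e" "represents m V W \<rho> \<alpha> \<sigma>" "\<rho> 0 = N" "e \<rho> \<alpha> = v"
  shows "\<exists>t R A. exec c \<sigma> t (R, A) \<and> t \<le> poly q N \<and> keeps d \<sigma> (R, A) \<and> R d = v"
  using assms unfolding comp_with_def by fastforce

lemma ptime_binop:
  assumes e: "ptime e" and f: "ptime f"
    and op: "\<And>x y z R A. exec (i x y z) (R, A) 1 (R(x := g (R y) (R z)), A)"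
  shows "ptime (\<lambda>\<rho> \<alpha>. g (e \<rho> \<alpha>) (f \<rho> \<alpha>))"
proof -
  from e obtain m1 where m1: "m1 > 0" "\<And>m V W d. m \<ge> m1 \<Longrightarrow> (\<forall>i<m. V i < d \<and> W i < d) \<Longrightarrow> \<exists>c q. comp_with m V W d c q e"
    unfolding ptime_def by metis
  from f obtain m2 where m2: "m2 > 0" "\<And>m V W d. m \<ge> m2 \<Longrightarrow> (\<forall>i<m. V i < d \<and> W i < d) \<Longrightarrow> \<exists>c q. comp_with m V W d c q f"
    unfolding ptime_def by metis
  show ?thesis unfolding ptime_def
  proof (intro exI[of _ "max m1 m2"] conjI allI impI)
    fix m d and V W :: "nat \<Rightarrow> nat"
    assume m: "max m1 m2 \<le> m" and V: "\<forall>i<m. V i < d \<and> W i < d"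
    obtain c1 q1 where c1: "comp_with m V W d c1 q1 e" using m1(2)[of m V d W] m V by auto
    have V': "\<forall>i<m. V i < Suc d \<and> W i < Suc d" using V by auto
    obtain c2 q2 where c2: "comp_with m V W (Suc d) c2 q2 f" using m2(2)[of m V "Suc d" W] m V' by auto
    have "comp_with m V W d (Seq c1 (Seq c2 (i d d (Suc d)))) (q1 + (q2 + 1)) (\<lambda>\<rho> \<alpha>. g (e \<rho> \<alpha>) (f \<rho> \<alpha>))"
      unfolding comp_with_def
    proof (intro allI impI)
      fix \<rho> \<alpha> \<sigma> assume r: "represents m V W \<rho> \<alpha> \<sigma>"
      obtain t1 R1 A1 where 1: "exec c1 \<sigma> t1 (R1, A1)" "t1 \<le> poly q1 (\<rho> 0)" "keeps d \<sigma> (R1, A1)" "R1 d = e \<rho> \<alpha>"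
        by (rule comp_withD[OF c1 r])
      obtain t2 R2 A2 where 2: "exec c2 (R1, A1) t2 (R2, A2)" "t2 \<le> poly q2 (\<rho> 0)"
          "keeps (Suc d) (R1, A1) (R2, A2)" "R2 (Suc d) = f \<rho> \<alpha>"
        by (rule comp_withD[OF c2 represents_keeps[OF r 1(3) V]])
      have "exec (Seq c1 (Seq c2 (i d d (Suc d)))) \<sigma> (t1 + (t2 + 1)) (R2(d := g (R2 d) (R2 (Suc d))), A2)"
        by (intro exec.Seq[OF 1(1)] exec.Seq[OF 2(1)] op)
      then show "\<exists>t \<tau>. exec (Seq c1 (Seq c2 (i d d (Suc d)))) \<sigma> t \<tau> \<and> t \<le> poly (q1 + (q2 + 1)) (\<rho> 0)
          \<and> keeps d \<sigma> \<tau> \<and> fst \<tau> d = g (e \<rho> \<alpha>) (f \<rho> \<alpha>)"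
        by (rule runI) (use 1 2 in \<open>auto simp: keeps_def\<close>)
    qed
    then show "\<exists>c q. comp_with m V W d c q (\<lambda>\<rho> \<alpha>. g (e \<rho> \<alpha>) (f \<rho> \<alpha>))" by blast
  qed (use m1 in auto)
qed

lemma ptime_add: "ptime e \<Longrightarrow> ptime f \<Longrightarrow> ptime (\<lambda>\<rho> \<alpha>. e \<rho> \<alpha> + f \<rho> \<alpha>)"
  by (rule ptime_binop[where i = Add and g = "(+)"]) (auto intro: exec.Add[simplified])

lemma ptime_diff: "ptime e \<Longrightarrow> ptime f \<Longrightarrow> ptime (\<lambda>\<rho> \<alpha>. e \<rho> \<alpha> - f \<rho> \<alpha>)"
  by (rule ptime_binop[where i = Sub and g = "(-)"]) (auto intro: exec.Sub[simplified])

lemma ptimeE: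
  assumes "ptime e"
  obtains m0 where "m0 > 0" "\<And>m V W d. m \<ge> m0 \<Longrightarrow> (\<forall>i<m. V i < d \<and> W i < d) \<Longrightarrow> \<exists>c q. comp_with m V W d c q e"
  using assms unfolding ptime_def by metis

lemma ptime_if:
  assumes b: "ptime b" and e: "ptime e" and f: "ptime f"
  shows "ptime (\<lambda>\<rho> \<alpha>. if b \<rho> \<alpha> \<noteq> 0 then e \<rho> \<alpha> else f \<rho> \<alpha>)"
proof -
  from b obtain m0 where m0: "m0 > 0" "\<And>m V W d. m \<ge> m0 \<Longrightarrow> (\<forall>i<m. V i < d \<and> W i < d) \<Longrightarrow> \<exists>c q. comp_with m V W d c q b"
    by (rule ptimeE) blast
  from e obtain m1 where m1: "m1 > 0" "\<And>m V W d. m \<ge> m1 \<Longrightarrow> (\<forall>i<m. V i < d \<and> W i < d) \<Longrightarrow> \<exists>c q. comp_with m V W d c q e"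
    by (rule ptimeE) blast
  from f obtain m2 where m2: "m2 > 0" "\<And>m V W d. m \<ge> m2 \<Longrightarrow> (\<forall>i<m. V i < d \<and> W i < d) \<Longrightarrow> \<exists>c q. comp_with m V W d c q f"
    by (rule ptimeE) blast
  show ?thesis unfolding ptime_def
  proof (intro exI[of _ "max m0 (max m1 m2)"] conjI allI impI)
    fix m d and V W :: "nat \<Rightarrow> nat"
    assume m: "max m0 (max m1 m2) \<le> m" and V: "\<forall>i<m. V i < d \<and> W i < d"
    obtain c0 q0 where c0: "comp_with m V W d c0 q0 b" using m0(2)[of m V d W] m V by auto
    obtain c1 q1 where c1: "comp_with m V W d c1 q1 e" using m1(2)[of m V d W] m V by auto
    obtain c2 q2 where c2: "comp_with m V W d c2 q2 f" using m2(2)[of m V d W] m V by auto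
    have "comp_with m V W d (Seq c0 (If d c1 c2)) (q0 + (1 + (q1 + q2))) (\<lambda>\<rho> \<alpha>. if b \<rho> \<alpha> \<noteq> 0 then e \<rho> \<alpha> else f \<rho> \<alpha>)"
      unfolding comp_with_def
    proof (intro allI impI)
      fix \<rho> \<alpha> \<sigma> assume r: "represents m V W \<rho> \<alpha> \<sigma>"
      obtain t0 R0 A0 where 0: "exec c0 \<sigma> t0 (R0, A0)" "t0 \<le> poly q0 (\<rho> 0)" "keeps d \<sigma> (R0, A0)" "R0 d = b \<rho> \<alpha>"
        by (rule comp_withD[OF c0 r])
      have r': "represents m V W \<rho> \<alpha> (R0, A0)" by (rule represents_keeps[OF r 0(3) V])
      obtain t1 R1 A1 where 1: "exec c1 (R0, A0) t1 (R1, A1)" "t1 \<le> poly q1 (\<rho> 0)" "keeps d (R0, A0) (R1, A1)" "R1 d = e \<rho> \<alpha>"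
        by (rule comp_withD[OF c1 r'])
      obtain t2 R2 A2 where 2: "exec c2 (R0, A0) t2 (R2, A2)" "t2 \<le> poly q2 (\<rho> 0)" "keeps d (R0, A0) (R2, A2)" "R2 d = f \<rho> \<alpha>"
        by (rule comp_withD[OF c2 r'])
      show "\<exists>t \<tau>. exec (Seq c0 (If d c1 c2)) \<sigma> t \<tau> \<and> t \<le> poly (q0 + (1 + (q1 + q2))) (\<rho> 0)
          \<and> keeps d \<sigma> \<tau> \<and> fst \<tau> d = (if b \<rho> \<alpha> \<noteq> 0 then e \<rho> \<alpha> else f \<rho> \<alpha>)"
      proof (cases "b \<rho> \<alpha> = 0")
        case True
        then have "exec (Seq c0 (If d c1 c2)) \<sigma> (t0 + Suc t2) (R2, A2)"
          by (intro exec.Seq[OF 0(1)] exec.IfFalse[OF _ 2(1)]) (simp add: 0)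
        then show ?thesis
          by (rule runI) (use 0 2 True keeps_trans[OF 0(3) 2(3)] in \<open>auto\<close>)
      next
        case False
        then have "exec (Seq c0 (If d c1 c2)) \<sigma> (t0 + Suc t1) (R1, A1)"
          by (intro exec.Seq[OF 0(1)] exec.IfTrue[OF _ 1(1)]) (simp add: 0)
        then show ?thesis
          by (rule runI) (use 0 1 False keeps_trans[OF 0(3) 1(3)] in \<open>auto\<close>)
      qed
    qed
    then show "\<exists>c q. comp_with m V W d c q (\<lambda>\<rho> \<alpha>. if b \<rho> \<alpha> \<noteq> 0 then e \<rho> \<alpha> else f \<rho> \<alpha>)" by blast
  qed (use m0 in auto)
qed

text \<open>The value of \<open>e\<close> stays in register \<open>d\<close>, which becomes the
  place of variable \<open>x\<close> for the body. By \<open>dep\<close>, \<open>F v\<close> reads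
  that variable only through \<open>v\<close>, so evaluating the body with \<open>x\<close>
  overwritten gives the intended value.\<close>

lemma ptime_let:
  assumes e: "ptime e" and f: "ptime (\<lambda>\<rho> \<alpha>. F (\<rho> x) \<rho> \<alpha>)" and "x \<noteq> 0"
    and dep: "\<And>v w \<rho> \<alpha>. F v (\<rho>(x := w)) \<alpha> = F v \<rho> \<alpha>"
  shows "ptime (\<lambda>\<rho> \<alpha>. F (e \<rho> \<alpha>) \<rho> \<alpha>)"
proof -
  from e obtain m1 where m1: "m1 > 0" "\<And>m V W d. m \<ge> m1 \<Longrightarrow> (\<forall>i<m. V i < d \<and> W i < d) \<Longrightarrow> \<exists>c q. comp_with m V W d c q e"
    by (rule ptimeE) blast
  from f obtain m2 where m2: "m2 > 0" "\<And>m V W d. m \<ge> m2 \<Longrightarrow> (\<forall>i<m. V i < d \<and> W i < d) \<Longrightarrow>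
      \<exists>c q. comp_with m V W d c q (\<lambda>\<rho> \<alpha>. F (\<rho> x) \<rho> \<alpha>)"
    by (rule ptimeE) blast
  show ?thesis unfolding ptime_def
  proof (intro exI[of _ "max m1 m2"] conjI allI impI)
    fix m d and V W :: "nat \<Rightarrow> nat"
    assume m: "max m1 m2 \<le> m" and V: "\<forall>i<m. V i < d \<and> W i < d"
    obtain c1 q1 where c1: "comp_with m V W d c1 q1 e" using m1(2)[of m V d W] m V by auto
    have V': "\<forall>i<m. (V(x := d)) i < Suc d \<and> W i < Suc d" using V by (auto simp: less_Suc_eq)
    obtain c2 q2 where c2: "comp_with m (V(x := d)) W (Suc d) c2 q2 (\<lambda>\<rho> \<alpha>. F (\<rho> x) \<rho> \<alpha>)"
      using m2(2)[of m "V(x := d)" "Suc d" W] m V' by auto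
    let ?mv = "Seq (Const (Suc (Suc d)) 0) (Add d (Suc d) (Suc (Suc d)))"
    have "comp_with m V W d (Seq c1 (Seq c2 ?mv)) (q1 + (q2 + 2)) (\<lambda>\<rho> \<alpha>. F (e \<rho> \<alpha>) \<rho> \<alpha>)"
      unfolding comp_with_def
    proof (intro allI impI)
      fix \<rho> \<alpha> \<sigma> assume r: "represents m V W \<rho> \<alpha> \<sigma>"
      obtain t1 R1 A1 where 1: "exec c1 \<sigma> t1 (R1, A1)" "t1 \<le> poly q1 (\<rho> 0)" "keeps d \<sigma> (R1, A1)" "R1 d = e \<rho> \<alpha>"
        by (rule comp_withD[OF c1 r])
      have "represents m (V(x := d)) W (\<rho>(x := e \<rho> \<alpha>)) \<alpha> (R1, A1)"
        using represents_keeps[OF r 1(3) V] 1(4) \<open>x \<noteq> 0\<close> by (auto simp: represents_def)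
      from comp_with_run[OF c2 this, of "\<rho> 0" "F (e \<rho> \<alpha>) \<rho> \<alpha>"] \<open>x \<noteq> 0\<close> dep
      obtain t2 R2 A2 where 2: "exec c2 (R1, A1) t2 (R2, A2)" "t2 \<le> poly q2 (\<rho> 0)"
          "keeps (Suc d) (R1, A1) (R2, A2)" "R2 (Suc d) = F (e \<rho> \<alpha>) \<rho> \<alpha>" by auto
      have "exec (Seq c1 (Seq c2 ?mv)) \<sigma> (t1 + (t2 + 2)) (R2(Suc (Suc d) := 0, d := R2 (Suc d)), A2)"
        by (intro exec.Seq[OF 1(1)] exec.Seq[OF 2(1)] exec_move) auto
      then show "\<exists>t \<tau>. exec (Seq c1 (Seq c2 ?mv)) \<sigma> t \<tau> \<and> t \<le> poly (q1 + (q2 + 2)) (\<rho> 0)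
          \<and> keeps d \<sigma> \<tau> \<and> fst \<tau> d = F (e \<rho> \<alpha>) \<rho> \<alpha>"
        by (rule runI) (use 1 2 in \<open>auto simp: keeps_def\<close>)
    qed
    then show "\<exists>c q. comp_with m V W d c q (\<lambda>\<rho> \<alpha>. F (e \<rho> \<alpha>) \<rho> \<alpha>)" by blast
  qed (use m1 in auto)
qed

text \<open>Machine arrays may hold anything beyond the input length, where \<open>\<alpha>\<close>
  is 0; hence the comparison with the length before the access.\<close>

lemma ptime_read:
  assumes e: "ptime e"
  shows "ptime (\<lambda>\<rho> \<alpha>. \<alpha> a (e \<rho> \<alpha>))"
proof -
  from e obtain m1 where m1: "m1 > 0" "\<And>m V W d. m \<ge> m1 \<Longrightarrow> (\<forall>i<m. V i < d \<and> W i < d) \<Longrightarrow> \<exists>c q. comp_with m V W d c q e"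
    by (rule ptimeE) blast
  show ?thesis unfolding ptime_def
  proof (intro exI[of _ "max m1 (Suc a)"] conjI allI impI)
    fix m d and V W :: "nat \<Rightarrow> nat"
    assume m: "max m1 (Suc a) \<le> m" and V: "\<forall>i<m. V i < d \<and> W i < d"
    then have V0: "V 0 < d" using m1 by auto
    obtain c1 q1 where c1: "comp_with m V W d c1 q1 e" using m1(2)[of m V d W] m V by auto
    let ?c = "Seq c1 (Seq (Sub (Suc d) (V 0) d) (If (Suc d) (Load d (W a) d) (Const d 0)))"
    have "comp_with m V W d ?c (q1 + 3) (\<lambda>\<rho> \<alpha>. \<alpha> a (e \<rho> \<alpha>))"
      unfolding comp_with_def
    proof (intro allI impI)
      fix \<rho> \<alpha> \<sigma> assume r: "represents m V W \<rho> \<alpha> \<sigma>"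
      obtain t1 R1 A1 where 1: "exec c1 \<sigma> t1 (R1, A1)" "t1 \<le> poly q1 (\<rho> 0)" "keeps d \<sigma> (R1, A1)" "R1 d = e \<rho> \<alpha>"
        by (rule comp_withD[OF c1 r])
      have r1: "represents m V W \<rho> \<alpha> (R1, A1)" by (rule represents_keeps[OF r 1(3) V])
      then have L: "R1 (V 0) = \<rho> 0" using m m1 by (auto simp: represents_def)
      have \<alpha>: "\<alpha> a i = (if i < \<rho> 0 then A1 (W a) i else 0)" for i
        using r1 m by (auto simp: represents_def)
      define R2 where "R2 = R1(Suc d := \<rho> 0 - e \<rho> \<alpha>)"
      have 2: "exec (Sub (Suc d) (V 0) d) (R1, A1) 1 (R2, A1)"
        using exec.Sub[of "Suc d" "V 0" d R1 A1] L 1 by (simp add: R2_def)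
      show "\<exists>t \<tau>. exec ?c \<sigma> t \<tau> \<and> t \<le> poly (q1 + 3) (\<rho> 0)
          \<and> keeps d \<sigma> \<tau> \<and> fst \<tau> d = \<alpha> a (e \<rho> \<alpha>)"
      proof (cases "e \<rho> \<alpha> < \<rho> 0")
        case True
        have "exec ?c \<sigma> (t1 + (1 + Suc 1)) (R2(d := A1 (W a) (R2 d)), A1)"
          by (intro exec.Seq[OF 1(1)] exec.Seq[OF 2] exec.IfTrue exec.Load)
            (use True in \<open>simp add: R2_def\<close>)
        then show ?thesis
          by (rule runI) (use 1 \<alpha> True in \<open>auto simp: keeps_def R2_def\<close>)
      next
        case False
        have "exec ?c \<sigma> (t1 + (1 + Suc 1)) (R2(d := 0), A1)"
          by (intro exec.Seq[OF 1(1)] exec.Seq[OF 2] exec.IfFalse exec.Const)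
            (use False in \<open>simp add: R2_def\<close>)
        then show ?thesis
          by (rule runI) (use 1 \<alpha> False in \<open>auto simp: keeps_def R2_def\<close>)
      qed
    qed
    then show "\<exists>c q. comp_with m V W d c q (\<lambda>\<rho> \<alpha>. \<alpha> a (e \<rho> \<alpha>))" by blast
  qed (use m1 in auto)
qed

lemma ptime_sum:
  assumes f: "ptime (\<lambda>\<rho> \<alpha>. F (\<rho> x) \<rho> \<alpha>)" and "x \<noteq> 0"
    and dep: "\<And>v w \<rho> \<alpha>. F v (\<rho>(x := w)) \<alpha> = F v \<rho> \<alpha>"
  shows "ptime (\<lambda>\<rho> \<alpha>. \<Sum>v<\<rho> 0. F v \<rho> \<alpha>)"
proof -
  from f obtain m1 where m1: "m1 > 0" "\<And>m V W d. m \<ge> m1 \<Longrightarrow> (\<forall>i<m. V i < d \<and> W i < d) \<Longrightarrow>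
      \<exists>c q. comp_with m V W d c q (\<lambda>\<rho> \<alpha>. F (\<rho> x) \<rho> \<alpha>)"
    by (rule ptimeE) blast
  show ?thesis unfolding ptime_def
  proof (intro exI[of _ "m1"] conjI allI impI)
    fix m d and V W :: "nat \<Rightarrow> nat"
    assume m: "m1 \<le> m" and V: "\<forall>i<m. V i < d \<and> W i < d"
    have V0: "V 0 < d" using m m1 V by auto
    have V': "\<forall>i<m. (V(x := d)) i < d + 3 \<and> W i < d + 3"
    proof (intro allI impI)
      fix i assume "i < m"
      then have "V i < d \<and> W i < d" using V by blast
      then show "(V(x := d)) i < d + 3 \<and> W i < d + 3" by simp
    qed
    obtain c1 q1 where c1: "comp_with m (V(x := d)) W (d + 3) c1 q1 (\<lambda>\<rho> \<alpha>. F (\<rho> x) \<rho> \<alpha>)"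
      using m1(2)[of m "V(x := d)" "d + 3" W] m V' by auto
    \<comment> \<open>Register \<open>d\<close> is the loop counter and the place of
      \<open>x\<close>, \<open>d + 1\<close> the accumulator, \<open>d + 2\<close> the guard; the
      summand is computed from \<open>d + 3\<close> on.\<close>
    let ?b = "Seq c1 (Add (d + 1) (d + 1) (d + 3))"
    let ?l = "for_loop d (d + 2) (V 0) ?b"
    let ?mv = "Seq (Const (d + 2) 0) (Add d (d + 1) (d + 2))"
    let ?c = "Seq (Const (d + 1) 0) (Seq ?l ?mv)"
    have "comp_with m V W d ?c (1 + (3 + [:0, 1:] * (q1 + 1 + 4)) + 2) (\<lambda>\<rho> \<alpha>. \<Sum>v<\<rho> 0. F v \<rho> \<alpha>)"
      unfolding comp_with_def
    proof (intro allI impI)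
      fix \<rho> \<alpha> \<sigma> assume r: "represents m V W \<rho> \<alpha> \<sigma>"
      obtain R A where \<sigma>: "\<sigma> = (R, A)" by fastforce
      define I where "I k \<tau> \<longleftrightarrow> keeps d \<sigma> \<tau> \<and> fst \<tau> (d + 1) = (\<Sum>v<k. F v \<rho> \<alpha>)" for k \<tau>
      have L: "fst \<sigma> (V 0) = \<rho> 0" using r m m1 by (auto simp: represents_def)
      have 1: "exec (Const (d + 1) 0) \<sigma> 1 (R(d + 1 := 0), A)"
        unfolding \<sigma> by (rule exec.Const)
      have "\<exists>t \<tau>. exec ?l (R(d + 1 := 0), A) t \<tau> \<and> t \<le> 3 + \<rho> 0 * (poly q1 (\<rho> 0) + 1 + 4) \<and> I (\<rho> 0) \<tau>
          \<and> fst \<tau> (V 0) = \<rho> 0"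
      proof (rule exec_for_loop[where I = I])
        fix k \<tau> assume k: "k < \<rho> 0" "I k \<tau>" "fst \<tau> d = k" "fst \<tau> (V 0) = \<rho> 0"
        have "represents m (V(x := d)) W (\<rho>(x := k)) \<alpha> \<tau>"
          using represents_keeps[OF r _ V] k \<open>x \<noteq> 0\<close> by (auto simp: represents_def I_def)
        from comp_with_run[OF c1 this, of "\<rho> 0" "F k \<rho> \<alpha>"] \<open>x \<noteq> 0\<close> dep
        obtain t R2 A2 where 2: "exec c1 \<tau> t (R2, A2)" "t \<le> poly q1 (\<rho> 0)"
            "keeps (d + 3) \<tau> (R2, A2)" "R2 (d + 3) = F k \<rho> \<alpha>" by auto
        have "exec ?b \<tau> (t + 1) (R2(d + 1 := R2 (d + 1) + R2 (d + 3)), A2)"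
          by (intro exec.Seq[OF 2(1)] exec.Add)
        moreover have "keeps d \<tau> (R2, A2)" using 2(3) by (rule keeps_mono) simp
        then have "keeps d \<sigma> (R2(d + 1 := R2 (d + 1) + R2 (d + 3)), A2)"
          using k(2) keeps_trans[of d \<sigma> \<tau>] by (intro keeps_upd) (auto simp: I_def)
        moreover have "R2 (d + 1) = (\<Sum>v<k. F v \<rho> \<alpha>)" "R2 d = k" "R2 (V 0) = \<rho> 0"
          using k 2(3) V0 by (auto simp: keeps_def I_def)
        ultimately show "\<exists>t \<tau>'. exec ?b \<tau> t \<tau>' \<and> t \<le> poly q1 (\<rho> 0) + 1 \<and> I (Suc k) \<tau>' \<and>
            fst \<tau>' d = k \<and> fst \<tau>' (V 0) = \<rho> 0"
          using 2 V0 by (intro exI[of _ "t + 1"] exI[of _ "(R2(d + 1 := R2 (d + 1) + R2 (d + 3)), A2)"])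
            (auto simp: I_def)
      next
        show "I 0 (R(d + 1 := 0), A)" using \<sigma> by (auto simp: I_def keeps_def)
        show "fst (R(d + 1 := 0), A) (V 0) = \<rho> 0" using \<sigma> L V0 by auto
      next
        fix k R A x y assume "I k (R, A)"
        then show "I k (R(d := x, d + 2 := y), A)" by (simp add: I_def keeps_def)
      next
        show "d \<noteq> d + 2" by simp
        show "d \<noteq> V 0" using V0 by linarith
        show "d + 2 \<noteq> V 0" using V0 by linarith
      qed
      then obtain t R3 A3 where 3: "exec ?l (R(d + 1 := 0), A) t (R3, A3)"
          "t \<le> 3 + \<rho> 0 * (poly q1 (\<rho> 0) + 1 + 4)" "I (\<rho> 0) (R3, A3)" by (auto simp del: One_nat_def)
      have "exec ?c \<sigma> (1 + (t + 2)) (R3(d + 2 := 0, d := R3 (d + 1)), A3)"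
        by (intro exec.Seq[OF 1] exec.Seq[OF 3(1)] exec_move) auto
      then show "\<exists>t \<tau>. exec ?c \<sigma> t \<tau> \<and> t \<le> poly (1 + (3 + [:0, 1:] * (q1 + 1 + 4)) + 2) (\<rho> 0) \<and> keeps d \<sigma> \<tau>
          \<and> fst \<tau> d = (\<Sum>v<\<rho> 0. F v \<rho> \<alpha>)"
        by (rule runI) (use 3 in \<open>auto simp: I_def keeps_def\<close>)
    qed
    then show "\<exists>c q. comp_with m V W d c q (\<lambda>\<rho> \<alpha>. \<Sum>v<\<rho> 0. F v \<rho> \<alpha>)" by blast
  qed (use m1 in auto)
qed

definition sweep :: "nat \<Rightarrow> (nat \<Rightarrow> (nat \<Rightarrow> nat) \<Rightarrow> nat) \<Rightarrow> (nat \<Rightarrow> nat) \<Rightarrow> nat \<Rightarrow> nat" where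
  "sweep k f A = fold (\<lambda>v A. A(v := f v A)) [0..<k] A"

text \<open>One scheme for both an array defined by recursion and the closure of a set under a rule;
  the \<open>N\<close> sweeps are the worst case of the latter.\<close>

definition iter_array :: "nat \<Rightarrow> (nat \<Rightarrow> (nat \<Rightarrow> nat) \<Rightarrow> nat) \<Rightarrow> nat \<Rightarrow> nat" where
  "iter_array N f = (sweep N f ^^ N) (\<lambda>_. 0)"

lemma sweep_Suc: "sweep (Suc k) f A = (sweep k f A)(k := f k (sweep k f A))"
  by (simp add: sweep_def)

lemma sweep_0 [simp]: "sweep 0 f A = A"
  by (simp add: sweep_def)

lemma sweep_ge: "i \<ge> k \<Longrightarrow> sweep k f A i = A i"
  by (induction k) (auto simp: sweep_Suc)

lemma sweep_pow_ge: "i \<ge> N \<Longrightarrow> (sweep N f ^^ r) (\<lambda>_. 0) i = 0"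
  by (induction r) (auto simp: sweep_ge)

lemma ptime_let_array:
  assumes f: "ptime (\<lambda>\<rho> \<alpha>. F (\<rho> x) (\<alpha> a) \<rho> \<alpha>)" and g: "ptime (\<lambda>\<rho> \<alpha>. G (\<alpha> a) \<rho> \<alpha>)" and "x \<noteq> 0"
    and depF: "\<And>v A w B \<rho> \<alpha>. F v A (\<rho>(x := w)) (\<alpha>(a := B)) = F v A \<rho> \<alpha>"
    and depG: "\<And>A B \<rho> \<alpha>. G A \<rho> (\<alpha>(a := B)) = G A \<rho> \<alpha>"
  shows "ptime (\<lambda>\<rho> \<alpha>. G (iter_array (\<rho> 0) (\<lambda>v A. F v A \<rho> \<alpha>)) \<rho> \<alpha>)"
proof -
  from f obtain m1 where m1: "m1 > 0" "\<And>m V W d. m \<ge> m1 \<Longrightarrow> (\<forall>i<m. V i < d \<and> W i < d) \<Longrightarrow>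
      \<exists>c q. comp_with m V W d c q (\<lambda>\<rho> \<alpha>. F (\<rho> x) (\<alpha> a) \<rho> \<alpha>)"
    by (rule ptimeE) blast
  from g obtain m2 where m2: "m2 > 0" "\<And>m V W d. m \<ge> m2 \<Longrightarrow> (\<forall>i<m. V i < d \<and> W i < d) \<Longrightarrow>
      \<exists>c q. comp_with m V W d c q (\<lambda>\<rho> \<alpha>. G (\<alpha> a) \<rho> \<alpha>)"
    by (rule ptimeE) blast
  show ?thesis unfolding ptime_def
  proof (intro exI[of _ "max m1 m2"] conjI allI impI)
    fix m d and V W :: "nat \<Rightarrow> nat"
    assume m: "max m1 m2 \<le> m" and V: "\<forall>i<m. V i < d \<and> W i < d"
    have V0: "V 0 < d" using m m1 V by auto
    define W' where "W' = W(a := d)"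
    define V' where "V' = V(x := d)"
    have V': "\<forall>i<m. V' i < d + 4 \<and> W' i < d + 4" "\<forall>i<m. V i < d + 4 \<and> W' i < d + 4"
    proof (goal_cases)
      case 1
      show ?case
      proof (intro allI impI)
        fix i assume "i < m"
        then have "V i < d \<and> W i < d" using V by blast
        then show "V' i < d + 4 \<and> W' i < d + 4" by (auto simp: V'_def W'_def)
      qed
    next
      case 2
      show ?case
      proof (intro allI impI)
        fix i assume "i < m"
        then have "V i < d \<and> W i < d" using V by blast
        then show "V i < d + 4 \<and> W' i < d + 4" by (auto simp: W'_def)
      qed
    qed
    obtain c1 q1 where c1: "comp_with m V' W' (d + 4) c1 q1 (\<lambda>\<rho> \<alpha>. F (\<rho> x) (\<alpha> a) \<rho> \<alpha>)"
      using m1(2)[of m V' "d + 4" W'] m V' by auto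
    obtain c2 q2 where c2: "comp_with m V W' (d + 4) c2 q2 (\<lambda>\<rho> \<alpha>. G (\<alpha> a) \<rho> \<alpha>)"
      using m2(2)[of m V "d + 4" W'] m V' by auto
    \<comment> \<open>\<open>?z\<close> clears the first cells of array \<open>d\<close>, which may
      hold remains of earlier computations; \<open>?i\<close> is one sweep and \<open>?o\<close>
      repeats it. Register \<open>d\<close> counts within a sweep, \<open>d + 2\<close> counts
      sweeps. Registers and arrays are numbered separately, so both may use
      \<open>d\<close>.\<close>
    let ?zb = "Seq (Const (d + 3) 0) (Store d d (d + 3))"
    let ?z = "for_loop d (d + 1) (V 0) ?zb"
    let ?ib = "Seq c1 (Store d d (d + 4))"
    let ?i = "for_loop d (d + 1) (V 0) ?ib"
    let ?o = "for_loop (d + 2) (d + 3) (V 0) ?i"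
    let ?mv = "Seq (Const (d + 2) 0) (Add d (d + 4) (d + 2))"
    let ?c = "Seq ?z (Seq ?o (Seq c2 ?mv))"
    let ?qi = "3 + [:0, 1:] * (q1 + 1 + 4)"
    let ?q = "(3 + [:0, 1:] * (2 + 4)) + ((3 + [:0, 1:] * (?qi + 4)) + (q2 + 2))"
    let ?e = "\<lambda>\<rho> \<alpha>. G (iter_array (\<rho> 0) (\<lambda>v A. F v A \<rho> \<alpha>)) \<rho> \<alpha>"
    have "comp_with m V W d ?c ?q ?e"
      unfolding comp_with_def
    proof (intro allI impI)
      fix \<rho> \<alpha> \<sigma> assume r: "represents m V W \<rho> \<alpha> \<sigma>"
      define N where "N = \<rho> 0"
      define f where "f v A = F v A \<rho> \<alpha>" for v A
      have L: "fst \<sigma> (V 0) = N" using r m m1 by (auto simp: represents_def N_def)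
      have rep: "represents m V W' \<rho> (\<alpha>(a := B)) \<tau>"
        if "keeps d \<sigma> \<tau>" "\<And>i. i < N \<Longrightarrow> snd \<tau> d i = B i" "\<And>i. i \<ge> N \<Longrightarrow> B i = 0" for \<tau> B
        using represents_keeps[OF r that(1) V] that(2,3)
        by (auto simp: represents_def W'_def N_def not_less)
      have "\<exists>t \<tau>. exec ?z \<sigma> t \<tau> \<and> t \<le> 3 + N * (2 + 4) \<and> (keeps d \<sigma> \<tau> \<and> (\<forall>i<N. snd \<tau> d i = 0)) \<and> fst \<tau> (V 0) = N"
      proof (rule exec_for_loop[where I = "\<lambda>k \<tau>. keeps d \<sigma> \<tau> \<and> (\<forall>i<k. snd \<tau> d i = 0)"])
        fix k \<tau> assume k: "k < N" "keeps d \<sigma> \<tau> \<and> (\<forall>i<k. snd \<tau> d i = 0)" "fst \<tau> d = k" "fst \<tau> (V 0) = N"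
        obtain R A where \<tau>: "\<tau> = (R, A)" by fastforce
        define R' where "R' = R(d + 3 := 0)"
        have "exec ?zb \<tau> (1 + 1) (R', A(d := (A d)(R' d := R' (d + 3))))"
          unfolding \<tau> R'_def by (rule exec.Seq[OF exec.Const exec.Store])
        then show "\<exists>t \<tau>'. exec ?zb \<tau> t \<tau>' \<and> t \<le> 2 \<and> (keeps d \<sigma> \<tau>' \<and> (\<forall>i<Suc k. snd \<tau>' d i = 0)) \<and>
            fst \<tau>' d = k \<and> fst \<tau>' (V 0) = N"
          using k V0 \<tau> by (intro exI[of _ "1 + 1"] exI[of _ "(R', A(d := (A d)(R' d := R' (d + 3))))"])
            (auto simp: R'_def keeps_def)
      next
        fix k R A x y assume "keeps d \<sigma> (R, A) \<and> (\<forall>i<k. snd (R, A) d i = 0)"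
        then show "keeps d \<sigma> (R(d := x, d + 1 := y), A) \<and> (\<forall>i<k. snd (R(d := x, d + 1 := y), A) d i = 0)"
          by (simp add: keeps_def)
      qed (use V0 L in \<open>simp_all add: keeps_refl\<close>)
      then obtain tz Rz Az where z: "exec ?z \<sigma> tz (Rz, Az)" "tz \<le> 3 + N * (2 + 4)" "keeps d \<sigma> (Rz, Az)"
          "\<forall>i<N. Az d i = 0" "Rz (V 0) = N" by fastforce
      \<comment> \<open>Register \<open>d + 2\<close> is carried in the invariant because a sweep,
        as body of the outer loop, has to preserve the outer counter.\<close>
      have inner: "\<exists>t \<tau>'. exec ?i \<tau> t \<tau>' \<and> t \<le> 3 + N * (poly q1 N + 1 + 4) \<and>
          (keeps d \<sigma> \<tau>' \<and> fst \<tau>' (d + 2) = r \<and> (\<forall>i<N. snd \<tau>' d i = sweep N f B i)) \<and> fst \<tau>' (V 0) = N"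
        if \<tau>: "keeps d \<sigma> \<tau>" "fst \<tau> (d + 2) = r" "\<forall>i<N. snd \<tau> d i = B i" "fst \<tau> (V 0) = N"
          and B: "\<And>i. i \<ge> N \<Longrightarrow> B i = 0" for B r \<tau>
      proof (rule exec_for_loop[where I = "\<lambda>k \<tau>. keeps d \<sigma> \<tau> \<and> fst \<tau> (d + 2) = r \<and> (\<forall>i<N. snd \<tau> d i = sweep k f B i)"])
        fix k \<tau>
        assume k: "k < N" "keeps d \<sigma> \<tau> \<and> fst \<tau> (d + 2) = r \<and> (\<forall>i<N. snd \<tau> d i = sweep k f B i)"
          "fst \<tau> d = k" "fst \<tau> (V 0) = N"
        have "represents m V W' \<rho> (\<alpha>(a := sweep k f B)) \<tau>"
          using k B by (intro rep) (auto simp: sweep_ge)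
        then have "represents m V' W' (\<rho>(x := k)) (\<alpha>(a := sweep k f B)) \<tau>"
          using \<open>x \<noteq> 0\<close> k by (auto simp: represents_def V'_def)
        from comp_with_run[OF c1 this, of N "f k (sweep k f B)"] \<open>x \<noteq> 0\<close> depF
        obtain t R A where 2: "exec c1 \<tau> t (R, A)" "t \<le> poly q1 N"
            "keeps (d + 4) \<tau> (R, A)" "R (d + 4) = f k (sweep k f B)"
          by (auto simp: f_def N_def)
        define A' where "A' = A(d := (A d)(R d := R (d + 4)))"
        have "exec ?ib \<tau> (t + 1) (R, A')"
          unfolding A'_def by (intro exec.Seq[OF 2(1)] exec.Store)
        moreover have Rd: "R d = k" "R (d + 2) = r" "R (V 0) = N" "A d = snd \<tau> d"
          using k 2(3) V0 by (auto simp: keeps_def)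
        moreover have "keeps d \<tau> (R, A')"
          unfolding A'_def by (rule keeps_upd_array[OF _ keeps_mono[OF 2(3)]]) auto
        then have "keeps d \<sigma> (R, A')" using k(2) keeps_trans by blast
        moreover have "\<forall>i<N. A' d i = sweep (Suc k) f B i"
          using k(2) Rd 2(4) by (simp add: A'_def sweep_Suc)
        ultimately show "\<exists>t \<tau>'. exec ?ib \<tau> t \<tau>' \<and> t \<le> poly q1 N + 1 \<and> (keeps d \<sigma> \<tau>' \<and> fst \<tau>' (d + 2) = r \<and>
            (\<forall>i<N. snd \<tau>' d i = sweep (Suc k) f B i)) \<and> fst \<tau>' d = k \<and> fst \<tau>' (V 0) = N"
          using 2(2) by (intro exI[of _ "t + 1"] exI[of _ "(R, A')"]) auto
      next
        fix k R A x y
        assume "keeps d \<sigma> (R, A) \<and> fst (R, A) (d + 2) = r \<and> (\<forall>i<N. snd (R, A) d i = sweep k f B i)"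
        then show "keeps d \<sigma> (R(d := x, d + 1 := y), A) \<and> fst (R(d := x, d + 1 := y), A) (d + 2) = r \<and>
            (\<forall>i<N. snd (R(d := x, d + 1 := y), A) d i = sweep k f B i)"
          by (simp add: keeps_def)
      qed (use V0 \<tau> in simp_all)
      have "\<exists>t \<tau>. exec ?o (Rz, Az) t \<tau> \<and> t \<le> 3 + N * ((3 + N * (poly q1 N + 1 + 4)) + 4) \<and>
          (keeps d \<sigma> \<tau> \<and> (\<forall>i<N. snd \<tau> d i = (sweep N f ^^ N) (\<lambda>_. 0) i)) \<and> fst \<tau> (V 0) = N"
      proof (rule exec_for_loop[where I = "\<lambda>r \<tau>. keeps d \<sigma> \<tau> \<and> (\<forall>i<N. snd \<tau> d i = (sweep N f ^^ r) (\<lambda>_. 0) i)"])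
        fix r \<tau>
        assume k: "r < N" "keeps d \<sigma> \<tau> \<and> (\<forall>i<N. snd \<tau> d i = (sweep N f ^^ r) (\<lambda>_. 0) i)"
          "fst \<tau> (d + 2) = r" "fst \<tau> (V 0) = N"
        show "\<exists>t \<tau>'. exec ?i \<tau> t \<tau>' \<and> t \<le> 3 + N * (poly q1 N + 1 + 4) \<and>
            (keeps d \<sigma> \<tau>' \<and> (\<forall>i<N. snd \<tau>' d i = (sweep N f ^^ Suc r) (\<lambda>_. 0) i)) \<and>
            fst \<tau>' (d + 2) = r \<and> fst \<tau>' (V 0) = N"
          using inner[of \<tau> r "(sweep N f ^^ r) (\<lambda>_. 0)"] k sweep_pow_ge[of N _ r f] by auto
      next
        fix k R A x y
        assume "keeps d \<sigma> (R, A) \<and> (\<forall>i<N. snd (R, A) d i = (sweep N f ^^ k) (\<lambda>_. 0) i)"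
        then show "keeps d \<sigma> (R(d + 2 := x, d + 3 := y), A) \<and>
            (\<forall>i<N. snd (R(d + 2 := x, d + 3 := y), A) d i = (sweep N f ^^ k) (\<lambda>_. 0) i)"
          by (simp add: keeps_def)
      qed (use V0 z in simp_all)
      then obtain t R A where o: "exec ?o (Rz, Az) t (R, A)"
          "t \<le> 3 + N * ((3 + N * (poly q1 N + 1 + 4)) + 4)" "keeps d \<sigma> (R, A)"
          "\<forall>i<N. A d i = iter_array N f i" "R (V 0) = N" unfolding iter_array_def by fastforce
      have "represents m V W' \<rho> (\<alpha>(a := iter_array N f)) (R, A)"
        using o by (intro rep) (auto simp: iter_array_def sweep_pow_ge)
      from comp_with_run[OF c2 this, of N "?e \<rho> \<alpha>"] depG
      obtain u R' A' where u: "exec c2 (R, A) u (R', A')" "u \<le> poly q2 N"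
            "keeps (d + 4) (R, A) (R', A')" "R' (d + 4) = ?e \<rho> \<alpha>"
        by (auto simp: f_def[abs_def] N_def)
      have "exec ?c \<sigma> (tz + (t + (u + 2))) (R'(d + 2 := 0, d := R' (d + 4)), A')"
        by (intro exec.Seq[OF z(1)] exec.Seq[OF o(1)] exec.Seq[OF u(1)] exec_move) auto
      moreover have "tz + (t + (u + 2)) \<le> poly ?q (\<rho> 0)"
        using z(2) o(2) u(2) by (simp add: N_def algebra_simps)
      moreover have "keeps d (R, A) (R', A')" using u(3) by (rule keeps_mono) simp
      then have "keeps d \<sigma> (R'(d + 2 := 0, d := R' (d + 4)), A')"
        using keeps_trans[OF o(3)] by (intro keeps_upd) auto
      ultimately show "\<exists>t \<tau>. exec ?c \<sigma> t \<tau> \<and> t \<le> poly ?q (\<rho> 0) \<and> keeps d \<sigma> \<tau> \<and> fst \<tau> d = ?e \<rho> \<alpha>"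
        using u(4) by (intro runI) auto
    qed
    then show "\<exists>c q. comp_with m V W d c q ?e" by blast
  qed (use m1 in auto)
qed

section \<open>Predicates and bounded search\<close>

abbreviation ptime_pred :: "((nat \<Rightarrow> nat) \<Rightarrow> (nat \<Rightarrow> nat \<Rightarrow> nat) \<Rightarrow> bool) \<Rightarrow> bool" where
  "ptime_pred P \<equiv> ptime (\<lambda>\<rho> \<alpha>. of_bool (P \<rho> \<alpha>))"

lemma ptime_cong:
  assumes "ptime e" "\<And>\<rho> \<alpha>. e \<rho> \<alpha> = f \<rho> \<alpha>"
  shows "ptime f"
  using assms(1) by (simp add: assms(2)[abs_def, symmetric])

lemma ptime_If:
  assumes "ptime_pred b" "ptime e" "ptime f"
  shows "ptime (\<lambda>\<rho> \<alpha>. if b \<rho> \<alpha> then e \<rho> \<alpha> else f \<rho> \<alpha>)"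
  by (rule ptime_cong[OF ptime_if[OF assms]]) simp

lemma ptime_pred_nonzero:
  assumes "ptime e"
  shows "ptime_pred (\<lambda>\<rho> \<alpha>. e \<rho> \<alpha> \<noteq> 0)"
  by (rule ptime_cong[OF ptime_if[OF assms ptime_const[of 1] ptime_const[of 0]]]) simp

lemma ptime_pred_not:
  assumes "ptime_pred P"
  shows "ptime_pred (\<lambda>\<rho> \<alpha>. \<not> P \<rho> \<alpha>)"
  by (rule ptime_cong[OF ptime_If[OF assms ptime_const[of 0] ptime_const[of 1]]]) simp

lemma ptime_pred_conj:
  assumes "ptime_pred P" "ptime_pred Q"
  shows "ptime_pred (\<lambda>\<rho> \<alpha>. P \<rho> \<alpha> \<and> Q \<rho> \<alpha>)"
  by (rule ptime_cong[OF ptime_If[OF assms ptime_const[of 0]]]) simp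

lemma ptime_pred_disj:
  assumes "ptime_pred P" "ptime_pred Q"
  shows "ptime_pred (\<lambda>\<rho> \<alpha>. P \<rho> \<alpha> \<or> Q \<rho> \<alpha>)"
  by (rule ptime_cong[OF ptime_pred_not[OF ptime_pred_conj[OF assms[THEN ptime_pred_not]]]]) simp

lemma ptime_pred_imp:
  assumes "ptime_pred P" "ptime_pred Q"
  shows "ptime_pred (\<lambda>\<rho> \<alpha>. P \<rho> \<alpha> \<longrightarrow> Q \<rho> \<alpha>)"
  by (rule ptime_cong[OF ptime_pred_disj[OF ptime_pred_not[OF assms(1)] assms(2)]]) simp

lemma ptime_pred_less:
  assumes "ptime e" "ptime f"
  shows "ptime_pred (\<lambda>\<rho> \<alpha>. e \<rho> \<alpha> < f \<rho> \<alpha>)"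
  by (rule ptime_cong[OF ptime_pred_nonzero[OF ptime_diff[OF assms(2,1)]]]) simp

lemma ptime_pred_le:
  assumes "ptime e" "ptime f"
  shows "ptime_pred (\<lambda>\<rho> \<alpha>. e \<rho> \<alpha> \<le> f \<rho> \<alpha>)"
  by (rule ptime_cong[OF ptime_pred_not[OF ptime_pred_less[OF assms(2,1)]]]) auto

lemma ptime_pred_eq:
  assumes "ptime e" "ptime f"
  shows "ptime_pred (\<lambda>\<rho> \<alpha>. e \<rho> \<alpha> = f \<rho> \<alpha>)"
  by (rule ptime_cong[OF ptime_pred_conj[OF ptime_pred_le[OF assms] ptime_pred_le[OF assms(2,1)]]]) auto

lemma ptime_pred_const: "ptime_pred (\<lambda>_ _. b)"
  by (rule ptime_const)

text \<open>A bounded search is the test whether a sum of truth values is nonzero; its range is the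
  input length, the bound of all loops.\<close>

lemma ptime_pred_bex:
  assumes "ptime_pred (\<lambda>\<rho> \<alpha>. P (\<rho> x) \<rho> \<alpha>)" "x \<noteq> 0" "\<And>v w \<rho> \<alpha>. P v (\<rho>(x := w)) \<alpha> = P v \<rho> \<alpha>"
  shows "ptime_pred (\<lambda>\<rho> \<alpha>. \<exists>v<\<rho> 0. P v \<rho> \<alpha>)"
proof -
  have "ptime (\<lambda>\<rho> \<alpha>. \<Sum>v<\<rho> 0. of_bool (P v \<rho> \<alpha>))"
    by (rule ptime_sum[where F = "\<lambda>v \<rho> \<alpha>. of_bool (P v \<rho> \<alpha>)", OF assms(1,2)]) (simp add: assms(3))
  then show ?thesis by (rule ptime_cong[OF ptime_pred_nonzero]) auto
qed

lemma ptime_pred_ball: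
  assumes "ptime_pred (\<lambda>\<rho> \<alpha>. P (\<rho> x) \<rho> \<alpha>)" "x \<noteq> 0" "\<And>v w \<rho> \<alpha>. P v (\<rho>(x := w)) \<alpha> = P v \<rho> \<alpha>"
  shows "ptime_pred (\<lambda>\<rho> \<alpha>. \<forall>v<\<rho> 0. P v \<rho> \<alpha>)"
  by (rule ptime_cong[OF ptime_pred_not[OF ptime_pred_bex[where P = "\<lambda>v \<rho> \<alpha>. \<not> P v \<rho> \<alpha>",
          OF ptime_pred_not[OF assms(1)] assms(2)]]]) (simp_all add: assms(3))

text \<open>\<open>c\<close> is a constant of the program, so the quantifier is unrolled at compile
  time.\<close>

lemma ptime_pred_finite_bex:
  fixes c :: nat
  assumes "\<And>j. ptime_pred (P j)"
  shows "ptime_pred (\<lambda>\<rho> \<alpha>. \<exists>j<c. P j \<rho> \<alpha>)"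
proof (induct c)
  case 0
  show ?case by (rule ptime_cong[OF ptime_pred_const[of False]]) simp
next
  case (Suc c)
  show ?case by (rule ptime_cong[OF ptime_pred_disj[OF Suc assms[of c]]]) (auto simp: less_Suc_eq)
qed

text \<open>Each component costs one more nested loop, so the degree of the time bound grows with
  \<open>c\<close>. \<open>Q\<close> receives the tuple in the variables from \<open>b\<close> to
  \<open>b + c - 1\<close>; \<open>b > 0\<close> protects the input length.\<close>

lemma ptime_pred_ex_tuple:
  assumes "ptime_pred Q" "0 < b"
  shows "ptime_pred (\<lambda>\<rho> \<alpha>. \<exists>T. (\<forall>j<c. T j < \<rho> 0) \<and> Q (\<lambda>i. if b \<le> i \<and> i < b + c then T (i - b) else \<rho> i) \<alpha>)"
proof (induct c)
  case 0
  have "(\<lambda>i. if b \<le> i \<and> i < b + 0 then T (i - b) else \<rho> i) = \<rho>" for T \<rho> :: "nat \<Rightarrow> nat"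
    by auto
  then show ?case by (intro ptime_cong[OF assms(1)]) simp
next
  case (Suc c)
  define P where "P c \<rho> \<alpha> \<longleftrightarrow> (\<exists>T. (\<forall>j<c. T j < \<rho> 0) \<and> Q (\<lambda>i. if b \<le> i \<and> i < b + c then T (i - b) else \<rho> i) \<alpha>)"
    for c \<rho> \<alpha>
  have eq: "P (Suc c) \<rho> \<alpha> \<longleftrightarrow> (\<exists>v<\<rho> 0. P c (\<rho>(b + c := v)) \<alpha>)" for \<rho> \<alpha>
  proof
    assume "P (Suc c) \<rho> \<alpha>"
    then obtain T where T: "\<forall>j<Suc c. T j < \<rho> 0"
      "Q (\<lambda>i. if b \<le> i \<and> i < b + Suc c then T (i - b) else \<rho> i) \<alpha>" by (auto simp: P_def)
    have "(\<lambda>i. if b \<le> i \<and> i < b + Suc c then T (i - b) else \<rho> i) =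
        (\<lambda>i. if b \<le> i \<and> i < b + c then T (i - b) else (\<rho>(b + c := T c)) i)"
      by (auto simp: fun_eq_iff less_Suc_eq)
    then show "\<exists>v<\<rho> 0. P c (\<rho>(b + c := v)) \<alpha>"
      using T assms(2) unfolding P_def by (intro exI[of _ "T c"] conjI exI[of _ T]) auto
  next
    assume "\<exists>v<\<rho> 0. P c (\<rho>(b + c := v)) \<alpha>"
    then obtain v T where T: "v < \<rho> 0" "\<forall>j<c. T j < \<rho> 0"
      "Q (\<lambda>i. if b \<le> i \<and> i < b + c then T (i - b) else (\<rho>(b + c := v)) i) \<alpha>"
      using assms(2) by (auto simp: P_def)
    have "(\<lambda>i. if b \<le> i \<and> i < b + c then T (i - b) else (\<rho>(b + c := v)) i) =
        (\<lambda>i. if b \<le> i \<and> i < b + Suc c then (T(c := v)) (i - b) else \<rho> i)"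
      by (auto simp: fun_eq_iff less_Suc_eq)
    then show "P (Suc c) \<rho> \<alpha>"
      using T unfolding P_def by (intro exI[of _ "T(c := v)"] conjI) (auto simp: less_Suc_eq)
  qed
  have "ptime_pred (P c)" using Suc unfolding P_def .
  then have "ptime_pred (\<lambda>\<rho> \<alpha>. \<exists>v<\<rho> 0. P c (\<rho>(b + c := v)) \<alpha>)"
    by (intro ptime_pred_bex[where x = "b + c"]) (use assms(2) in auto)
  then have "ptime_pred (P (Suc c))" by (rule ptime_cong) (simp add: eq)
  then show ?case by (simp add: P_def)
qed

text \<open>With variables and arrays placed by the identity, the initial state represents itself,
  its arrays being 0 beyond the input. The answer is finally moved from register \<open>m0\<close>
  to register 0.\<close>

lemma ptime_imp_poly_time_solvable:
  assumes "ptime_pred P"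
    and "\<And>x. x \<in> D \<Longrightarrow> P (fst (init_state (enc x))) (snd (init_state (enc x))) \<longleftrightarrow> x \<in> Yes"
  shows "poly_time_solvable enc D Yes"
proof -
  from assms(1) obtain m0 where "m0 > 0" and
    m0: "\<And>m V W d. m \<ge> m0 \<Longrightarrow> (\<forall>i<m. V i < d \<and> W i < d) \<Longrightarrow> \<exists>c q. comp_with m V W d c q (\<lambda>\<rho> \<alpha>. of_bool (P \<rho> \<alpha>))"
    by (rule ptimeE) blast
  obtain c q where c: "comp_with m0 id id m0 c q (\<lambda>\<rho> \<alpha>. of_bool (P \<rho> \<alpha>))"
    using m0[of m0 id m0 id] by auto
  let ?c = "Seq c (Seq (Const (m0 + 1) 0) (Add 0 m0 (m0 + 1)))"
  show ?thesis
    unfolding poly_time_solvable_def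
  proof (intro exI[of _ ?c] exI[of _ "q + 2"] ballI)
    fix x assume x: "x \<in> D"
    define \<sigma> where "\<sigma> = init_state (enc x)"
    have "fst \<sigma> 0 = length (enc x)" by (simp add: \<sigma>_def init_state_def)
    moreover have "represents m0 id id (fst \<sigma>) (snd \<sigma>) \<sigma>"
      by (auto simp: represents_def \<sigma>_def init_state_def)
    ultimately obtain t R A where 1: "exec c \<sigma> t (R, A)" "t \<le> poly q (length (enc x))" "R m0 = of_bool (P (fst \<sigma>) (snd \<sigma>))"
      using comp_with_run[OF c] by metis
    have "exec ?c \<sigma> (t + 2) (R(m0 + 1 := 0, 0 := R m0), A)"
      by (rule exec.Seq[OF 1(1) exec_move]) auto
    then show "\<exists>t \<tau>. exec ?c (init_state (enc x)) t \<tau> \<and> t \<le> poly (q + 2) (length (enc x)) \<and> (accepting \<tau> \<longleftrightarrow> x \<in> Yes)"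
      using 1(2,3) assms(2)[OF x] unfolding \<sigma>_def[symmetric]
      by (intro exI[of _ "t + 2"] exI[of _ "(R(m0 + 1 := 0, 0 := R m0), A)"]) (auto simp: accepting_def)
  qed
qed


section \<open>Arrays defined by iteration\<close>

text \<open>If \<open>f v A\<close> depends only on entries below \<open>v\<close>, the first sweep already computes the
  array defined by course-of-values recursion, and later sweeps leave it unchanged.\<close>

lemma iter_array_rec:
  assumes dep: "\<And>v A B. v < N \<Longrightarrow> (\<And>u. u < v \<Longrightarrow> A u = B u) \<Longrightarrow> f v A = f v B" and "v < N"
  shows "iter_array N f v = f v (iter_array N f)"
proof -
  have eq: "sweep k f A v = f v (sweep N f A)" if "v < k" "k \<le> N" for k v A
    using that
  proof (induction k)
    case (Suc k)
    \<comment> \<open>An entry is final once the sweep has passed it.\<close>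
    have *: "sweep k f A u = sweep N f A u" if "u < k" for u
    proof -
      have "sweep j f A u = sweep k f A u" if "k \<le> j" for j
        using that \<open>u < k\<close> by (induction j rule: dec_induct) (auto simp: sweep_Suc)
      from this[of N] show ?thesis using Suc.prems by simp
    qed
    show ?case
    proof (cases "v = k")
      case True
      then show ?thesis using dep[of k "sweep k f A" "sweep N f A"] * Suc.prems by (simp add: sweep_Suc)
    next
      case False
      then show ?thesis using Suc by (simp add: sweep_Suc)
    qed
  qed simp
  \<comment> \<open>Only the outermost of the \<open>N\<close> sweeps is split off:
    \<open>eq\<close> holds whatever array a sweep starts from.\<close>
  obtain M where M: "N = Suc M" using assms(2) by (cases N) auto
  show ?thesis
    unfolding iter_array_def M using eq[of v N] assms(2) M by simp
qed

lemma iter_array_ge: "v \<ge> N \<Longrightarrow> iter_array N f v = 0"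
  by (simp add: iter_array_def sweep_pow_ge)

text \<open>Sweeping with a monotone closure rule \<open>\<Phi>\<close> computes the least closed set, since
  each sweep before saturation adds an element.\<close>

lemma iter_array_closure:
  fixes N \<Phi>
  defines "A \<equiv> iter_array N (\<lambda>v A. of_bool (A v \<noteq> 0 \<or> \<Phi> {u. u < N \<and> A u \<noteq> 0} v))"
  assumes "\<forall>X Y v. X \<subseteq> Y \<and> \<Phi> X v \<longrightarrow> \<Phi> Y v"
  shows "v < N \<Longrightarrow> \<Phi> {u. u < N \<and> A u \<noteq> 0} v \<Longrightarrow> A v \<noteq> 0"
    and "(\<And>v. v < N \<Longrightarrow> \<Phi> C v \<Longrightarrow> v \<in> C) \<Longrightarrow> A v \<noteq> 0 \<Longrightarrow> v \<in> C"
proof -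
  have mono: "\<Phi> Y v" if "X \<subseteq> Y" "\<Phi> X v" for X Y v using assms(2) that by blast
  define S where "S B = {u. u < N \<and> B u \<noteq> 0}" for B :: "nat \<Rightarrow> nat"
  define f where "f = (\<lambda>v A. of_bool (A v \<noteq> 0 \<or> \<Phi> (S A) v) :: nat)"
  have A: "A = iter_array N f" by (simp add: A_def f_def S_def)
  have grow: "S B \<subseteq> S (sweep k f B)" if "k \<le> N" for k B
    using that
  proof (induction k)
    case (Suc k)
    then show ?case by (auto simp: S_def sweep_Suc f_def)
  qed simp
  have grow2: "S (sweep j f B) \<subseteq> S (sweep k f B)" if "j \<le> k" "k \<le> N" for j k B
    using that by (induction k rule: dec_induct) (auto simp: S_def sweep_Suc f_def)
  \<comment> \<open>When the sweep reaches \<open>v\<close>, the set has only grown, so by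
    monotonicity the rule still fires.\<close>
  have step: "v \<in> S (sweep N f B)" if "v < N" "\<Phi> (S B) v" for v B
  proof -
    have "\<Phi> (S (sweep v f B)) v" using mono[OF grow that(2)] that(1) by simp
    then have "v \<in> S (sweep (Suc v) f B)" using that(1) by (simp add: S_def sweep_Suc f_def)
    then show ?thesis using grow2[of "Suc v" N B] that(1) by auto
  qed
  \<comment> \<open>The rule rewrites every nonzero entry to 1; with entries at most 1, a saturated
    array is therefore literally unchanged.\<close>
  have fix_step: "sweep k f B = B" if "\<forall>v<N. \<Phi> (S B) v \<longrightarrow> v \<in> S B" "\<forall>v. B v \<le> 1" "k \<le> N" for B k
    using that(3)
  proof (induction k)
    case (Suc k)
    then have "sweep k f B = B" by simp
    moreover have "f k B = B k"
      using spec[OF that(1), of k] Suc.prems spec[OF that(2), of k] by (cases "B k = 0") (auto simp: f_def S_def)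
    ultimately show ?case by (simp add: sweep_Suc)
  qed simp
  define B where "B r = (sweep N f ^^ r) (\<lambda>_. 0)" for r
  have bin: "sweep k f C v \<le> 1" if "\<forall>v. C v \<le> 1" for k C v
    using that by (induction k) (auto simp: sweep_Suc f_def)
  have B1: "\<forall>v. B r v \<le> 1" for r
    unfolding B_def by (induction r) (auto intro: bin[simplified])
  \<comment> \<open>As long as the set is not closed, \<open>r\<close> sweeps have put at least
    \<open>r\<close> elements into it; for \<open>r = N\<close> it is everything and hence
    closed.\<close>
  have progress: "(\<forall>v<N. \<Phi> (S (B r)) v \<longrightarrow> v \<in> S (B r)) \<or> r \<le> card (S (B r))" for r
  proof (induction r)
    case (Suc r)
    show ?case
    proof (cases "\<forall>v<N. \<Phi> (S (B r)) v \<longrightarrow> v \<in> S (B r)")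
      case True
      then have "B (Suc r) = B r" using fix_step[OF True B1, of N] by (simp add: B_def)
      then show ?thesis using True by simp
    next
      case False
      then obtain v where v: "v < N" "\<Phi> (S (B r)) v" "v \<notin> S (B r)" by blast
      have "v \<in> S (B (Suc r))" using step[OF v(1,2)] by (simp add: B_def)
      moreover have "S (B r) \<subseteq> S (B (Suc r))" using grow[of N "B r"] by (simp add: B_def)
      ultimately have "S (B r) \<subset> S (B (Suc r))" using v(3) by blast
      moreover have "finite (S (B (Suc r)))" by (simp add: S_def)
      ultimately have "card (S (B r)) < card (S (B (Suc r)))" by (rule psubset_card_mono[rotated])
      moreover have "r \<le> card (S (B r))" using Suc False by blast
      ultimately show ?thesis by simp
    qed
  qed simp
  have closed: "\<forall>v<N. \<Phi> (S (B N)) v \<longrightarrow> v \<in> S (B N)"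
    using progress[of N]
  proof
    assume "N \<le> card (S (B N))"
    moreover have "S (B N) \<subseteq> {..<N}" by (auto simp: S_def)
    ultimately have "S (B N) = {..<N}" by (intro card_seteq) auto
    then show ?thesis by simp
  qed
  have AB: "A = B N" by (simp add: A B_def iter_array_def)
  show "A v \<noteq> 0" if "v < N" "\<Phi> {u. u < N \<and> A u \<noteq> 0} v"
    using closed that unfolding AB by (auto simp: S_def)
  show "v \<in> C" if C: "\<And>v. v < N \<Longrightarrow> \<Phi> C v \<Longrightarrow> v \<in> C" and v: "A v \<noteq> 0"
  proof -
    have sub: "{v. sweep k f X v \<noteq> 0} \<subseteq> C" if "{v. X v \<noteq> 0} \<subseteq> C" "k \<le> N" for k X
      using that
    proof (induction k)
      case (Suc k)
      then have IH: "{v. sweep k f X v \<noteq> 0} \<subseteq> C" by simp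
      then have "S (sweep k f X) \<subseteq> C" by (auto simp: S_def)
      then have "\<Phi> (S (sweep k f X)) k \<Longrightarrow> k \<in> C" using mono C[of k] Suc.prems by auto
      then show ?case using IH by (auto simp: sweep_Suc f_def split: if_splits)
    qed simp
    have "{v. B r v \<noteq> 0} \<subseteq> C" for r
      unfolding B_def by (induction r) (use sub[of _ N] in auto)
    then show ?thesis using v AB by auto
  qed
qed

section \<open>Forests, independent sets and connectivity\<close>

definition thin :: "('a \<Rightarrow> 'a \<Rightarrow> bool) \<Rightarrow> 'a set \<Rightarrow> 'a \<Rightarrow> bool" where
  "thin E X v \<longleftrightarrow> (\<forall>a\<in>X. \<forall>b\<in>X. E v a \<and> E v b \<longrightarrow> a = b)"

text \<open>The graph on \<open>F\<close> is 1-degenerate, which for finite simple graphs means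
  being a forest (see \<open>forest_delete_verts\<close>). This form passes to subsets, offers a
  vertex to remove in inductions, and is what peeling decides.\<close>

definition acyclic_on :: "('a \<Rightarrow> 'a \<Rightarrow> bool) \<Rightarrow> 'a set \<Rightarrow> bool" where
  "acyclic_on E F \<longleftrightarrow> (\<forall>Q\<subseteq>F. Q \<noteq> {} \<longrightarrow> (\<exists>v\<in>Q. thin E Q v))"

definition indep :: "('a \<Rightarrow> 'a \<Rightarrow> bool) \<Rightarrow> 'a set \<Rightarrow> bool" where
  "indep E I \<longleftrightarrow> (\<forall>u\<in>I. \<forall>v\<in>I. \<not> E u v)"

text \<open>Edges are oriented because the description of \<open>J\<close> treats the two ends
  differently. As distinct pairs share no vertex, no edge occurs in both orientations and
  \<open>card\<close> counts edges.\<close>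

definition induced_matching :: "('a \<Rightarrow> 'a \<Rightarrow> bool) \<Rightarrow> ('a \<times> 'a) set \<Rightarrow> bool" where
  "induced_matching E M \<longleftrightarrow> (\<forall>(a, b)\<in>M. E a b) \<and>
     (\<forall>p\<in>M. \<forall>q\<in>M. p \<noteq> q \<longrightarrow> (\<forall>x\<in>{fst p, snd p}. \<forall>y\<in>{fst q, snd q}. x \<noteq> y \<and> \<not> E x y))"

text \<open>Phrased by closed sets instead of walks, so that a failure directly yields a cut. The
  empty set counts as connected, as in \<open>connected_graph\<close>.\<close>

definition conn_on :: "('a \<Rightarrow> 'a \<Rightarrow> bool) \<Rightarrow> 'a set \<Rightarrow> bool" where
  "conn_on E S \<longleftrightarrow> (\<forall>A\<subseteq>S. A \<noteq> {} \<and> (\<forall>u\<in>A. \<forall>v\<in>S. E u v \<longrightarrow> v \<in> A) \<longrightarrow> A = S)"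

lemma conn_onD:
  assumes "conn_on E S" "A \<subseteq> S" "A \<noteq> {}" "\<And>u v. u \<in> A \<Longrightarrow> v \<in> S \<Longrightarrow> E u v \<Longrightarrow> v \<in> A"
  shows "A = S"
  using assms unfolding conn_on_def by simp

lemma thin_mono: "thin E Y v \<Longrightarrow> X \<subseteq> Y \<Longrightarrow> thin E X v"
  by (auto simp: thin_def)

lemma acyclic_on_mono: "acyclic_on E G \<Longrightarrow> F \<subseteq> G \<Longrightarrow> acyclic_on E F"
  by (auto simp: acyclic_on_def)

lemma indep_mono: "indep E J \<Longrightarrow> I \<subseteq> J \<Longrightarrow> indep E I"
  by (auto simp: indep_def)

text \<open>A vertex of \<open>Q\<close> in \<open>J\<close> has no neighbours in \<open>J\<close>
  and at most one in \<open>U\<close>; it is the witness unless \<open>Q\<close> lies inside the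
  forest \<open>U\<close>.\<close>

lemma acyclic_on_union_indep:
  assumes "acyclic_on E U" "indep E J" "\<And>v. v \<in> J \<Longrightarrow> thin E U v"
  shows "acyclic_on E (U \<union> J)"
  unfolding acyclic_on_def
proof (intro allI impI)
  fix Q assume Q: "Q \<subseteq> U \<union> J" "Q \<noteq> {}"
  show "\<exists>v\<in>Q. thin E Q v"
  proof (cases "Q \<subseteq> U")
    case True
    then show ?thesis using Q assms(1) by (auto simp: acyclic_on_def)
  next
    case False
    then obtain v where v: "v \<in> Q" "v \<in> J" using Q by auto
    then have "thin E Q v"
      using assms(2) assms(3)[of v] Q unfolding thin_def indep_def by blast
    then show ?thesis using v by blast
  qed
qed

lemma maximal_indep_extension:
  assumes "finite W" "I \<subseteq> W" "indep E I"
  shows "\<exists>J. I \<subseteq> J \<and> J \<subseteq> W \<and> indep E J \<and> (\<forall>K\<subseteq>W. indep E K \<and> J \<subseteq> K \<longrightarrow> K = J)"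
proof -
  let ?\<A> = "{J. I \<subseteq> J \<and> J \<subseteq> W \<and> indep E J}"
  have "finite ?\<A>" by (rule finite_subset[of _ "Pow W"]) (use assms(1) in auto)
  moreover have "?\<A> \<noteq> {}" using assms(2,3) by blast
  ultimately have "\<exists>J\<in>?\<A>. \<forall>K\<in>?\<A>. J \<subseteq> K \<longrightarrow> J = K"
    by (rule finite_has_maximal)
  then obtain J where J: "J \<in> ?\<A>" "\<forall>K\<in>?\<A>. J \<subseteq> K \<longrightarrow> J = K" ..
  have "K = J" if "K \<subseteq> W" "indep E K" "J \<subseteq> K" for K
    using J(2)[THEN bspec, of K] J(1) that by auto
  then show ?thesis using J(1) by (intro exI[of _ J]) simp
qed

locale sym_graph =
  fixes E :: "'a \<Rightarrow> 'a \<Rightarrow> bool"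
  assumes sym: "E u v \<Longrightarrow> E v u" and irrefl: "\<not> E u u"
begin

section \<open>Few vertices that control a forest\<close>

lemma induced_matching_insert:
  assumes "induced_matching E M" "E a b"
    and "\<And>x. x \<in> fst ` M \<union> snd ` M \<Longrightarrow> \<not> E a x \<and> \<not> E b x"
  shows "induced_matching E (insert (a, b) M)"
proof -
  \<comment> \<open>Non-adjacency also yields disjointness: \<open>x = a\<close> would give
    \<open>E b x\<close>, and \<open>x = b\<close> would give \<open>E a x\<close>.\<close>
  have ne: "x \<noteq> a \<and> x \<noteq> b \<and> \<not> E a x \<and> \<not> E b x \<and> \<not> E x a \<and> \<not> E x b" if "x \<in> fst ` M \<union> snd ` M" for x
    using assms(2) assms(3)[of x] that sym by blast
  have "fst p \<in> fst ` M \<union> snd ` M \<and> snd p \<in> fst ` M \<union> snd ` M" if "p \<in> M" for p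
    using that by auto
  note ne' = conjunct1[OF this, THEN ne] conjunct2[OF this, THEN ne]
  show ?thesis
    unfolding induced_matching_def
  proof (intro conjI ballI impI)
    fix p assume "p \<in> insert (a, b) M"
    then show "case p of (a, b) \<Rightarrow> E a b"
      using assms(1,2) by (auto simp: induced_matching_def)
  next
    fix p q x y
    assume p: "p \<in> insert (a, b) M" and q: "q \<in> insert (a, b) M" and "p \<noteq> q"
      and x: "x \<in> {fst p, snd p}" and y: "y \<in> {fst q, snd q}"
    then consider "p \<in> M" "q \<in> M" | "p = (a, b)" "q \<in> M" | "p \<in> M" "q = (a, b)"
      by blast
    then have "x \<noteq> y \<and> \<not> E x y"
    proof cases
      case 1
      then show ?thesis using assms(1) \<open>p \<noteq> q\<close> x y unfolding induced_matching_def by blast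
    next
      case 2
      then show ?thesis using ne'[of q] x y by auto
    next
      case 3
      then show ?thesis using ne'[of p] x y by auto
    qed
    then show "x \<noteq> y" "\<not> E x y" by auto
  qed
qed

text \<open>Apply acyclicity to the non-leaves: one of them, \<open>p\<close>, has at most one
  neighbour among them (collected in \<open>D\<close>). Having two neighbours in \<open>F\<close>,
  it has a leaf \<open>l\<close> among them.\<close>

lemma exists_star_centre:
  assumes F: "acyclic_on E F" and edge: "\<not> indep E F"
  shows "\<exists>p l D. p \<in> F \<and> l \<in> F \<and> E p l \<and> l \<notin> D \<and> finite D \<and> card D \<le> 1 \<and> D \<subseteq> F \<and>
    (\<forall>x\<in>F - D. E p x \<longrightarrow> (\<forall>y\<in>F. E x y \<longrightarrow> y = p))"
proof -
  define Q where "Q = {v \<in> F. \<not> thin E F v}"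
  have leaf: "y = p" if "x \<in> F - Q" "E p x" "y \<in> F" "E x y" "p \<in> F" for x y p
    using that sym[OF that(2)] by (auto simp: Q_def thin_def)
  show ?thesis
  proof (cases "Q = {}")
    \<comment> \<open>Without vertices of degree two or more, any edge serves, with \<open>D\<close>
      empty.\<close>
    case True
    obtain p l where "p \<in> F" "l \<in> F" "E p l" using edge by (auto simp: indep_def)
    then show ?thesis
      using leaf True by (intro exI[of _ p] exI[of _ l] exI[of _ "{}"]) auto
  next
    case False
    then obtain p where p: "p \<in> Q" "thin E Q p"
      using F unfolding acyclic_on_def Q_def by (metis (no_types, lifting) mem_Collect_eq subsetI)
    define D where "D = {x \<in> Q. E p x}"
    have D: "x = y" if "x \<in> D" "y \<in> D" for x y
      using that p by (auto simp: D_def thin_def)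
    have D1: "finite D \<and> card D \<le> 1"
    proof (cases "D = {}")
      case False
      then obtain x where "D = {x}" using D by blast
      then show ?thesis by simp
    qed simp
    obtain a b where "a \<in> F" "b \<in> F" "E p a" "E p b" "a \<noteq> b"
      using p by (auto simp: Q_def thin_def)
    then obtain l where "l \<in> F" "E p l" "l \<notin> D" using D by blast
    then show ?thesis
      using leaf p D1
      by (intro exI[of _ p] exI[of _ l] exI[of _ D]) (auto simp: D_def Q_def)
  qed
qed

text \<open>Each round removes a star centre \<open>p\<close> with all its neighbours, records the
  edge \<open>(p, l)\<close> in \<open>M\<close>, and puts \<open>p\<close> and its at most one
  exceptional neighbour into \<open>U\<close>; hence the factor 2.\<close>

lemma acyclic_cover_by_induced_matching:
  assumes "finite F" "acyclic_on E F"
  shows "\<exists>U M. U \<subseteq> F \<and> M \<subseteq> F \<times> F \<and> induced_matching E M \<and> card U \<le> 2 * card M \<and> indep E (F - U)"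
  using assms
proof (induction "card F" arbitrary: F rule: less_induct)
  case less
  show ?case
  proof (cases "indep E F")
    case True
    then show ?thesis by (intro exI[of _ "{}"]) (auto simp: induced_matching_def)
  next
    case False
    then obtain p l D where p: "p \<in> F" "l \<in> F" "E p l" "l \<notin> D" "finite D" "card D \<le> 1" "D \<subseteq> F"
      and leaf: "\<And>x y. x \<in> F - D \<Longrightarrow> E p x \<Longrightarrow> y \<in> F \<Longrightarrow> E x y \<Longrightarrow> y = p"
      using exists_star_centre[OF less.prems(2) False] by blast
    define F' where "F' = F - insert p D - {x. E p x}"
    have "card F' < card F" using less.prems p by (intro psubset_card_mono) (auto simp: F'_def)
    moreover have "acyclic_on E F'" using less.prems by (auto simp: F'_def intro: acyclic_on_mono)
    moreover have "finite F'" using less.prems(1) by (simp add: F'_def)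
    ultimately obtain U M where UM: "U \<subseteq> F'" "M \<subseteq> F' \<times> F'" "induced_matching E M" "card U \<le> 2 * card M" "indep E (F' - U)"
      using less.hyps[of F'] by blast
    have "induced_matching E (insert (p, l) M)"
    proof (rule induced_matching_insert[OF UM(3) p(3)])
      fix x assume "x \<in> fst ` M \<union> snd ` M"
      then have "x \<in> F'" using UM(2) by auto
      \<comment> \<open>\<open>F'\<close> avoids the neighbours of \<open>p\<close>, and the leaf
        \<open>l\<close> has no neighbour but \<open>p\<close>.\<close>
      then show "\<not> E p x \<and> \<not> E l x" using leaf[of l x] p by (auto simp: F'_def)
    qed
    moreover have "card (insert p (D \<union> U)) \<le> 2 * card (insert (p, l) M)"
    proof -
      have "finite M" by (rule finite_subset[OF UM(2)]) (auto simp: F'_def less.prems)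
      moreover have "(p, l) \<notin> M" using UM(2) by (auto simp: F'_def)
      moreover have "card (insert p (D \<union> U)) \<le> Suc (card (D \<union> U))"
        by (rule card_insert_le_m1[of "Suc (card (D \<union> U))", simplified]) simp
      then have "card (insert p (D \<union> U)) \<le> Suc (card D + card U)"
        using card_Un_le[of D U] by linarith
      ultimately show ?thesis using UM(4) p(6) by simp
    qed
    moreover have "indep E (F - insert p (D \<union> U))"
      unfolding indep_def
    proof (intro ballI notI)
      fix u v assume uv: "u \<in> F - insert p (D \<union> U)" "v \<in> F - insert p (D \<union> U)" "E u v"
      \<comment> \<open>A neighbour of \<open>p\<close> outside \<open>D\<close> has no other
        neighbour in \<open>F\<close>, so an uncovered edge at it would end in \<open>p\<close>,
        which is in the cover.\<close>
      show False
      proof (cases "E p u \<or> E p v")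
        case True
        then show ?thesis using leaf[of u v] leaf[of v u] uv sym by auto
      next
        case False
        then have "u \<in> F' - U" "v \<in> F' - U" using uv(1,2) by (auto simp: F'_def)
        then show ?thesis using uv(3) UM(5) by (auto simp: indep_def)
      qed
    qed
    ultimately show ?thesis
      using UM(1,2) p by (intro exI[of _ "insert p (D \<union> U)"] exI[of _ "insert (p, l) M"]) (auto simp: F'_def)
  qed
qed

text \<open>A vertex \<open>v\<close> with at most one neighbour in the whole forest must lie in
  \<open>U\<close>. Deleting it together with its neighbour in \<open>Z\<close>, if any, costs one
  vertex of \<open>U\<close> and at most one of \<open>Z\<close>; the rest of \<open>Z\<close> is
  not adjacent to \<open>v\<close> and keeps its two neighbours.\<close>

lemma card_heavy_le:
  assumes "finite U" "finite Z" "U \<inter> Z = {}" "acyclic_on E (U \<union> Z)" "\<And>z. z \<in> Z \<Longrightarrow> \<not> thin E U z"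
  shows "card Z \<le> card U"
  using assms
proof (induction "card U" arbitrary: U Z rule: less_induct)
  case less
  show ?case
  proof (cases "Z = {}")
    case False
    then obtain v where v: "v \<in> U \<union> Z" "thin E (U \<union> Z) v"
      using less.prems(4) unfolding acyclic_on_def by (metis Un_empty subset_refl)
    then have "v \<in> U" using less.prems(5) thin_mono[of E "U \<union> Z" v U] by auto
    define Z' where "Z' = {z \<in> Z. \<not> E v z}"
    have thin: "\<not> thin E (U - {v}) z" if z: "z \<in> Z'" for z
    proof -
      obtain a b where "a \<in> U" "b \<in> U" "E z a" "E z b" "a \<noteq> b"
        using less.prems(5)[of z] z by (auto simp: thin_def Z'_def)
      moreover from this have "a \<noteq> v" "b \<noteq> v" using z sym by (auto simp: Z'_def)
      ultimately show ?thesis by (auto simp: thin_def)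
    qed
    have "card Z' \<le> card (U - {v})"
    proof (rule less.hyps)
      show "card (U - {v}) < card U" using \<open>v \<in> U\<close> less.prems(1) by (rule card_Diff1_less[rotated])
      show "acyclic_on E (U - {v} \<union> Z')" by (rule acyclic_on_mono[OF less.prems(4)]) (auto simp: Z'_def)
    qed (use less.prems thin in \<open>auto simp: Z'_def\<close>)
    moreover have "card Z \<le> Suc (card Z')"
    proof (cases "\<exists>z\<in>Z. E v z")
      case True
      then obtain z where "z \<in> Z" "E v z" by auto
      then have "Z = insert z Z'" using v by (auto simp: thin_def Z'_def)
      then show ?thesis by (metis card_insert_le_m1 card_insert_if finite_insert le_SucI le_refl less.prems(2))
    next
      case False
      then have "Z' = Z" by (auto simp: Z'_def)
      then show ?thesis by simp
    qed
    moreover have "card (U - {v}) < card U" using \<open>v \<in> U\<close> less.prems(1) by (rule card_Diff1_less[rotated])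
    ultimately show ?thesis by simp
  qed simp
qed

text \<open>The cover contributes \<open>2 * s\<close> vertices, and the vertices with two
  neighbours in it at most as many again.\<close>

lemma acyclic_structure:
  assumes "finite F" "acyclic_on E F"
    and matching: "\<And>M. M \<subseteq> F \<times> F \<Longrightarrow> induced_matching E M \<Longrightarrow> card M \<le> s"
  shows "\<exists>U\<subseteq>F. card U \<le> 4 * s \<and> indep E (F - U) \<and> (\<forall>v\<in>F - U. thin E U v)"
proof -
  obtain U M where U: "U \<subseteq> F" "M \<subseteq> F \<times> F" "induced_matching E M" "card U \<le> 2 * card M" "indep E (F - U)"
    using acyclic_cover_by_induced_matching[OF assms(1,2)] by blast
  define Z where "Z = {v \<in> F - U. \<not> thin E U v}"
  have fin: "finite U" "finite Z" using U(1) assms(1) finite_subset by (auto simp: Z_def)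
  have "card Z \<le> card U"
    using fin by (rule card_heavy_le) (use U acyclic_on_mono[OF assms(2), of "U \<union> Z"] in \<open>auto simp: Z_def\<close>)
  then have "card (U \<union> Z) \<le> 4 * s"
    using U(4) matching[OF U(2,3)] card_Un_le[of U Z] by linarith
  \<comment> \<open>Adding \<open>Z\<close> to \<open>U\<close> gives \<open>v\<close> no further
    neighbours, since both lie in the independent set \<open>F - U\<close>.\<close>
  moreover have "thin E (U \<union> Z) v" if "v \<in> F - (U \<union> Z)" for v
    using that U(5) by (fastforce simp: Z_def thin_def indep_def)
  ultimately show ?thesis
    using U by (intro exI[of _ "U \<union> Z"]) (auto simp: Z_def intro: indep_mono)
qed

text \<open>In each nonempty finite set of vertices some vertex has no successor,
  so following successors ends and the parity of the number of steps is a proper 2-colouring.\<close>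

lemma two_colouring:
  fixes r :: "'b \<Rightarrow> 'b \<Rightarrow> bool"
  assumes "finite X"
    and unique: "\<And>x y z. x \<in> X \<Longrightarrow> y \<in> X \<Longrightarrow> z \<in> X \<Longrightarrow> r x y \<Longrightarrow> r x z \<Longrightarrow> y = z"
    and sink: "\<And>Y. Y \<subseteq> X \<Longrightarrow> Y \<noteq> {} \<Longrightarrow> \<exists>y\<in>Y. \<forall>z\<in>Y. \<not> r y z"
  shows "\<exists>Y\<subseteq>X. card X \<le> 2 * card Y \<and> (\<forall>y\<in>Y. \<forall>z\<in>Y. \<not> r y z)"
proof -
  define R where "R = {(z, y). y \<in> X \<and> z \<in> X \<and> r y z}"
  have "wf R"
    unfolding wf_eq_minimal
  proof (intro allI impI)
    fix Q :: "'b set" and x assume x: "x \<in> Q"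
    show "\<exists>z\<in>Q. \<forall>y. (y, z) \<in> R \<longrightarrow> y \<notin> Q"
    proof (cases "Q \<inter> X = {}")
      case True
      then show ?thesis using x by (auto simp: R_def)
    next
      case False
      then show ?thesis using sink[of "Q \<inter> X"] by (auto simp: R_def)
    qed
  qed
  \<comment> \<open>Sinks get the colour, and every other element gets it exactly if its successor
    does not.\<close>
  define col where "col = wfrec R (\<lambda>f y. \<forall>z. (z, y) \<in> R \<longrightarrow> \<not> f z)"
  have col: "col y \<longleftrightarrow> (\<forall>z. (z, y) \<in> R \<longrightarrow> \<not> col z)" for y
    using wfrec[OF \<open>wf R\<close>, of "\<lambda>f y. \<forall>z. (z, y) \<in> R \<longrightarrow> \<not> f z" y]
    unfolding col_def[symmetric] by (simp add: cut_def)
  define A where "A = {x \<in> X. col x}"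
  define B where "B = {x \<in> X. \<not> col x}"
  have "X = A \<union> B" by (auto simp: A_def B_def)
  then have "card X \<le> card A + card B" by (metis card_Un_le)
  then have le: "card X \<le> 2 * card A \<or> card X \<le> 2 * card B" by linarith
  have A: "\<not> r y z" if "y \<in> A" "z \<in> A" for y z
    using that col[of y] by (auto simp: A_def R_def)
  \<comment> \<open>An element without the colour has a successor with it, and by
    \<open>unique\<close> that is its only successor.\<close>
  have B: "\<not> r y z" if yz: "y \<in> B" "z \<in> B" for y z
  proof
    assume "r y z"
    obtain u where "(u, y) \<in> R" "col u" using col[of y] yz(1) by (auto simp: B_def)
    then show False using unique[of y u z] \<open>r y z\<close> yz by (auto simp: B_def R_def)
  qed
  have "A \<subseteq> X" "B \<subseteq> X" by (auto simp: A_def B_def)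
  with le show ?thesis
  proof (elim disjE)
    assume "card X \<le> 2 * card A"
    then show ?thesis using A \<open>A \<subseteq> X\<close> by (intro exI[of _ A]) simp
  next
    assume "card X \<le> 2 * card B"
    then show ?thesis using B \<open>B \<subseteq> X\<close> by (intro exI[of _ B]) simp
  qed
qed

text \<open>Take \<open>X0\<close> minimal. Each \<open>x\<close> in \<open>X0\<close> then
  separates a part \<open>C x\<close> from the root \<open>r\<close>, and a neighbour
  \<open>t x\<close> of \<open>x\<close> in \<open>C x\<close> gives an edge
  \<open>(x, t x)\<close>. The adjacencies from one \<open>x\<close> to another \<open>t y\<close>
  can be avoided by a 2-colouring, so half of \<open>X0\<close> yields an induced matching; hence
  \<open>2 * s\<close>.\<close>

lemma conn_on_few_connectors:
  assumes "finite T" "finite X" "T \<inter> X = {}" "indep E X" "conn_on E (T \<union> X)"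
    and matching: "\<And>M. M \<subseteq> (T \<union> X) \<times> (T \<union> X) \<Longrightarrow> induced_matching E M \<Longrightarrow> card M \<le> s"
  shows "\<exists>X0\<subseteq>X. card X0 \<le> 2 * s \<and> conn_on E (T \<union> X0)"
proof (cases "T = {}")
  case True
  then show ?thesis by (intro exI[of _ "{}"]) (auto simp: conn_on_def)
next
  case False
  then obtain r where r: "r \<in> T" by blast
  let ?\<A> = "{Y. Y \<subseteq> X \<and> conn_on E (T \<union> Y)}"
  have "finite ?\<A>" by (rule finite_subset[of _ "Pow X"]) (use assms(2) in auto)
  moreover have "?\<A> \<noteq> {}" using assms(5) by blast
  ultimately have "\<exists>X0\<in>?\<A>. \<forall>K\<in>?\<A>. K \<subseteq> X0 \<longrightarrow> X0 = K"
    by (rule finite_has_minimal)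
  then obtain X0 where X0': "X0 \<in> ?\<A>" "\<forall>K\<in>?\<A>. K \<subseteq> X0 \<longrightarrow> X0 = K" ..
  then have X0: "X0 \<subseteq> X" "conn_on E (T \<union> X0)" by auto
  have min: "K = X0" if "K \<subseteq> X" "conn_on E (T \<union> K)" "K \<subseteq> X0" for K
    using X0'(2)[THEN bspec, of K] that by simp
  define S where "S = T \<union> X0"
  have rS: "r \<in> S" using r by (simp add: S_def)
  \<comment> \<open>Minimality makes \<open>S - {x}\<close> disconnected; of the two sides of a cut,
    the one without \<open>r\<close> is taken.\<close>
  have cut: "\<exists>C. C \<subseteq> S - {x} \<and> C \<noteq> {} \<and> r \<notin> C \<and> (\<forall>u\<in>C. \<forall>v\<in>S - {x}. E u v \<longrightarrow> v \<in> C)"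
    if x: "x \<in> X0" for x
  proof -
    have "T \<union> (X0 - {x}) = S - {x}" using x X0(1) assms(3) by (auto simp: S_def)
    then have "\<not> conn_on E (S - {x})" using min[of "X0 - {x}"] x X0(1) by auto
    then obtain A where A: "A \<subseteq> S - {x}" "A \<noteq> {}" "A \<noteq> S - {x}"
        "\<forall>u\<in>A. \<forall>v\<in>S - {x}. E u v \<longrightarrow> v \<in> A" by (auto simp: conn_on_def)
    show ?thesis
    proof (cases "r \<in> A")
      case True
      then show ?thesis using A sym by (intro exI[of _ "S - {x} - A"]) blast
    next
      case False
      then show ?thesis using A by blast
    qed
  qed
  then have "\<forall>x\<in>X0. \<exists>C. C \<subseteq> S - {x} \<and> C \<noteq> {} \<and> r \<notin> C \<and> (\<forall>u\<in>C. \<forall>v\<in>S - {x}. E u v \<longrightarrow> v \<in> C)"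
    by blast
  from bchoice[OF this] obtain C where C': "\<forall>x\<in>X0. C x \<subseteq> S - {x} \<and> C x \<noteq> {} \<and> r \<notin> C x \<and>
      (\<forall>u\<in>C x. \<forall>v\<in>S - {x}. E u v \<longrightarrow> v \<in> C x)" ..
  have C: "C x \<subseteq> S - {x} \<and> C x \<noteq> {} \<and> r \<notin> C x" if "x \<in> X0" for x
    using C' that by blast
  have closed: "v \<in> C x" if "x \<in> X0" "u \<in> C x" "v \<in> S" "v \<noteq> x" "E u v" for x u v
    using C' that by blast
  \<comment> \<open>Otherwise the union of all \<open>C y\<close> would be closed in
    \<open>S\<close>: an edge leaves \<open>C y\<close> only towards \<open>y\<close>, which lies in
    some \<open>C z\<close>. But the union misses \<open>r\<close>.\<close>
  have escape: "\<exists>y\<in>Y. \<forall>z\<in>Y. y \<notin> C z" if Y: "Y \<subseteq> X0" "Y \<noteq> {}" for Y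
  proof (rule ccontr)
    assume *: "\<not> (\<exists>y\<in>Y. \<forall>z\<in>Y. y \<notin> C z)"
    let ?D = "\<Union>y\<in>Y. C y"
    have Cy: "C y \<subseteq> S" "C y \<noteq> {}" "r \<notin> C y" if "y \<in> Y" for y
      using C[of y] that Y(1) by auto
    then have D: "?D \<subseteq> S" "?D \<noteq> {}" "r \<notin> ?D" using Y(2) by auto
    have D_closed: "v \<in> ?D" if uv: "u \<in> ?D" "v \<in> S" "E u v" for u v
    proof -
      obtain y where y: "y \<in> Y" "u \<in> C y" using uv(1) by auto
      show ?thesis
      proof (cases "v = y")
        case True
        then show ?thesis using * y(1) by auto
      next
        case False
        then have "v \<in> C y" using closed[of y u v] y uv Y(1) by auto
        then show ?thesis using y(1) by auto
      qed
    qed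
    have "?D = S" by (rule conn_onD[OF X0(2)[folded S_def] D(1,2) D_closed])
    then show False using rS D(3) by simp
  qed
  \<comment> \<open>Otherwise \<open>C x\<close> would be closed in all of \<open>S\<close>, not
    only in \<open>S - {x}\<close>.\<close>
  have "\<exists>t\<in>C x. E x t" if x: "x \<in> X0" for x
  proof (rule ccontr)
    assume *: "\<not> (\<exists>t\<in>C x. E x t)"
    have "\<forall>u\<in>C x. \<forall>v\<in>S. E u v \<longrightarrow> v \<in> C x" using * closed[OF x] sym by blast
    moreover have "C x \<subseteq> S" "C x \<noteq> {}" "r \<notin> C x" using C[OF x] by auto
    ultimately show False using X0(2) rS unfolding conn_on_def S_def by blast
  qed
  then obtain t where t: "\<And>x. x \<in> X0 \<Longrightarrow> t x \<in> C x \<and> E x (t x)" by metis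
  have tT: "t x \<in> T" "t x \<in> S" "t x \<notin> X0" if "x \<in> X0" for x
  proof -
    have "t x \<in> S" using C[OF that] t[OF that] by auto
    moreover have "t x \<notin> X" using t[OF that] that X0(1) assms(4) by (auto simp: indep_def)
    ultimately show "t x \<in> T" "t x \<in> S" "t x \<notin> X0" using X0(1) by (auto simp: S_def)
  qed
  have conflict: "x \<in> C y" if "x \<in> X0" "y \<in> X0" "E x (t y)" "x \<noteq> y" for x y
    using closed[of y "t y" x] t[of y] that sym by (auto simp: S_def)
  have asym: False if "x \<in> X0" "y \<in> X0" "x \<in> C y" "y \<in> C x" for x y
    using escape[of "{x, y}"] that C[of x] C[of y] by auto
  \<comment> \<open>Being adjacent to \<open>t y\<close> and \<open>t z\<close>, \<open>x\<close>
    lies in \<open>C y\<close> and in \<open>C z\<close>. Inside \<open>C z\<close> the walk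
    \<open>x\<close>, \<open>t y\<close>, \<open>y\<close> leads to \<open>y\<close>; symmetrically
    \<open>z\<close> lies in \<open>C y\<close>, against \<open>asym\<close>.\<close>
  have unique: "y = z" if "x \<in> X0" "y \<in> X0" "z \<in> X0" "x \<noteq> y \<and> E x (t y)" "x \<noteq> z \<and> E x (t z)" for x y z
  proof (rule ccontr)
    assume "y \<noteq> z"
    have "t y \<in> C z" using closed[of z x "t y"] conflict[of x z] that tT[of y] by auto
    then have "y \<in> C z" using closed[of z "t y" y] t[of y] that \<open>y \<noteq> z\<close> sym by (auto simp: S_def)
    have "t z \<in> C y" using closed[of y x "t z"] conflict[of x y] that tT[of z] by auto
    then have "z \<in> C y" using closed[of y "t z" z] t[of z] that \<open>y \<noteq> z\<close> sym by (auto simp: S_def)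
    show False by (rule asym) fact+
  qed
  have "finite X0" using X0(1) assms(2) by (rule finite_subset)
  have sink: "\<exists>y\<in>Y. \<forall>z\<in>Y. \<not> (y \<noteq> z \<and> E y (t z))" if "Y \<subseteq> X0" "Y \<noteq> {}" for Y
    using escape[OF that] conflict that by blast
  obtain Y where Y: "Y \<subseteq> X0" "card X0 \<le> 2 * card Y" "\<forall>y\<in>Y. \<forall>z\<in>Y. \<not> (y \<noteq> z \<and> E y (t z))"
    using two_colouring[of X0 "\<lambda>x y. x \<noteq> y \<and> E x (t y)"] \<open>finite X0\<close> unique sink by blast
  define M where "M = (\<lambda>y. (y, t y)) ` Y"
  \<comment> \<open>If \<open>t x\<close> and \<open>t y\<close> coincided or were adjacent, each of
    \<open>C x\<close> and \<open>C y\<close> would contain both, and hence \<open>y\<close> and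
    \<open>x\<close> respectively.\<close>
  have tt: "t x \<noteq> t y \<and> \<not> E (t x) (t y)" if "x \<in> Y" "y \<in> Y" "x \<noteq> y" for x y
  proof (rule ccontr)
    assume "\<not> (t x \<noteq> t y \<and> \<not> E (t x) (t y))"
    moreover have xy: "x \<in> X0" "y \<in> X0" using that Y by auto
    ultimately have "t y \<in> C x" "t x \<in> C y"
      using closed[of x "t x" "t y"] closed[of y "t y" "t x"] t[of x] t[of y] tT[of x] tT[of y] sym by auto
    then have "y \<in> C x" "x \<in> C y"
      using closed[of x "t y" y] closed[of y "t x" x] t[of x] t[of y] that xy sym by (auto simp: S_def)
    then show False using asym xy by blast
  qed
  have "induced_matching E M"
    unfolding induced_matching_def
  proof (intro conjI ballI impI)
    fix p assume "p \<in> M" then show "case p of (a, b) \<Rightarrow> E a b" using t Y by (auto simp: M_def)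
  next
    fix p q u v
    assume pq: "p \<in> M" "q \<in> M" "p \<noteq> q" "u \<in> {fst p, snd p}" "v \<in> {fst q, snd q}"
    obtain x y where x: "x \<in> Y" "p = (x, t x)" and y: "y \<in> Y" "q = (y, t y)"
      using pq(1,2) by (auto simp: M_def)
    with pq have xy: "x \<in> Y" "y \<in> Y" "x \<noteq> y" "u \<in> {x, t x}" "v \<in> {y, t y}" by auto
    have X: "x \<in> X0" "y \<in> X0" using xy Y(1) by auto
    then have "\<not> E x y" using X0(1) assms(4) by (auto simp: indep_def)
    moreover have "x \<noteq> t y" "y \<noteq> t x" using X tT(3) by metis+
    moreover have "\<not> E x (t y)" "\<not> E y (t x)" using Y(3) xy by auto
    moreover from this have "\<not> E (t x) y" using sym by blast
    ultimately show "u \<noteq> v" "\<not> E u v" using tt[OF xy(1-3)] xy(3-5) by auto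
  qed
  moreover have "M \<subseteq> (T \<union> X) \<times> (T \<union> X)" using Y X0(1) tT by (auto simp: M_def)
  ultimately have "card M \<le> s" by (rule matching[rotated])
  moreover have "card M = card Y" unfolding M_def by (rule card_image) (auto simp: inj_on_def)
  ultimately show ?thesis using X0 Y(2) by (intro exI[of _ X0]) auto
qed

end

text \<open>Remove the largest vertex \<open>m\<close>. Either \<open>J - {m}\<close> is still
  maximal in the rest and \<open>P\<close> is kept, or some \<open>w\<close> is dominated by
  \<open>m\<close> alone; the pair \<open>(m, w)\<close> is recorded, and the rest shrinks to the
  vertices adjacent to neither end, which keeps \<open>P\<close> an induced matching. The condition
  \<open>v < a\<close> restricts a pair to the vertices that were left when \<open>a\<close> was
  removed.\<close>

lemma maximal_indep_determined:
  fixes E :: "nat \<Rightarrow> nat \<Rightarrow> bool"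
  assumes "sym_graph E" "finite W" "J \<subseteq> W" "indep E J" "\<And>K. K \<subseteq> W \<Longrightarrow> indep E K \<Longrightarrow> J \<subseteq> K \<Longrightarrow> K = J"
  shows "\<exists>P. P \<subseteq> W \<times> W \<and> induced_matching E P \<and>
    (\<forall>v. v \<in> J \<longleftrightarrow> v \<in> W \<and> (\<forall>u\<in>J. u < v \<longrightarrow> \<not> E u v) \<and> (\<forall>(a, b)\<in>P. v < a \<longrightarrow> \<not> E v a \<and> \<not> E v b))"
  using assms(2-)
proof (induction "card W" arbitrary: W J rule: less_induct)
  case less
  interpret sym_graph E by fact
  have dom: "v \<in> J" if "v \<in> W" "\<forall>u\<in>J. \<not> E u v" for v
  proof -
    have "indep E (insert v J)" using that(2) less.prems(3) sym irrefl unfolding indep_def by blast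
    then have "insert v J = J" using that(1) less.prems(2) by (intro less.prems(4)) auto
    then show ?thesis by blast
  qed
  show ?case
  proof (cases "W = {}")
    case True
    then show ?thesis using less.prems(2) by (intro exI[of _ "{}"]) (auto simp: induced_matching_def)
  next
    case False
    define m where "m = Max W"
    have m: "m \<in> W" "\<And>v. v \<in> W \<Longrightarrow> v \<le> m" using False less.prems(1) by (auto simp: m_def)
    define W' where "W' = W - {m}"
    have W': "card W' < card W" "finite W'" "W' \<subseteq> W" "W = insert m W'" "\<And>v. v \<in> W' \<Longrightarrow> v < m"
      using m less.prems(1) card_Diff1_less[OF less.prems(1) m(1)]
      by (auto simp: W'_def le_neq_implies_less)
    show ?thesis
    proof (cases "\<forall>v\<in>W'. (\<forall>u\<in>J - {m}. \<not> E u v) \<longrightarrow> v \<in> J")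
      case True
      have "\<exists>P. P \<subseteq> W' \<times> W' \<and> induced_matching E P \<and>
        (\<forall>v. v \<in> J - {m} \<longleftrightarrow> v \<in> W' \<and> (\<forall>u\<in>J - {m}. u < v \<longrightarrow> \<not> E u v) \<and> (\<forall>(a, b)\<in>P. v < a \<longrightarrow> \<not> E v a \<and> \<not> E v b))"
      proof (rule less.hyps[OF W'(1,2)])
        show "J - {m} \<subseteq> W'" using less.prems(2) by (auto simp: W'_def)
        show "indep E (J - {m})" using less.prems(3) by (rule indep_mono) auto
        show "K = J - {m}" if K: "K \<subseteq> W'" "indep E K" "J - {m} \<subseteq> K" for K
        proof (rule subset_antisym[OF _ K(3)])
          show "K \<subseteq> J - {m}"
          proof
            fix v assume v: "v \<in> K"
            then have "\<forall>u\<in>J - {m}. \<not> E u v" using K(2,3) by (auto simp: indep_def)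
            then show "v \<in> J - {m}" using True v K(1) by (auto simp: W'_def)
          qed
        qed
      qed
      then obtain P where P: "P \<subseteq> W' \<times> W'" "induced_matching E P" and
        J: "\<And>v. v \<in> J - {m} \<longleftrightarrow> v \<in> W' \<and> (\<forall>u\<in>J - {m}. u < v \<longrightarrow> \<not> E u v) \<and> (\<forall>(a, b)\<in>P. v < a \<longrightarrow> \<not> E v a \<and> \<not> E v b)"
        by blast
      have "v \<in> J \<longleftrightarrow> v \<in> W \<and> (\<forall>u\<in>J. u < v \<longrightarrow> \<not> E u v) \<and> (\<forall>(a, b)\<in>P. v < a \<longrightarrow> \<not> E v a \<and> \<not> E v b)" for v
      proof (cases "v = m")
        case True
        have "\<not> m < a" if "(a, b) \<in> P" for a b using that P(1) W'(5)[of a] by auto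
        moreover have "m \<in> J" if h: "\<forall>u\<in>J. u < m \<longrightarrow> \<not> E u m"
        proof (rule dom[OF m(1)], intro ballI)
          fix u assume u: "u \<in> J"
          then have "u \<le> m" using m(2) less.prems(2) by blast
          then show "\<not> E u m" using h u irrefl by (cases "u = m") auto
        qed
        moreover have "m \<in> J \<Longrightarrow> \<forall>u\<in>J. \<not> E u m" using less.prems(3) by (auto simp: indep_def)
        ultimately show ?thesis using True m(1) by auto
      next
        case False
        have "v \<in> W \<Longrightarrow> (\<forall>u\<in>J. u < v \<longrightarrow> \<not> E u v) \<longleftrightarrow> (\<forall>u\<in>J - {m}. u < v \<longrightarrow> \<not> E u v)"
          using m(2)[of v] by auto
        then show ?thesis using J[of v] False W'(4) by auto
      qed
      moreover have "P \<subseteq> W \<times> W" using P(1) W'(3) by auto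
      ultimately show ?thesis using P(2) by blast
    next
      case False
      then obtain w where w: "w \<in> W'" "w \<notin> J" "\<forall>u\<in>J - {m}. \<not> E u w" by blast
      then have "m \<in> J" "E m w" using dom[of w] W'(3) by auto
      define W2 where "W2 = {v \<in> W'. \<not> E v m \<and> \<not> E v w \<and> v \<noteq> w}"
      have JW2: "J - {m} \<subseteq> W2"
        using less.prems(2,3) \<open>m \<in> J\<close> w by (auto simp: W2_def W'_def indep_def)
      have "\<exists>P. P \<subseteq> W2 \<times> W2 \<and> induced_matching E P \<and>
        (\<forall>v. v \<in> J - {m} \<longleftrightarrow> v \<in> W2 \<and> (\<forall>u\<in>J - {m}. u < v \<longrightarrow> \<not> E u v) \<and> (\<forall>(a, b)\<in>P. v < a \<longrightarrow> \<not> E v a \<and> \<not> E v b))"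
      proof (rule less.hyps)
        show "card W2 < card W"
          using W'(1) card_mono[OF W'(2), of W2] by (simp add: W2_def)
        show "finite W2" using W'(2) by (simp add: W2_def)
        show "J - {m} \<subseteq> W2" by fact
        show "indep E (J - {m})" using less.prems(3) by (rule indep_mono) auto
        show "K = J - {m}" if K: "K \<subseteq> W2" "indep E K" "J - {m} \<subseteq> K" for K
        proof -
          \<comment> \<open>\<open>W2\<close> contains no neighbour of \<open>m\<close>, so
            \<open>m\<close> can be added back to \<open>K\<close>; this transfers maximality from
            \<open>W\<close> to \<open>W2\<close>.\<close>
          have "insert m K = J"
          proof (rule less.prems(4))
            show "insert m K \<subseteq> W" using K(1) m(1) W'(3) by (auto simp: W2_def)
            show "indep E (insert m K)" using K(1,2) sym irrefl by (auto simp: W2_def indep_def)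
            show "J \<subseteq> insert m K" using K(3) by auto
          qed
          moreover have "m \<notin> K" using K(1) by (auto simp: W2_def W'_def)
          ultimately show ?thesis by blast
        qed
      qed
      then obtain P where P: "P \<subseteq> W2 \<times> W2" "induced_matching E P" and
        J: "\<And>v. v \<in> J - {m} \<longleftrightarrow> v \<in> W2 \<and> (\<forall>u\<in>J - {m}. u < v \<longrightarrow> \<not> E u v) \<and> (\<forall>(a, b)\<in>P. v < a \<longrightarrow> \<not> E v a \<and> \<not> E v b)"
        by blast
      have "induced_matching E (insert (m, w) P)"
      proof (rule induced_matching_insert[OF P(2) \<open>E m w\<close>])
        fix x assume "x \<in> fst ` P \<union> snd ` P"
        then have "x \<in> W2" using P(1) by auto
        then show "\<not> E m x \<and> \<not> E w x" using sym by (auto simp: W2_def)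
      qed
      moreover have "v \<in> J \<longleftrightarrow> v \<in> W \<and> (\<forall>u\<in>J. u < v \<longrightarrow> \<not> E u v) \<and>
          (\<forall>(a, b)\<in>insert (m, w) P. v < a \<longrightarrow> \<not> E v a \<and> \<not> E v b)" for v
      proof (cases "v = m")
        case True
        have "\<not> m < a" if "(a, b) \<in> P" for a b using that P(1) W'(5)[of a] by (auto simp: W2_def)
        then show ?thesis using True m(1) \<open>m \<in> J\<close> less.prems(3) by (auto simp: indep_def)
      next
        case False
        \<comment> \<open>For vertices below \<open>m\<close> the new pair expresses exactly
          membership in \<open>W2\<close>; \<open>w\<close> itself is excluded as a neighbour of
          \<open>m\<close>.\<close>
        have "v \<in> W2 \<longleftrightarrow> v \<in> W \<and> (v < m \<longrightarrow> \<not> E v m \<and> \<not> E v w)"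
          using False W'(3,4,5) \<open>E m w\<close> sym by (auto simp: W2_def)
        moreover have "v \<in> W \<Longrightarrow> (\<forall>u\<in>J. u < v \<longrightarrow> \<not> E u v) \<longleftrightarrow> (\<forall>u\<in>J - {m}. u < v \<longrightarrow> \<not> E u v)"
          using m(2)[of v] by auto
        ultimately show ?thesis using J[of v] False by auto
      qed
      moreover have "insert (m, w) P \<subseteq> W \<times> W" using P(1) m(1) w(1) W'(3) by (auto simp: W2_def)
      ultimately show ?thesis by blast
    qed
  qed
qed

section \<open>The program\<close>

lemmas ptime_intros = ptime_var ptime_const ptime_read ptime_add ptime_diff ptime_If ptime_pred_conj ptime_pred_disj
  ptime_pred_imp ptime_pred_less ptime_pred_le ptime_pred_eq ptime_pred_not

text \<open>The matrix starts after \<open>n\<close> ones and a zero. The machine cannot multiply,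
  so the row offset \<open>u * n\<close> is a sum over the input length, which exceeds
  \<open>u\<close>.\<close>

definition edge_at :: "nat \<Rightarrow> nat \<Rightarrow> (nat \<Rightarrow> nat) \<Rightarrow> nat \<Rightarrow> nat \<Rightarrow> bool" where
  "edge_at L n A u v \<longleftrightarrow> u < n \<and> v < n \<and> A (Suc n + (\<Sum>i<L. if i < u then n else 0) + v) \<noteq> 0"

definition in_range :: "(nat \<Rightarrow> nat) \<Rightarrow> nat \<Rightarrow> nat \<Rightarrow> nat \<Rightarrow> bool" where
  "in_range T p c v \<longleftrightarrow> (\<exists>j<c. v = T (p + j))"

text \<open>Consecutive entries of \<open>T\<close> from \<open>p\<close> on are read as the pairs
  \<open>P\<close> of \<open>maximal_indep_determined\<close>; a vertex is blocked if it violates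
  their condition.\<close>

definition blocked :: "(nat \<Rightarrow> nat \<Rightarrow> bool) \<Rightarrow> (nat \<Rightarrow> nat) \<Rightarrow> nat \<Rightarrow> nat \<Rightarrow> nat \<Rightarrow> bool" where
  "blocked E T p c v \<longleftrightarrow> (\<exists>j<c. v < T (p + 2 * j) \<and> (E v (T (p + 2 * j)) \<or> E v (T (Suc (p + 2 * j)))))"

text \<open>The recursion of \<open>maximal_indep_determined\<close>, with \<open>W\<close> the
  vertices outside \<open>U\<close> that are thin with respect to \<open>U\<close>. Bounds by
  \<open>L\<close> appear because loops run over the input length.\<close>

definition greedy_step :: "nat \<Rightarrow> nat \<Rightarrow> (nat \<Rightarrow> nat \<Rightarrow> bool) \<Rightarrow> (nat \<Rightarrow> bool) \<Rightarrow> (nat \<Rightarrow> bool) \<Rightarrow>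
    nat \<Rightarrow> (nat \<Rightarrow> nat) \<Rightarrow> nat" where
  "greedy_step L n E U B v J = of_bool (v < n \<and> \<not> U v \<and> thin E {u. u < L \<and> U u} v \<and> \<not> B v \<and>
     (\<forall>u<L. u < v \<and> J u \<noteq> 0 \<longrightarrow> \<not> E u v))"

text \<open>\<open>R\<close> marks the vertices of the supposed forest peeled off so far; a vertex
  with at most one unpeeled neighbour follows.\<close>

definition peel_step :: "nat \<Rightarrow> nat \<Rightarrow> (nat \<Rightarrow> nat \<Rightarrow> bool) \<Rightarrow> (nat \<Rightarrow> nat) \<Rightarrow> nat \<Rightarrow> (nat \<Rightarrow> nat) \<Rightarrow> nat" where
  "peel_step L n E S v R = of_bool (R v \<noteq> 0 \<or>
     v < n \<and> S v = 0 \<and> thin E {u. u < L \<and> u < n \<and> S u = 0 \<and> R u = 0} v)"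

text \<open>The search starts at the least element of \<open>S\<close>, recognised by having no
  smaller one.\<close>

definition reach_step :: "nat \<Rightarrow> (nat \<Rightarrow> nat \<Rightarrow> bool) \<Rightarrow> (nat \<Rightarrow> nat) \<Rightarrow> nat \<Rightarrow> (nat \<Rightarrow> nat) \<Rightarrow> nat" where
  "reach_step L E S v C = of_bool (C v \<noteq> 0 \<or>
     S v \<noteq> 0 \<and> ((\<forall>u<L. u < v \<longrightarrow> S u = 0) \<or> (\<exists>u<L. C u \<noteq> 0 \<and> E u v)))"

definition verdict :: "bool \<Rightarrow> nat \<Rightarrow> nat \<Rightarrow> (nat \<Rightarrow> nat \<Rightarrow> bool) \<Rightarrow> nat \<Rightarrow> (nat \<Rightarrow> nat) \<Rightarrow> bool" where
  "verdict conn L n E k S \<longleftrightarrow>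
     (\<forall>v<L. v < n \<and> S v = 0 \<longrightarrow> iter_array L (peel_step L n E S) v \<noteq> 0) \<and>
     (conn \<longrightarrow> (\<forall>v<L. S v \<noteq> 0 \<longrightarrow> iter_array L (reach_step L E S) v \<noteq> 0)) \<and>
     (\<Sum>v<L. S v) \<le> k"

text \<open>The second iteration ignores its array argument: it only tabulates the set, as the tests
  read it from an array.\<close>

definition candidate :: "nat \<Rightarrow> nat \<Rightarrow> (nat \<Rightarrow> nat \<Rightarrow> bool) \<Rightarrow> (nat \<Rightarrow> bool) \<Rightarrow> (nat \<Rightarrow> bool) \<Rightarrow> (nat \<Rightarrow> bool) \<Rightarrow>
    nat \<Rightarrow> nat" where
  "candidate L n E U X B = (let J = iter_array L (greedy_step L n E U B) in
     iter_array L (\<lambda>v _. of_bool (v < n \<and> \<not> U v \<and> (J v = 0 \<or> X v))))"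

text \<open>Allocation of variables in the programs below: 0 is the length of the input, 1 and 4 to 6 are
  loop counters, 2 is the number of vertices, 3 the bound \<open>k\<close>, 7 the position of the sign bit, and
  the guessed tuple starts at 10. Array 0 is the input.\<close>

abbreviation edge_in :: "(nat \<Rightarrow> nat) \<Rightarrow> (nat \<Rightarrow> nat \<Rightarrow> nat) \<Rightarrow> nat \<Rightarrow> nat \<Rightarrow> bool" where
  "edge_in \<rho> \<alpha> \<equiv> edge_at (\<rho> 0) (\<rho> 2) (\<alpha> 0)"

text \<open>Variable 1 is the counter of the sum that replaces a multiplication, so no vertex may be
  kept there.\<close>

lemma ptime_pred_edge:
  assumes "i \<noteq> 1" "j \<noteq> 1"
  shows "ptime_pred (\<lambda>\<rho> \<alpha>. edge_in \<rho> \<alpha> (\<rho> i) (\<rho> j))"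
proof -
  have mult: "ptime (\<lambda>\<rho> \<alpha>. \<Sum>v<\<rho> 0. if v < \<rho> i then \<rho> 2 else 0)"
  proof (rule ptime_sum[where x = 1])
    show "ptime (\<lambda>\<rho> \<alpha>. if \<rho> 1 < \<rho> i then \<rho> 2 else 0)" by (intro ptime_intros)
  qed (use assms in auto)
  have "ptime_pred (\<lambda>\<rho> \<alpha>. \<rho> i < \<rho> 2 \<and> \<rho> j < \<rho> 2 \<and>
      \<not> \<alpha> 0 (1 + \<rho> 2 + (\<Sum>v<\<rho> 0. if v < \<rho> i then \<rho> 2 else 0) + \<rho> j) = 0)"
    by (intro ptime_intros mult)
  then show ?thesis by (simp add: edge_at_def)
qed

lemma ptime_pred_in_range: "ptime_pred (\<lambda>\<rho> \<alpha>. in_range (\<lambda>j. \<rho> (10 + j)) p c (\<rho> i))"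
  unfolding in_range_def by (intro ptime_pred_finite_bex ptime_intros)

lemma ptime_pred_blocked: "ptime_pred (\<lambda>\<rho> \<alpha>. blocked (edge_in \<rho> \<alpha>) (\<lambda>j. \<rho> (10 + j)) p c (\<rho> 6))"
  unfolding blocked_def by (intro ptime_pred_finite_bex ptime_intros ptime_pred_edge) auto

text \<open>Variable 6 holds the tested vertex, while 4 and 5 run over pairs of possible neighbours;
  hence \<open>P\<close> has to be decidable at both.\<close>

lemma ptime_pred_thin:
  assumes P: "\<And>i. i = 4 \<or> i = 5 \<Longrightarrow> ptime_pred (\<lambda>\<rho> \<alpha>. P (\<rho> i) \<rho> \<alpha>)"
    and dep: "\<And>i v w \<rho> \<alpha>. i = 4 \<or> i = 5 \<Longrightarrow> P v (\<rho>(i := w)) \<alpha> = P v \<rho> \<alpha>"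
  shows "ptime_pred (\<lambda>\<rho> \<alpha>. thin (edge_in \<rho> \<alpha>) {u. u < \<rho> 0 \<and> P u \<rho> \<alpha>} (\<rho> 6))"
proof -
  let ?Q = "\<lambda>\<rho> \<alpha> u v. P u \<rho> \<alpha> \<and> P v \<rho> \<alpha> \<and> edge_in \<rho> \<alpha> (\<rho> 6) u \<and> edge_in \<rho> \<alpha> (\<rho> 6) v \<longrightarrow> u = v"
  have "ptime_pred (\<lambda>\<rho> \<alpha>. \<forall>u<\<rho> 0. \<forall>v<\<rho> 0. ?Q \<rho> \<alpha> u v)"
  proof (rule ptime_pred_ball[where x = 4])
    show "ptime_pred (\<lambda>\<rho> \<alpha>. \<forall>v<\<rho> 0. ?Q \<rho> \<alpha> (\<rho> 4) v)"
    proof (rule ptime_pred_ball[where x = 5])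
      show "ptime_pred (\<lambda>\<rho> \<alpha>. ?Q \<rho> \<alpha> (\<rho> 4) (\<rho> 5))"
        by (intro ptime_intros ptime_pred_edge P) auto
    qed (auto simp: dep)
  qed (auto simp: dep)
  then show ?thesis by (rule ptime_cong) (auto simp: thin_def)
qed

lemma ptime_greedy_step:
  "ptime (\<lambda>\<rho> \<alpha>. greedy_step (\<rho> 0) (\<rho> 2) (edge_in \<rho> \<alpha>) (in_range (\<lambda>j. \<rho> (10 + j)) 0 a)
      (blocked (edge_in \<rho> \<alpha>) (\<lambda>j. \<rho> (10 + j)) (a + b) c) (\<rho> 6) (\<alpha> 1))"
proof -
  have ball: "ptime_pred (\<lambda>\<rho> \<alpha>. \<forall>u<\<rho> 0. u < \<rho> 6 \<and> \<alpha> 1 u \<noteq> 0 \<longrightarrow> \<not> edge_in \<rho> \<alpha> u (\<rho> 6))"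
  proof (rule ptime_pred_ball[where x = 4])
    show "ptime_pred (\<lambda>\<rho> \<alpha>. \<rho> 4 < \<rho> 6 \<and> \<alpha> 1 (\<rho> 4) \<noteq> 0 \<longrightarrow> \<not> edge_in \<rho> \<alpha> (\<rho> 4) (\<rho> 6))"
      by (intro ptime_intros ptime_pred_edge) auto
  qed auto
  show ?thesis
    unfolding greedy_step_def
    by (intro ptime_pred_conj ptime_pred_thin ptime_pred_not[OF ptime_pred_blocked] ptime_pred_not ptime_pred_less
        ptime_pred_in_range ptime_var ball) auto
qed

lemma ptime_pred_forest_check:
  "ptime_pred (\<lambda>\<rho> \<alpha>. \<forall>v<\<rho> 0. v < \<rho> 2 \<and> \<alpha> 2 v = 0 \<longrightarrow>
     iter_array (\<rho> 0) (peel_step (\<rho> 0) (\<rho> 2) (edge_in \<rho> \<alpha>) (\<alpha> 2)) v \<noteq> 0)"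
proof (rule ptime_let_array[where x = 6 and a = 3
      and F = "\<lambda>v R \<rho> \<alpha>. peel_step (\<rho> 0) (\<rho> 2) (edge_in \<rho> \<alpha>) (\<alpha> 2) v R"
      and G = "\<lambda>R \<rho> \<alpha>. of_bool (\<forall>v<\<rho> 0. v < \<rho> 2 \<and> \<alpha> 2 v = 0 \<longrightarrow> R v \<noteq> 0)"])
  show "ptime (\<lambda>\<rho> \<alpha>. peel_step (\<rho> 0) (\<rho> 2) (edge_in \<rho> \<alpha>) (\<alpha> 2) (\<rho> 6) (\<alpha> 3))"
    unfolding peel_step_def
    by (intro ptime_pred_thin ptime_intros) auto
  show "ptime_pred (\<lambda>\<rho> \<alpha>. \<forall>v<\<rho> 0. v < \<rho> 2 \<and> \<alpha> 2 v = 0 \<longrightarrow> \<alpha> 3 v \<noteq> 0)"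
  proof (rule ptime_pred_ball[where x = 6])
    show "ptime_pred (\<lambda>\<rho> \<alpha>. \<rho> 6 < \<rho> 2 \<and> \<alpha> 2 (\<rho> 6) = 0 \<longrightarrow> \<alpha> 3 (\<rho> 6) \<noteq> 0)" by (intro ptime_intros)
  qed auto
qed auto

lemma ptime_pred_conn_check:
  "ptime_pred (\<lambda>\<rho> \<alpha>. \<forall>v<\<rho> 0. \<alpha> 2 v \<noteq> 0 \<longrightarrow> iter_array (\<rho> 0) (reach_step (\<rho> 0) (edge_in \<rho> \<alpha>) (\<alpha> 2)) v \<noteq> 0)"
proof (rule ptime_let_array[where x = 6 and a = 3
      and F = "\<lambda>v C \<rho> \<alpha>. reach_step (\<rho> 0) (edge_in \<rho> \<alpha>) (\<alpha> 2) v C"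
      and G = "\<lambda>C \<rho> \<alpha>. of_bool (\<forall>v<\<rho> 0. \<alpha> 2 v \<noteq> 0 \<longrightarrow> C v \<noteq> 0)"])
  have 1: "ptime_pred (\<lambda>\<rho> \<alpha>. \<forall>u<\<rho> 0. u < \<rho> 6 \<longrightarrow> \<alpha> 2 u = 0)"
  proof (rule ptime_pred_ball[where x = 4])
    show "ptime_pred (\<lambda>\<rho> \<alpha>. \<rho> 4 < \<rho> 6 \<longrightarrow> \<alpha> 2 (\<rho> 4) = 0)" by (intro ptime_intros)
  qed auto
  have 2: "ptime_pred (\<lambda>\<rho> \<alpha>. \<exists>u<\<rho> 0. \<alpha> 3 u \<noteq> 0 \<and> edge_in \<rho> \<alpha> u (\<rho> 6))"
  proof (rule ptime_pred_bex[where x = 4])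
    show "ptime_pred (\<lambda>\<rho> \<alpha>. \<alpha> 3 (\<rho> 4) \<noteq> 0 \<and> edge_in \<rho> \<alpha> (\<rho> 4) (\<rho> 6))"
      by (intro ptime_intros ptime_pred_edge) auto
  qed auto
  show "ptime (\<lambda>\<rho> \<alpha>. reach_step (\<rho> 0) (edge_in \<rho> \<alpha>) (\<alpha> 2) (\<rho> 6) (\<alpha> 3))"
    unfolding reach_step_def by (intro ptime_intros 1 2)
  show "ptime_pred (\<lambda>\<rho> \<alpha>. \<forall>v<\<rho> 0. \<alpha> 2 v \<noteq> 0 \<longrightarrow> \<alpha> 3 v \<noteq> 0)"
  proof (rule ptime_pred_ball[where x = 6])
    show "ptime_pred (\<lambda>\<rho> \<alpha>. \<alpha> 2 (\<rho> 6) \<noteq> 0 \<longrightarrow> \<alpha> 3 (\<rho> 6) \<noteq> 0)" by (intro ptime_intros)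
  qed auto
qed auto

lemma ptime_pred_verdict:
  "ptime_pred (\<lambda>\<rho> \<alpha>. verdict conn (\<rho> 0) (\<rho> 2) (edge_in \<rho> \<alpha>) (\<rho> 3) (\<alpha> 2))"
proof -
  have "ptime (\<lambda>\<rho> \<alpha>. \<Sum>v<\<rho> 0. \<alpha> 2 v)"
  proof (rule ptime_sum[where x = 6])
    show "ptime (\<lambda>\<rho> \<alpha>. \<alpha> 2 (\<rho> 6))" by (intro ptime_intros)
  qed auto
  then show ?thesis
    unfolding verdict_def
    by (intro ptime_pred_conj ptime_pred_imp ptime_pred_const ptime_pred_forest_check ptime_pred_conn_check ptime_pred_le ptime_var)
qed

text \<open>Array 1 holds the greedy set, array 2 the candidate, and array 3 is used by both
  tests.\<close>

lemma ptime_pred_candidate_verdict: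
  "ptime_pred (\<lambda>\<rho> \<alpha>. verdict conn (\<rho> 0) (\<rho> 2) (edge_in \<rho> \<alpha>) (\<rho> 3)
     (candidate (\<rho> 0) (\<rho> 2) (edge_in \<rho> \<alpha>) (in_range (\<lambda>j. \<rho> (10 + j)) 0 a) (in_range (\<lambda>j. \<rho> (10 + j)) a b)
        (blocked (edge_in \<rho> \<alpha>) (\<lambda>j. \<rho> (10 + j)) (a + b) c)))"
  unfolding candidate_def Let_def
proof (rule ptime_let_array[where x = 6 and a = 1
      and F = "\<lambda>v J \<rho> \<alpha>. greedy_step (\<rho> 0) (\<rho> 2) (edge_in \<rho> \<alpha>) (in_range (\<lambda>j. \<rho> (10 + j)) 0 a)
        (blocked (edge_in \<rho> \<alpha>) (\<lambda>j. \<rho> (10 + j)) (a + b) c) v J"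
      and G = "\<lambda>J \<rho> \<alpha>. of_bool (verdict conn (\<rho> 0) (\<rho> 2) (edge_in \<rho> \<alpha>) (\<rho> 3)
        (iter_array (\<rho> 0) (\<lambda>v _. of_bool (v < \<rho> 2 \<and> \<not> in_range (\<lambda>j. \<rho> (10 + j)) 0 a v \<and>
           (J v = 0 \<or> in_range (\<lambda>j. \<rho> (10 + j)) a b v)))))"])
  show "ptime_pred (\<lambda>\<rho> \<alpha>. verdict conn (\<rho> 0) (\<rho> 2) (edge_in \<rho> \<alpha>) (\<rho> 3)
        (iter_array (\<rho> 0) (\<lambda>v _. of_bool (v < \<rho> 2 \<and> \<not> in_range (\<lambda>j. \<rho> (10 + j)) 0 a v \<and>
           (\<alpha> 1 v = 0 \<or> in_range (\<lambda>j. \<rho> (10 + j)) a b v)))))"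
  proof (rule ptime_let_array[where x = 6 and a = 2
      and F = "\<lambda>v S \<rho> \<alpha>. of_bool (v < \<rho> 2 \<and> \<not> in_range (\<lambda>j. \<rho> (10 + j)) 0 a v \<and>
           (\<alpha> 1 v = 0 \<or> in_range (\<lambda>j. \<rho> (10 + j)) a b v))"
      and G = "\<lambda>S \<rho> \<alpha>. of_bool (verdict conn (\<rho> 0) (\<rho> 2) (edge_in \<rho> \<alpha>) (\<rho> 3) S)"])
    show "ptime_pred (\<lambda>\<rho> \<alpha>. \<rho> 6 < \<rho> 2 \<and> \<not> in_range (\<lambda>j. \<rho> (10 + j)) 0 a (\<rho> 6) \<and>
           (\<alpha> 1 (\<rho> 6) = 0 \<or> in_range (\<lambda>j. \<rho> (10 + j)) a b (\<rho> 6)))"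
      by (intro ptime_intros ptime_pred_in_range)
  qed (auto intro: ptime_pred_verdict)
qed (use ptime_greedy_step in auto)

text \<open>The length of the leading run of ones: a position counts if no zero occurs up to and
  including it.\<close>

definition decode_n :: "nat \<Rightarrow> (nat \<Rightarrow> nat) \<Rightarrow> nat" where
  "decode_n L A = (\<Sum>i<L. of_bool (\<forall>j<L. j \<le> i \<longrightarrow> A j \<noteq> 0))"

definition sign_position :: "nat \<Rightarrow> nat \<Rightarrow> nat" where
  "sign_position L n = Suc n + (\<Sum>i<L. if i < n then n else 0)"

text \<open>\<open>P\<close> tabulates the powers of two by doubling. With unit costs their size
  does not affect the time, and cells beyond the input read as 0 bits.\<close>

definition decode_k :: "nat \<Rightarrow> nat \<Rightarrow> (nat \<Rightarrow> nat) \<Rightarrow> nat" where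
  "decode_k L p A = (let P = iter_array L (\<lambda>v P. if v = 0 then 1 else P (v - 1) + P (v - 1)) in
     \<Sum>i<L. if A (Suc p + i) \<noteq> 0 then P i else 0)"

definition accepts :: "bool \<Rightarrow> nat \<Rightarrow> nat \<Rightarrow> nat \<Rightarrow> nat \<Rightarrow> (nat \<Rightarrow> nat) \<Rightarrow> bool" where
  "accepts conn a b c L A \<longleftrightarrow> (let n = decode_n L A; p = sign_position L n; E = edge_at L n A in
     A p = 0 \<and> (\<exists>T. (\<forall>j<a + b + 2 * c. T j < L) \<and>
       verdict conn L n E (decode_k L p A)
         (candidate L n E (in_range T 0 a) (in_range T a b) (blocked E T (a + b) c))))"

lemma ptime_decode_n: "ptime (\<lambda>\<rho> \<alpha>. decode_n (\<rho> 0) (\<alpha> 0))"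
  unfolding decode_n_def
proof (rule ptime_sum[where x = 4])
  show "ptime_pred (\<lambda>\<rho> \<alpha>. \<forall>j<\<rho> 0. j \<le> \<rho> 4 \<longrightarrow> \<alpha> 0 j \<noteq> 0)"
  proof (rule ptime_pred_ball[where x = 5])
    show "ptime_pred (\<lambda>\<rho> \<alpha>. \<rho> 5 \<le> \<rho> 4 \<longrightarrow> \<alpha> 0 (\<rho> 5) \<noteq> 0)" by (intro ptime_intros)
  qed auto
qed auto

lemma ptime_sign_position: "ptime (\<lambda>\<rho> \<alpha>. sign_position (\<rho> 0) (\<rho> 2))"
proof -
  have "ptime (\<lambda>\<rho> \<alpha>. \<Sum>i<\<rho> 0. if i < \<rho> 2 then \<rho> 2 else 0)"
  proof (rule ptime_sum[where x = 4])
    show "ptime (\<lambda>\<rho> \<alpha>. if \<rho> 4 < \<rho> 2 then \<rho> 2 else 0)" by (intro ptime_intros)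
  qed auto
  from ptime_add[OF ptime_add[OF ptime_const[of 1] ptime_var[of 2]] this] show ?thesis
    by (simp add: sign_position_def)
qed

lemma ptime_decode_k: "ptime (\<lambda>\<rho> \<alpha>. decode_k (\<rho> 0) (\<rho> 7) (\<alpha> 0))"
  unfolding decode_k_def Let_def
proof (rule ptime_let_array[where x = 4 and a = 1
      and F = "\<lambda>v P \<rho> \<alpha>. if v = 0 then 1 else P (v - 1) + P (v - 1)"
      and G = "\<lambda>P \<rho> \<alpha>. \<Sum>i<\<rho> 0. if \<alpha> 0 (Suc (\<rho> 7) + i) \<noteq> 0 then P i else 0"])
  show "ptime (\<lambda>\<rho> \<alpha>. if \<rho> 4 = 0 then 1 else \<alpha> 1 (\<rho> 4 - 1) + \<alpha> 1 (\<rho> 4 - 1))"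
    by (intro ptime_intros)
  show "ptime (\<lambda>\<rho> \<alpha>. \<Sum>i<\<rho> 0. if \<alpha> 0 (Suc (\<rho> 7) + i) \<noteq> 0 then \<alpha> 1 i else 0)"
  proof (rule ptime_sum[where x = 5])
    have "ptime (\<lambda>\<rho> \<alpha>. if \<alpha> 0 (1 + \<rho> 7 + \<rho> 5) \<noteq> 0 then \<alpha> 1 (\<rho> 5) else 0)" by (intro ptime_intros)
    then show "ptime (\<lambda>\<rho> \<alpha>. if \<alpha> 0 (Suc (\<rho> 7) + \<rho> 5) \<noteq> 0 then \<alpha> 1 (\<rho> 5) else 0)" by simp
  qed auto
qed auto

lemma in_range_cong: "(\<And>j. j < p + c \<Longrightarrow> T j = T' j) \<Longrightarrow> in_range T p c = in_range T' p c"
  by (auto simp: in_range_def fun_eq_iff)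

lemma blocked_cong: "(\<And>j. j < p + 2 * c \<Longrightarrow> T j = T' j) \<Longrightarrow> blocked E T p c = blocked E T' p c"
  by (auto simp: blocked_def fun_eq_iff)

lemma ptime_pred_accepts: "ptime_pred (\<lambda>\<rho> \<alpha>. accepts conn a b c (\<rho> 0) (\<alpha> 0))"
proof -
  define cand where "cand \<rho> \<alpha> n k T \<longleftrightarrow> (let L = \<rho> 0; E = edge_at L n (\<alpha> 0) in verdict conn L n E k
    (candidate L n E (in_range T 0 a) (in_range T a b) (blocked E T (a + b) c)))"
    for \<rho> :: "nat \<Rightarrow> nat" and \<alpha> :: "nat \<Rightarrow> nat \<Rightarrow> nat" and n k T
  \<comment> \<open>The independence from variables other than 0 gives the side conditions of
    \<open>ptime_let\<close>; the restriction to finitely many entries of \<open>T\<close> makes the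
    variables after the guessed block irrelevant.\<close>
  have cand_cong: "cand \<rho> \<alpha> n k T \<longleftrightarrow> cand \<rho>' \<alpha> n k T'"
    if "\<rho> 0 = \<rho>' 0" "\<And>j. j < a + b + 2 * c \<Longrightarrow> T j = T' j" for \<rho> \<rho>' \<alpha> n k T T'
  proof -
    have "in_range T 0 a = in_range T' 0 a" "in_range T a b = in_range T' a b"
      "blocked E T (a + b) c = blocked E T' (a + b) c" for E
      using that by (auto intro!: in_range_cong blocked_cong)
    then show ?thesis using that(1) by (simp add: cand_def)
  qed
  have "ptime_pred (\<lambda>\<rho> \<alpha>. cand \<rho> \<alpha> (\<rho> 2) (\<rho> 3) (\<lambda>j. \<rho> (10 + j)))"
    using ptime_pred_candidate_verdict[of conn a b c] by (simp add: cand_def Let_def)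
  then have "ptime_pred (\<lambda>\<rho> \<alpha>. \<exists>T. (\<forall>j<a + b + 2 * c. T j < \<rho> 0) \<and> cand \<rho> \<alpha> (\<rho> 2) (\<rho> 3) T)"
  proof (rule ptime_cong[OF ptime_pred_ex_tuple[of _ 10 "a + b + 2 * c"]])
    fix \<rho> \<alpha>
    have "cand (\<lambda>i. if 10 \<le> i \<and> i < 10 + (a + b + 2 * c) then T (i - 10) else \<rho> i) \<alpha> (\<rho> 2) (\<rho> 3)
        (\<lambda>j. if j < a + b + 2 * c then T (10 + j - 10) else \<rho> (10 + j)) \<longleftrightarrow> cand \<rho> \<alpha> (\<rho> 2) (\<rho> 3) T" for T
      by (rule cand_cong) auto
    then show "of_bool (\<exists>T. (\<forall>j<a + b + 2 * c. T j < \<rho> 0) \<and>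
        (\<lambda>\<rho> \<alpha>. cand \<rho> \<alpha> (\<rho> 2) (\<rho> 3) (\<lambda>j. \<rho> (10 + j)))
          (\<lambda>i. if 10 \<le> i \<and> i < 10 + (a + b + 2 * c) then T (i - 10) else \<rho> i) \<alpha>) =
      (of_bool (\<exists>T. (\<forall>j<a + b + 2 * c. T j < \<rho> 0) \<and> cand \<rho> \<alpha> (\<rho> 2) (\<rho> 3) T) :: nat)"
      by simp
  qed simp_all
  \<comment> \<open>The bindings are added from the inside out: the bound in variable 3, the sign
    position in 7, the number of vertices in 2, each computed from those further out.\<close>
  then have 3: "ptime_pred (\<lambda>\<rho> \<alpha>. \<exists>T. (\<forall>j<a + b + 2 * c. T j < \<rho> 0) \<and>
      cand \<rho> \<alpha> (\<rho> 2) (decode_k (\<rho> 0) (\<rho> 7) (\<alpha> 0)) T)"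
    by (rule ptime_let[where x = 3 and e = "\<lambda>\<rho> \<alpha>. decode_k (\<rho> 0) (\<rho> 7) (\<alpha> 0)"
      and F = "\<lambda>v \<rho> \<alpha>. of_bool (\<exists>T. (\<forall>j<a + b + 2 * c. T j < \<rho> 0) \<and> cand \<rho> \<alpha> (\<rho> 2) v T)", OF ptime_decode_k])
      (auto simp: cand_def)
  have "ptime_pred (\<lambda>\<rho> \<alpha>. \<alpha> 0 (\<rho> 7) = 0 \<and> (\<exists>T. (\<forall>j<a + b + 2 * c. T j < \<rho> 0) \<and>
      cand \<rho> \<alpha> (\<rho> 2) (decode_k (\<rho> 0) (\<rho> 7) (\<alpha> 0)) T))"
    by (intro ptime_pred_conj ptime_intros 3)
  then have "ptime_pred (\<lambda>\<rho> \<alpha>. \<alpha> 0 (sign_position (\<rho> 0) (\<rho> 2)) = 0 \<and> (\<exists>T. (\<forall>j<a + b + 2 * c. T j < \<rho> 0) \<and>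
      cand \<rho> \<alpha> (\<rho> 2) (decode_k (\<rho> 0) (sign_position (\<rho> 0) (\<rho> 2)) (\<alpha> 0)) T))"
    by (rule ptime_let[where x = 7 and e = "\<lambda>\<rho> \<alpha>. sign_position (\<rho> 0) (\<rho> 2)"
      and F = "\<lambda>v \<rho> \<alpha>. of_bool (\<alpha> 0 v = 0 \<and> (\<exists>T. (\<forall>j<a + b + 2 * c. T j < \<rho> 0) \<and>
        cand \<rho> \<alpha> (\<rho> 2) (decode_k (\<rho> 0) v (\<alpha> 0)) T))", OF ptime_sign_position])
      (auto simp: cand_def)
  then have "ptime_pred (\<lambda>\<rho> \<alpha>. \<alpha> 0 (sign_position (\<rho> 0) (decode_n (\<rho> 0) (\<alpha> 0))) = 0 \<and>
      (\<exists>T. (\<forall>j<a + b + 2 * c. T j < \<rho> 0) \<and> cand \<rho> \<alpha> (decode_n (\<rho> 0) (\<alpha> 0))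
        (decode_k (\<rho> 0) (sign_position (\<rho> 0) (decode_n (\<rho> 0) (\<alpha> 0))) (\<alpha> 0)) T))"
    by (rule ptime_let[where x = 2 and e = "\<lambda>\<rho> \<alpha>. decode_n (\<rho> 0) (\<alpha> 0)"
      and F = "\<lambda>v \<rho> \<alpha>. of_bool (\<alpha> 0 (sign_position (\<rho> 0) v) = 0 \<and> (\<exists>T. (\<forall>j<a + b + 2 * c. T j < \<rho> 0) \<and>
        cand \<rho> \<alpha> v (decode_k (\<rho> 0) (sign_position (\<rho> 0) v) (\<alpha> 0)) T))", OF ptime_decode_n])
      (auto simp: cand_def)
  then show ?thesis by (simp add: accepts_def cand_def Let_def)
qed

section \<open>Correctness of the program\<close>

definition adj :: "'a graph \<Rightarrow> 'a \<Rightarrow> 'a \<Rightarrow> bool" where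
  "adj G u v \<longleftrightarrow> {u, v} \<in> edges G"

lemma adj_verts:
  assumes "simple_graph G" "adj G u v"
  shows "u \<in> verts G" "v \<in> verts G"
  using assms by (auto simp: simple_graph_def adj_def)

lemma sym_graph_adj: "simple_graph G \<Longrightarrow> sym_graph (adj G)"
  by unfold_locales (auto simp: adj_def simple_graph_def insert_commute)

text \<open>Any \<open>s\<close> pairs of \<open>M\<close> induce \<open>sP_2\<close>:
  \<open>g\<close> maps the two vertices of the \<open>i\<close>-th copy to the ends of the
  \<open>i\<close>-th pair, and its inverse is the isomorphism.\<close>

lemma card_le_induced_matching:
  assumes G: "simple_graph G" and free: "sP2_free s G"
    and M: "M \<subseteq> verts G \<times> verts G" "induced_matching (adj G) M"
  shows "card M \<le> s"
proof (rule ccontr)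
  assume "\<not> card M \<le> s"
  interpret sym_graph "adj G" using G by (rule sym_graph_adj)
  have "finite M" using M(1) G by (auto simp: simple_graph_def intro: finite_subset)
  obtain M' where M': "M' \<subseteq> M" "card M' = s" "finite M'"
    using \<open>\<not> card M \<le> s\<close> obtain_subset_with_card_n[of s M] by auto
  obtain h where h: "bij_betw h {..<s} M'"
    using ex_bij_betw_nat_finite[OF M'(3)] M'(2) by (auto simp: atLeast0LessThan)
  define g where "g p = (if snd p = 0 then fst (h (fst p)) else snd (h (fst p)))" for p :: "nat \<times> nat"
  let ?P = "{..<s} \<times> {..<2::nat}"
  have hM: "h i \<in> M" if "i < s" for i using h M'(1) that by (auto simp: bij_betw_def)
  have g_in: "g p \<in> {fst (h (fst p)), snd (h (fst p))}" for p by (simp add: g_def)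
  have E: "adj G (g p) (g q) \<longleftrightarrow> fst p = fst q \<and> {snd p, snd q} = {0, 1}"
    and inj: "g p = g q \<longleftrightarrow> p = q" if p: "p \<in> ?P" and q: "q \<in> ?P" for p q
  proof -
    have edge: "adj G (fst (h i)) (snd (h i))" "adj G (snd (h i)) (fst (h i))" if "i < s" for i
      using M(2) hM[OF that] sym by (auto simp: induced_matching_def split: prod.splits)
    have *: "(adj G (g p) (g q) \<longleftrightarrow> fst p = fst q \<and> {snd p, snd q} = {0, 1}) \<and> (g p = g q \<longleftrightarrow> p = q)"
    proof (cases "fst p = fst q")
      case True
      obtain i x y where pq: "p = (i, x)" "q = (i, y)" using True by (metis prod.collapse)
      then have "i < s" "x = 0 \<or> x = 1" "y = 0 \<or> y = 1" using p q by auto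
      moreover have "fst (h i) \<noteq> snd (h i)" using edge(1)[OF \<open>i < s\<close>] irrefl by metis
      ultimately show ?thesis using edge[of i] irrefl by (auto simp: pq g_def doubleton_eq_iff)
    next
      case False
      then have "h (fst p) \<noteq> h (fst q)" using h p q by (auto simp: bij_betw_def inj_on_def)
      then have "g p \<noteq> g q \<and> \<not> adj G (g p) (g q)"
        using M(2) hM[of "fst p"] hM[of "fst q"] p q g_in[of p] g_in[of q]
        unfolding induced_matching_def by (metis SigmaE fst_conv lessThan_iff)
      then show ?thesis using False by auto
    qed
    show "adj G (g p) (g q) \<longleftrightarrow> fst p = fst q \<and> {snd p, snd q} = {0, 1}" by (rule conjunct1[OF *])
    show "g p = g q \<longleftrightarrow> p = q" by (rule conjunct2[OF *])
  qed
  define W where "W = g ` ?P"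
  have "W \<subseteq> verts G"
  proof
    fix w assume "w \<in> W"
    then obtain p where "p \<in> ?P" "w = g p" by (auto simp: W_def)
    then show "w \<in> verts G" using hM[of "fst p"] g_in[of p] M(1) by (auto simp: mem_Times_iff)
  qed
  have bij: "bij_betw g ?P W" using inj by (auto simp: bij_betw_def W_def inj_on_def)
  define f where "f = inv_into ?P g"
  have f: "f u \<in> ?P" "g (f u) = u" if "u \<in> W" for u
    using that bij by (auto simp: f_def W_def inv_into_into f_inv_into_f)
  have edges: "{p, q} \<in> edges (disjoint_copies s (path_graph 2)) \<longleftrightarrow> fst p = fst q \<and> {snd p, snd q} = {0, 1}"
    if p: "p \<in> ?P" and q: "q \<in> ?P" for p q
  proof -
    have "edges (path_graph 2) = {{0, 1}}"
      by (auto simp: path_graph_def numeral_2_eq_2 less_Suc_eq)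
    then have "edges (disjoint_copies s (path_graph 2)) = {{(i, 0), (i, 1)} | i. i < s}"
      by (auto simp: disjoint_copies_def)
    then show ?thesis using p q by (cases p; cases q) (auto simp: doubleton_eq_iff)
  qed
  have "isomorphic (induced_subgraph G W) (disjoint_copies s (path_graph 2))"
    unfolding isomorphic_def
  proof (intro exI[of _ f] conjI ballI)
    have "verts (induced_subgraph G W) = W" using \<open>W \<subseteq> verts G\<close> by (auto simp: induced_subgraph_def)
    moreover have "verts (disjoint_copies s (path_graph 2)) = ?P" by (simp add: disjoint_copies_def path_graph_def)
    ultimately show "bij_betw f (verts (induced_subgraph G W)) (verts (disjoint_copies s (path_graph 2)))"
      unfolding f_def using bij_betw_inv_into[OF bij] by simp
    fix u v assume "u \<in> verts (induced_subgraph G W)" "v \<in> verts (induced_subgraph G W)"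
    then have uv: "u \<in> W" "v \<in> W" by (auto simp: induced_subgraph_def)
    then have "{u, v} \<in> edges (induced_subgraph G W) \<longleftrightarrow> adj G (g (f u)) (g (f v))"
      using f by (simp add: induced_subgraph_def adj_def)
    then show "{u, v} \<in> edges (induced_subgraph G W) \<longleftrightarrow> {f u, f v} \<in> edges (disjoint_copies s (path_graph 2))"
      using E[OF f(1) f(1)] edges[OF f(1) f(1)] uv by simp
  qed
  then show False using free \<open>W \<subseteq> verts G\<close> by (auto simp: sP2_free_def induced_free_def)
qed

lemma connected_graph_induced:
  assumes G: "simple_graph G" and S: "S \<subseteq> verts G"
  shows "connected_graph (induced_subgraph G S) \<longleftrightarrow> conn_on (adj G) S"
proof -
  let ?R = "{(x, y). {x, y} \<in> edges (induced_subgraph G S)}"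
  have R: "(x, y) \<in> ?R \<longleftrightarrow> x \<in> S \<and> y \<in> S \<and> adj G x y" for x y
    by (auto simp: induced_subgraph_def adj_def)
  have V: "verts (induced_subgraph G S) = S" using S by (auto simp: induced_subgraph_def)
  show ?thesis
    unfolding connected_graph_def V
  proof
    assume conn: "\<forall>u\<in>S. \<forall>v\<in>S. (u, v) \<in> ?R\<^sup>*"
    show "conn_on (adj G) S"
      unfolding conn_on_def
    proof (intro allI impI subset_antisym subsetI)
      fix A v assume A: "A \<subseteq> S" "A \<noteq> {} \<and> (\<forall>u\<in>A. \<forall>v\<in>S. adj G u v \<longrightarrow> v \<in> A)" and v: "v \<in> S"
      obtain u where "u \<in> A" using A by auto
      have "(u, v) \<in> ?R\<^sup>*" using conn \<open>u \<in> A\<close> A v by auto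
      then show "v \<in> A" using \<open>u \<in> A\<close>
        by (induction rule: rtrancl_induct) (use A(2) R in auto)
    qed auto
  next
    assume conn: "conn_on (adj G) S"
    show "\<forall>u\<in>S. \<forall>v\<in>S. (u, v) \<in> ?R\<^sup>*"
    proof (intro ballI)
      fix u v assume u: "u \<in> S" "v \<in> S"
      let ?A = "{v \<in> S. (u, v) \<in> ?R\<^sup>*}"
      have "?A = S"
      proof (rule conn_onD[OF conn])
        fix x y assume "x \<in> ?A" "y \<in> S" "adj G x y"
        moreover from this have "(x, y) \<in> ?R" using R by auto
        ultimately show "y \<in> ?A" by (auto intro: rtrancl_into_rtrancl)
      qed (use u in auto)
      then show "(u, v) \<in> ?R\<^sup>*" using u by blast
    qed
  qed
qed

text \<open>A longest path in a set of vertices with two neighbours each closes up at its first vertex.\<close>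

lemma cycle_of_min_degree_two:
  assumes "finite Q" "Q \<noteq> {}" "\<And>v. v \<in> Q \<Longrightarrow> \<not> thin E Q v" "sym_graph E"
  shows "\<exists>xs. length xs \<ge> 3 \<and> distinct xs \<and> set xs \<subseteq> Q \<and> (\<forall>i<length xs. E (xs ! i) (xs ! (Suc i mod length xs)))"
proof -
  interpret sym_graph E by fact
  define path where "path xs \<longleftrightarrow> xs \<noteq> [] \<and> distinct xs \<and> set xs \<subseteq> Q \<and> (\<forall>i. Suc i < length xs \<longrightarrow> E (xs ! i) (xs ! Suc i))"
    for xs
  obtain q where "q \<in> Q" using assms(2) by blast
  then have "path [q]" by (simp add: path_def)
  moreover have "\<forall>xs. path xs \<longrightarrow> length xs < Suc (card Q)"
    using assms(1) by (auto simp: path_def less_Suc_eq_le intro: card_mono simp flip: distinct_card)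
  ultimately obtain xs where xs: "path xs" and max: "\<And>ys. path ys \<Longrightarrow> length ys \<le> length xs"
    using ex_has_greatest_nat[of path "[q]" length "Suc (card Q)"] by blast
  define v where "v = xs ! 0"
  have ne: "xs \<noteq> []" using xs by (simp add: path_def)
  then have "v \<in> Q" using xs by (auto simp: path_def v_def)
  have on_path: "w \<in> set xs" if w: "w \<in> Q" "E v w" for w
  proof (rule ccontr)
    assume "w \<notin> set xs"
    have "E ((w # xs) ! i) ((w # xs) ! Suc i)" if "Suc i < length (w # xs)" for i
    proof (cases i)
      case 0
      then show ?thesis using w(2) sym by (simp add: v_def)
    next
      case (Suc j)
      then show ?thesis using xs that by (auto simp: path_def)
    qed
    then have "path (w # xs)" using xs w(1) \<open>w \<notin> set xs\<close> by (auto simp: path_def)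
    then show False using max by fastforce
  qed
  obtain a b where ab: "a \<in> Q" "b \<in> Q" "E v a" "E v b" "a \<noteq> b"
    using assms(3)[OF \<open>v \<in> Q\<close>] by (auto simp: thin_def)
  obtain i j where i: "i < length xs" "xs ! i = a" and j: "j < length xs" "xs ! j = b"
    using on_path ab by (metis in_set_conv_nth)
  \<comment> \<open>Two distinct neighbours of the first vertex sit at distinct nonzero positions,
    so one is at position 2 or later and closes a cycle of length at least 3.\<close>
  have "i \<noteq> j" "i \<noteq> 0" "j \<noteq> 0" using ab i j irrefl v_def by metis+
  then have "2 \<le> i \<or> 2 \<le> j" by linarith
  then obtain k where k: "2 \<le> k" "k < length xs" "E v (xs ! k)" using i j ab by blast
  let ?ys = "take (Suc k) xs"
  have "E (?ys ! i) (?ys ! (Suc i mod length ?ys))" if "i < length ?ys" for i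
  proof (cases "i = k")
    case True
    have "E (xs ! k) (xs ! 0)" using sym[OF k(3)] by (simp add: v_def)
    moreover have "length ?ys = Suc k" using k(2) by simp
    ultimately show ?thesis using True by (simp del: length_take)
  next
    case False
    moreover have "length ?ys = Suc k" using k(2) by simp
    ultimately have "i < k" using that by simp
    then show ?thesis using \<open>length ?ys = Suc k\<close> k(2) xs by (simp add: path_def del: length_take)
  qed
  moreover have "distinct ?ys" "set ?ys \<subseteq> Q" using xs set_take_subset[of "Suc k" xs] by (auto simp: path_def)
  moreover have "length ?ys \<ge> 3" using k by simp
  ultimately show ?thesis by blast
qed

lemma forest_delete_verts:
  assumes G: "simple_graph G"
  shows "forest (delete_verts G S) \<longleftrightarrow> acyclic_on (adj G) (verts G - S)"
proof -
  interpret sym_graph "adj G" using G by (rule sym_graph_adj)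
  let ?W = "verts G - S"
  have cyc: "cycle_in (delete_verts G S) xs \<longleftrightarrow> length xs \<ge> 3 \<and> distinct xs \<and> set xs \<subseteq> ?W \<and>
      (\<forall>i<length xs. adj G (xs ! i) (xs ! (Suc i mod length xs)))" for xs
  proof -
    have "{xs ! i, xs ! (Suc i mod length xs)} \<subseteq> ?W" if "set xs \<subseteq> ?W" "i < length xs" for i
    proof -
      have "Suc i mod length xs < length xs" using that(2) by (intro mod_less_divisor) auto
      then show ?thesis using that nth_mem[of i xs] nth_mem[of "Suc i mod length xs" xs] by blast
    qed
    then show ?thesis
      unfolding cycle_in_def delete_verts_def induced_subgraph_def adj_def by auto
  qed
  show ?thesis
  proof
    assume forest: "forest (delete_verts G S)"
    show "acyclic_on (adj G) ?W"
      unfolding acyclic_on_def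
    proof (intro allI impI)
      fix Q assume Q: "Q \<subseteq> ?W" "Q \<noteq> {}"
      have "finite Q" using Q(1) G by (auto simp: simple_graph_def intro: finite_subset)
      show "\<exists>v\<in>Q. thin (adj G) Q v"
      proof (rule ccontr)
        assume "\<not> (\<exists>v\<in>Q. thin (adj G) Q v)"
        then obtain xs where "length xs \<ge> 3 \<and> distinct xs \<and> set xs \<subseteq> Q \<and>
            (\<forall>i<length xs. adj G (xs ! i) (xs ! (Suc i mod length xs)))"
          using cycle_of_min_degree_two[OF \<open>finite Q\<close> Q(2) _ sym_graph_adj[OF G]] by blast
        then have "cycle_in (delete_verts G S) xs" using cyc Q(1) by blast
        then show False using forest by (auto simp: forest_def)
      qed
    qed
  next
    assume acyclic: "acyclic_on (adj G) ?W"
    have False if "cycle_in (delete_verts G S) xs" for xs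
    proof -
      have xs: "length xs \<ge> 3" "distinct xs" "set xs \<subseteq> ?W"
        "\<And>i. i < length xs \<Longrightarrow> adj G (xs ! i) (xs ! (Suc i mod length xs))"
        using that cyc by blast+
      then have "set xs \<noteq> {}" by auto
      then obtain v where v: "v \<in> set xs" "thin (adj G) (set xs) v"
        using acyclic xs(3) by (auto simp: acyclic_on_def)
      then obtain i where i: "i < length xs" "v = xs ! i" by (auto simp: in_set_conv_nth)
      \<comment> \<open>On a cycle, predecessor \<open>j\<close> and successor \<open>k\<close> of
        \<open>v\<close> are distinct because the length is at least 3, so no vertex of it is
        thin.\<close>
      define j where "j = (if i = 0 then length xs - 1 else i - 1)"
      have j: "j < length xs" "Suc j mod length xs = i" using i xs(1) by (auto simp: j_def)
      define k where "k = Suc i mod length xs"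
      have k: "k < length xs" using i by (auto simp: k_def intro: mod_less_divisor)
      have "j \<noteq> k"
        using xs(1) i by (cases "Suc i = length xs") (auto simp: j_def k_def)
      then have "xs ! j \<noteq> xs ! k" using xs(2) j k by (simp add: nth_eq_iff_index_eq)
      moreover have "adj G v (xs ! j)" using xs(4)[OF j(1)] j(2) i sym by simp
      moreover have "adj G v (xs ! k)" using xs(4)[OF i(1)] i k_def by simp
      ultimately show False using v(2) j k by (auto simp: thin_def)
    qed
    then show "forest (delete_verts G S)" by (auto simp: forest_def)
  qed
qed

section \<open>Correctness of the forest test and the connectivity test\<close>

lemma peel_correct:
  assumes "n \<le> L"
  shows "(\<forall>v<L. v < n \<and> S v = 0 \<longrightarrow> iter_array L (peel_step L n E S) v \<noteq> 0) \<longleftrightarrow>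
    acyclic_on E {v. v < n \<and> S v = 0}"
proof -
  let ?F = "{v. v < n \<and> S v = 0}"
  \<comment> \<open>The rule is stated in terms of the removed set \<open>X\<close>: it is monotone
    because thinness survives when fewer vertices remain.\<close>
  define \<Phi> where "\<Phi> X v \<longleftrightarrow> v < n \<and> S v = 0 \<and> thin E {u \<in> ?F. u \<notin> X} v" for X v
  define A where "A = iter_array L (\<lambda>v R. of_bool (R v \<noteq> 0 \<or> \<Phi> {u. u < L \<and> R u \<noteq> 0} v))"
  have "{u. u < L \<and> u < n \<and> S u = 0 \<and> R u = 0} = {u \<in> ?F. u \<notin> {u. u < L \<and> R u \<noteq> 0}}" for R :: "nat \<Rightarrow> nat"
    using assms by auto
  then have A: "iter_array L (peel_step L n E S) = A"
    by (simp add: A_def peel_step_def[abs_def] \<Phi>_def)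
  have mono: "\<forall>X Y v. X \<subseteq> Y \<and> \<Phi> X v \<longrightarrow> \<Phi> Y v"
  proof (intro allI impI, elim conjE)
    fix X Y v assume "X \<subseteq> Y" "\<Phi> X v"
    then show "\<Phi> Y v" using thin_mono[of E "{u \<in> ?F. u \<notin> X}" v "{u \<in> ?F. u \<notin> Y}"] by (auto simp: \<Phi>_def)
  qed
  note closure = iter_array_closure[where \<Phi> = \<Phi> and N = L, OF mono, folded A_def]
  show ?thesis
    unfolding A
  proof
    assume peeled: "\<forall>v<L. v < n \<and> S v = 0 \<longrightarrow> A v \<noteq> 0"
    show "acyclic_on E ?F"
      unfolding acyclic_on_def
    proof (intro allI impI, rule ccontr)
      fix Q assume Q: "Q \<subseteq> ?F" "Q \<noteq> {}" "\<not> (\<exists>v\<in>Q. thin E Q v)"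
      have "{u \<in> ?F. u \<notin> - Q} = Q" using Q(1) by auto
      \<comment> \<open>The complement of \<open>Q\<close> is closed under the rule, so peeling
        never enters a set without thin vertices.\<close>
      then have "v \<in> - Q" if "\<Phi> (- Q) v" for v using that Q(3) by (auto simp: \<Phi>_def)
      then have "v \<in> - Q" if "A v \<noteq> 0" for v using closure(2)[of "- Q" v] that by blast
      moreover obtain q where "q \<in> Q" using Q(2) by blast
      moreover from this have "A q \<noteq> 0" using peeled Q(1) assms by auto
      ultimately show False by blast
    qed
  next
    assume acyclic: "acyclic_on E ?F"
    \<comment> \<open>The unpeeled rest; if nonempty, it would contain a thin vertex, to which the
      rule still applies.\<close>
    define Q where "Q = {v \<in> ?F. A v = 0}"
    have "Q = {}"
    proof (rule ccontr)
      assume "Q \<noteq> {}"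
      moreover have "Q \<subseteq> ?F" by (auto simp: Q_def)
      ultimately obtain v where v: "v \<in> Q" "thin E Q v" using acyclic unfolding acyclic_on_def by blast
      moreover have "{u \<in> ?F. u \<notin> {u. u < L \<and> A u \<noteq> 0}} = Q" using assms by (auto simp: Q_def)
      ultimately have "\<Phi> {u. u < L \<and> A u \<noteq> 0} v" by (simp add: \<Phi>_def Q_def)
      then have "A v \<noteq> 0" using closure(1)[of v] v assms by (auto simp: Q_def)
      then show False using v(1) by (simp add: Q_def)
    qed
    then show "\<forall>v<L. v < n \<and> S v = 0 \<longrightarrow> A v \<noteq> 0" by (auto simp: Q_def)
  qed
qed

lemma reach_correct:
  assumes "sym_graph E" and S: "\<And>v. v \<ge> L \<Longrightarrow> S v = 0"
  shows "(\<forall>v<L. S v \<noteq> 0 \<longrightarrow> iter_array L (reach_step L E S) v \<noteq> 0) \<longleftrightarrow> conn_on E {v. S v \<noteq> 0}"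
proof -
  interpret sym_graph E by fact
  let ?S = "{v. S v \<noteq> 0}"
  have bound: "v < L" if "S v \<noteq> 0" for v using S[of v] that by (meson not_less)
  define \<Phi> where "\<Phi> X v \<longleftrightarrow> S v \<noteq> 0 \<and> ((\<forall>u<L. u < v \<longrightarrow> S u = 0) \<or> (\<exists>u\<in>X. E u v))" for X v
  define A where "A = iter_array L (\<lambda>v R. of_bool (R v \<noteq> 0 \<or> \<Phi> {u. u < L \<and> R u \<noteq> 0} v))"
  have A: "iter_array L (reach_step L E S) = A"
    by (simp add: A_def reach_step_def[abs_def] \<Phi>_def Bex_def conj_assoc)
  have mono: "\<forall>X Y v. X \<subseteq> Y \<and> \<Phi> X v \<longrightarrow> \<Phi> Y v"
    by (auto simp: \<Phi>_def)
  note closure = iter_array_closure[where \<Phi> = \<Phi> and N = L, OF mono, folded A_def]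
  show ?thesis
  proof (cases "?S = {}")
    case True
    then show ?thesis by (auto simp: conn_on_def)
  next
    case False
    define m where "m = (LEAST v. S v \<noteq> 0)"
    have m: "S m \<noteq> 0" "\<And>u. u < m \<Longrightarrow> S u = 0"
    proof -
      show "S m \<noteq> 0" unfolding m_def by (rule LeastI_ex) (use False in blast)
      show "S u = 0" if "u < m" for u using not_less_Least[of u "\<lambda>v. S v \<noteq> 0"] that by (simp add: m_def)
    qed
    have root: "v = m" if "S v \<noteq> 0" "\<forall>u<L. u < v \<longrightarrow> S u = 0" for v
      using that m bound by (metis linorder_neqE_nat)
    show ?thesis
      unfolding A
    proof
      assume reached: "\<forall>v<L. S v \<noteq> 0 \<longrightarrow> A v \<noteq> 0"
      have all: "?S \<subseteq> C" if C: "m \<in> C" "\<And>u v. u \<in> C \<Longrightarrow> v \<in> ?S \<Longrightarrow> E u v \<Longrightarrow> v \<in> C" for C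
      proof
        fix v assume v: "v \<in> ?S"
        have "w \<in> C" if "\<Phi> C w" for w using that root C by (auto simp: \<Phi>_def)
        then show "v \<in> C" using closure(2)[of C v] reached bound v by auto
      qed
      show "conn_on E ?S"
        unfolding conn_on_def
      proof (intro allI impI)
        fix B assume B: "B \<subseteq> ?S" "B \<noteq> {} \<and> (\<forall>u\<in>B. \<forall>v\<in>?S. E u v \<longrightarrow> v \<in> B)"
        show "B = ?S"
        proof (cases "m \<in> B")
          case True
          then show ?thesis using all[of B] B by blast
        next
          case False
          \<comment> \<open>By symmetry the complement of the closed set \<open>B\<close> is closed
            too, and it contains the root \<open>m\<close>.\<close>
          have "?S \<subseteq> ?S - B"
            by (rule all) (use False m(1) B sym in auto)
          then show ?thesis using B by blast
        qed
      qed
    next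
      assume conn: "conn_on E ?S"
      let ?R = "{v \<in> ?S. A v \<noteq> 0}"
      have "?R = ?S"
      proof (rule conn_onD[OF conn])
        have "\<Phi> {u. u < L \<and> A u \<noteq> 0} m" using m by (simp add: \<Phi>_def)
        then have "A m \<noteq> 0" by (rule closure(1)[OF bound[OF m(1)]])
        then show "?R \<noteq> {}" using m(1) by auto
        fix u v assume "u \<in> ?R" "v \<in> ?S" "E u v"
        then have "\<Phi> {u. u < L \<and> A u \<noteq> 0} v" "v < L" using bound by (auto simp: \<Phi>_def)
        then have "A v \<noteq> 0" using closure(1)[of v] by simp
        then show "v \<in> ?R" using \<open>v \<in> ?S\<close> by simp
      qed auto
      then show "\<forall>v<L. S v \<noteq> 0 \<longrightarrow> A v \<noteq> 0" by blast
    qed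
  qed
qed

lemma verdict_correct:
  assumes "sym_graph E" "n \<le> L" "S = (\<lambda>v. of_bool (v \<in> Z))" "Z \<subseteq> {..<n}"
  shows "verdict conn L n E k S \<longleftrightarrow>
    acyclic_on E ({..<n} - Z) \<and> (conn \<longrightarrow> conn_on E Z) \<and> card Z \<le> k"
proof -
  have "{v. v < n \<and> S v = 0} = {..<n} - Z" "{v. S v \<noteq> 0} = Z" using assms(3) by auto
  moreover have "(\<Sum>v<L. S v) = card Z"
  proof -
    have "{..<L} \<inter> Z = Z" using assms(2,4) by auto
    then show ?thesis by (simp add: assms(3) flip: sum.inter_restrict Int_def)
  qed
  moreover have "S v = 0" if "v \<ge> L" for v using that assms(2-4) by auto
  ultimately show ?thesis
    using peel_correct[OF assms(2), of S E] reach_correct[OF assms(1), of L S] by (simp add: verdict_def)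
qed

lemma candidate_eq:
  assumes "n \<le> L"
  shows "candidate L n E U X B =
    (\<lambda>v. of_bool (v < n \<and> \<not> U v \<and> (iter_array L (greedy_step L n E U B) v = 0 \<or> X v)))"
proof
  fix v
  show "candidate L n E U X B v =
      of_bool (v < n \<and> \<not> U v \<and> (iter_array L (greedy_step L n E U B) v = 0 \<or> X v))"
  proof (cases "v < L")
    case True
    then show ?thesis
      using iter_array_rec[of L "\<lambda>v _. of_bool (v < n \<and> \<not> U v \<and> (iter_array L (greedy_step L n E U B) v = 0 \<or> X v))" v]
      by (simp add: candidate_def Let_def)
  next
    case False
    then show ?thesis using assms by (simp add: candidate_def Let_def iter_array_ge)
  qed
qed

text \<open>The equation for \<open>J\<close> decides membership of \<open>v\<close> from the
  members below \<open>v\<close>, and the array obeys the same recursion; strong induction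
  identifies the two.\<close>

lemma greedy_eq:
  assumes "n \<le> L" and J: "\<And>v. v \<in> J \<longleftrightarrow> v < n \<and> \<not> U v \<and> thin E {u. u < L \<and> U u} v \<and> \<not> B v \<and>
      (\<forall>u\<in>J. u < v \<longrightarrow> \<not> E u v)"
  shows "iter_array L (greedy_step L n E U B) v \<noteq> 0 \<longleftrightarrow> v \<in> J"
proof (induction v rule: less_induct)
  case (less v)
  define A where "A = iter_array L (greedy_step L n E U B)"
  show ?case
  proof (cases "v < L")
    case True
    have "A v = greedy_step L n E U B v A"
      unfolding A_def by (rule iter_array_rec) (use True in \<open>auto simp: greedy_step_def\<close>)
    moreover have "(\<forall>u<L. u < v \<and> A u \<noteq> 0 \<longrightarrow> \<not> E u v) \<longleftrightarrow> (\<forall>u\<in>J. u < v \<longrightarrow> \<not> E u v)"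
      using less.IH True unfolding A_def by (meson less_trans)
    ultimately have "A v \<noteq> 0 \<longleftrightarrow> v \<in> J" using J[of v] by (auto simp: greedy_step_def)
    then show ?thesis by (simp add: A_def)
  next
    case False
    then show ?thesis using J[of v] assms(1) by (simp add: iter_array_ge)
  qed
qed

section \<open>Existence of a successful guess\<close>

lemma enumerate_with_default:
  assumes "finite Y" "card Y \<le> a"
  shows "\<exists>t :: nat \<Rightarrow> 'a. (\<forall>j<a. t j \<in> insert d Y) \<and> (\<forall>y. y \<noteq> d \<longrightarrow> (\<exists>j<a. t j = y) \<longleftrightarrow> y \<in> Y)"
proof -
  obtain xs where xs: "set xs = Y" "length xs = card Y"
    using assms(1) by (metis distinct_card finite_distinct_list)
  define t where "t j = (if j < length xs then xs ! j else d)" for j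
  have "(\<exists>j<a. t j = y) \<longleftrightarrow> y \<in> Y" if "y \<noteq> d" for y
  proof
    assume "y \<in> Y"
    then obtain j where "j < length xs" "xs ! j = y" using xs(1) by (auto simp: in_set_conv_nth)
    then show "\<exists>j<a. t j = y" using xs(2) assms(2) by (intro exI[of _ j]) (simp add: t_def)
  qed (use that xs(1) in \<open>auto simp: t_def split: if_splits\<close>)
  moreover have "t j \<in> insert d Y" for j using xs(1) by (auto simp: t_def)
  ultimately show ?thesis by blast
qed

text \<open>Padding the guessed tuple with \<open>n\<close>, which is not a vertex, lets it encode smaller sets.\<close>

lemma guess_exists:
  fixes E :: "nat \<Rightarrow> nat \<Rightarrow> bool"
  assumes bound: "\<forall>u v. E u v \<longrightarrow> u < n \<and> v < n"
    and U: "U \<subseteq> {..<n}" "card U \<le> a" and X: "X \<subseteq> {..<n}" "card X \<le> b"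
    and P: "P \<subseteq> {..<n} \<times> {..<n}" "card P \<le> c"
  shows "\<exists>T. (\<forall>j<a + b + 2 * c. T j \<le> n) \<and> (\<forall>v<n. in_range T 0 a v \<longleftrightarrow> v \<in> U) \<and>
    (\<forall>v<n. in_range T a b v \<longleftrightarrow> v \<in> X) \<and>
    (\<forall>v. blocked E T (a + b) c v \<longleftrightarrow> (\<exists>(x, y)\<in>P. v < x \<and> (E v x \<or> E v y)))"
proof -
  have fin: "finite U" "finite X" "finite P"
    using U(1) X(1) P(1) by (auto intro: finite_subset[of _ "{..<n}"] finite_subset[of _ "{..<n} \<times> {..<n}"])
  obtain tU where tU: "\<forall>j<a. tU j \<in> insert n U" "\<And>y. y \<noteq> n \<Longrightarrow> (\<exists>j<a. tU j = y) \<longleftrightarrow> y \<in> U"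
    using enumerate_with_default[OF fin(1) U(2), of n] by blast
  obtain tX where tX: "\<forall>j<b. tX j \<in> insert n X" "\<And>y. y \<noteq> n \<Longrightarrow> (\<exists>j<b. tX j = y) \<longleftrightarrow> y \<in> X"
    using enumerate_with_default[OF fin(2) X(2), of n] by blast
  obtain tP where tP: "\<forall>j<c. tP j \<in> insert (n, n) P" "\<And>y. y \<noteq> (n, n) \<Longrightarrow> (\<exists>j<c. tP j = y) \<longleftrightarrow> y \<in> P"
    using enumerate_with_default[OF fin(3) P(2), of "(n, n)"] by blast
  define T where "T j = (if j < a then tU j else if j < a + b then tX (j - a)
      else let i = j - (a + b) in if even i then fst (tP (i div 2)) else snd (tP (i div 2)))" for j
  have T: "j < a \<Longrightarrow> T j = tU j" "j < b \<Longrightarrow> T (a + j) = tX j"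
    "T (a + b + 2 * j) = fst (tP j)" "T (Suc (a + b + 2 * j)) = snd (tP j)" for j
    by (auto simp: T_def)
  have "T j \<le> n" if j: "j < a + b + 2 * c" for j
  proof -
    consider "j < a" | i where "j = a + i" "i < b" | i where "j = a + b + i" "i < 2 * c"
      using j by (metis add_less_cancel_left le_Suc_ex not_less)
    then show ?thesis
    proof cases
      case 1
      then show ?thesis using tU(1) U(1) by (auto simp: T dest!: spec[of _ j])
    next
      case 2
      then show ?thesis using tX(1) X(1) by (auto simp: T dest!: spec[of _ i])
    next
      case 3
      then have "tP (i div 2) \<in> insert (n, n) P" using tP(1) by auto
      then show ?thesis using P(1) 3 by (auto simp: T_def Let_def)
    qed
  qed
  moreover have "in_range T 0 a v \<longleftrightarrow> v \<in> U" if "v < n" for v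
    using tU(2)[of v] that T(1) by (auto simp: in_range_def)
  moreover have "in_range T a b v \<longleftrightarrow> v \<in> X" if "v < n" for v
    using tX(2)[of v] that T(2) by (auto simp: in_range_def)
  moreover have "blocked E T (a + b) c v \<longleftrightarrow> (\<exists>(x, y)\<in>P. v < x \<and> (E v x \<or> E v y))" for v
  proof -
    have "blocked E T (a + b) c v \<longleftrightarrow> (\<exists>j<c. v < fst (tP j) \<and> (E v (fst (tP j)) \<or> E v (snd (tP j))))"
      by (simp add: blocked_def T)
    also have "\<dots> \<longleftrightarrow> (\<exists>(x, y)\<in>P. v < x \<and> (E v x \<or> E v y))"
    proof
      assume "\<exists>j<c. v < fst (tP j) \<and> (E v (fst (tP j)) \<or> E v (snd (tP j)))"
      then obtain j where j: "j < c" "v < fst (tP j)" "E v (fst (tP j)) \<or> E v (snd (tP j))" by blast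
      \<comment> \<open>\<open>n\<close> lies outside the range of \<open>E\<close>, so the padding
        pair blocks nothing.\<close>
      then have "tP j \<noteq> (n, n)" using bound[rule_format, of v n] by auto
      then have "tP j \<in> P" using tP(1) j(1) by auto
      then show "\<exists>(x, y)\<in>P. v < x \<and> (E v x \<or> E v y)" using j by (intro bexI[of _ "tP j"]) (auto split: prod.splits)
    next
      assume "\<exists>(x, y)\<in>P. v < x \<and> (E v x \<or> E v y)"
      then obtain x y where xy: "(x, y) \<in> P" "v < x" "E v x \<or> E v y" by blast
      moreover have "(x, y) \<noteq> (n, n)" using xy(3) bound by blast
      ultimately obtain j where "j < c" "tP j = (x, y)" using tP(2)[of "(x, y)"] by blast
      then show "\<exists>j<c. v < fst (tP j) \<and> (E v (fst (tP j)) \<or> E v (snd (tP j)))"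
        using xy by (intro exI[of _ j]) auto
    qed
    finally show ?thesis .
  qed
  ultimately show ?thesis by blast
qed

text \<open>The solution \<open>Z\<close> is replaced by a subset \<open>Z'\<close> that the program
  can produce: \<open>R\<close> together with few connectors \<open>Y\<close>. Being a subset bounds
  its size, and its complement is \<open>U\<close> plus an independent set of thin vertices.\<close>

lemma candidate_complete:
  fixes E :: "nat \<Rightarrow> nat \<Rightarrow> bool"
  assumes E: "sym_graph E" and bound: "\<And>u v. E u v \<Longrightarrow> u < n \<and> v < n" and "n < L"
    and matching: "\<And>M. M \<subseteq> {..<n} \<times> {..<n} \<Longrightarrow> induced_matching E M \<Longrightarrow> card M \<le> s"
    and Z: "Z \<subseteq> {..<n}" "acyclic_on E ({..<n} - Z)" "conn \<Longrightarrow> conn_on E Z"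
  shows "\<exists>T Z'. (\<forall>j<4 * s + 2 * s + 2 * s. T j < L) \<and> Z' \<subseteq> {..<n} \<and> acyclic_on E ({..<n} - Z') \<and>
    (conn \<longrightarrow> conn_on E Z') \<and> card Z' \<le> card Z \<and>
    candidate L n E (in_range T 0 (4 * s)) (in_range T (4 * s) (2 * s)) (blocked E T (4 * s + 2 * s) s) =
      (\<lambda>v. of_bool (v \<in> Z'))"
proof -
  interpret sym_graph E by (rule E)
  define F where "F = {..<n} - Z"
  have matching': "card M \<le> s" if "M \<subseteq> Q \<times> Q" "Q \<subseteq> {..<n}" "induced_matching E M" for M Q
    using matching[OF _ that(3)] that(1,2) by blast
  have "finite F" by (simp add: F_def)
  then obtain U where U: "U \<subseteq> F" "card U \<le> 4 * s" "indep E (F - U)" "\<forall>v\<in>F - U. thin E U v"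
    using acyclic_structure[of F s] Z(2) matching'[of _ F] unfolding F_def by blast
  define W where "W = {v. v < n \<and> v \<notin> U \<and> thin E U v}"
  have "F - U \<subseteq> W" using U(4) by (auto simp: W_def F_def)
  have "finite W" by (simp add: W_def)
  from maximal_indep_extension[OF \<open>finite W\<close> \<open>F - U \<subseteq> W\<close> U(3)]
  obtain J where J': "F - U \<subseteq> J \<and> J \<subseteq> W \<and> indep E J \<and> (\<forall>K\<subseteq>W. indep E K \<and> J \<subseteq> K \<longrightarrow> K = J)" ..
  then have J: "F - U \<subseteq> J" "J \<subseteq> W" "indep E J" by auto
  have J_max: "K = J" if "K \<subseteq> W" "indep E K" "J \<subseteq> K" for K
    using J' that by simp
  \<comment> \<open>Since \<open>F\<close> lies in \<open>U \<union> J\<close>, the set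
    \<open>R\<close> is contained in \<open>Z\<close>; the remainder \<open>X\<close> of
    \<open>Z\<close> lies in \<open>J\<close> and is therefore independent, as the lemma on
    connectors demands.\<close>
  define R where "R = {..<n} - U - J"
  define X where "X = J - F"
  have Z_eq: "Z = R \<union> X" using J U(1) Z(1) by (auto simp: R_def X_def F_def W_def)
  have X_sub: "X \<subseteq> {..<n}" using J(2) by (auto simp: X_def W_def)
  have "\<exists>Y\<subseteq>X. card Y \<le> 2 * s \<and> (conn \<longrightarrow> conn_on E (R \<union> Y))"
  proof (cases conn)
    case True
    have "\<exists>Y\<subseteq>X. card Y \<le> 2 * s \<and> conn_on E (R \<union> Y)"
    proof (rule conn_on_few_connectors)
      show "finite R" "finite X" using X_sub by (auto simp: R_def intro: finite_subset)
      show "R \<inter> X = {}" by (auto simp: R_def X_def)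
      show "indep E X" using J(3) by (rule indep_mono) (auto simp: X_def)
      show "conn_on E (R \<union> X)" using Z(3) True Z_eq by simp
      show "card M \<le> s" if "M \<subseteq> (R \<union> X) \<times> (R \<union> X)" "induced_matching E M" for M
        using matching'[OF that(1) _ that(2)] Z(1) Z_eq by simp
    qed
    then show ?thesis by blast
  qed (intro exI[of _ "{}"], simp)
  then obtain Y where Y: "Y \<subseteq> X" "card Y \<le> 2 * s" "conn \<Longrightarrow> conn_on E (R \<union> Y)" by blast
  define Z' where "Z' = R \<union> Y"
  have Z': "Z' \<subseteq> {..<n}" using Y(1) X_sub by (auto simp: Z'_def R_def)
  have "{..<n} - Z' = U \<union> (J - Y)"
    using U(1) J(2) Y(1) by (auto simp: Z'_def R_def F_def W_def X_def)
  moreover have "acyclic_on E (U \<union> (J - Y))"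
  proof (rule acyclic_on_union_indep)
    show "acyclic_on E U" using Z(2) U(1) unfolding F_def by (rule acyclic_on_mono)
    show "indep E (J - Y)" using J(3) by (rule indep_mono) auto
    show "thin E U v" if "v \<in> J - Y" for v using that J(2) by (auto simp: W_def)
  qed
  ultimately have acyclic: "acyclic_on E ({..<n} - Z')" by simp
  have card: "card Z' \<le> card Z"
    using Y(1) Z_eq Z(1) by (intro card_mono) (auto simp: Z'_def intro: finite_subset)
  obtain P where P: "P \<subseteq> W \<times> W" "induced_matching E P" and J_eq: "\<And>v. v \<in> J \<longleftrightarrow> v \<in> W \<and>
      (\<forall>u\<in>J. u < v \<longrightarrow> \<not> E u v) \<and> (\<forall>(a, b)\<in>P. v < a \<longrightarrow> \<not> E v a \<and> \<not> E v b)"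
    using maximal_indep_determined[OF E \<open>finite W\<close> J(2,3) J_max] by blast
  have "W \<subseteq> {..<n}" by (auto simp: W_def)
  then have P': "P \<subseteq> {..<n} \<times> {..<n}" "card P \<le> s" using P matching'[OF P(1)] by auto
  have U_sub: "U \<subseteq> {..<n}" using U(1) by (auto simp: F_def)
  have Y_sub: "Y \<subseteq> {..<n}" using Y(1) X_sub by auto
  have "\<forall>u v. E u v \<longrightarrow> u < n \<and> v < n" using bound by blast
  from guess_exists[OF this U_sub U(2) Y_sub Y(2) P'] obtain T where
    T': "(\<forall>j<4 * s + 2 * s + 2 * s. T j \<le> n) \<and> (\<forall>v<n. in_range T 0 (4 * s) v \<longleftrightarrow> v \<in> U) \<and>
     (\<forall>v<n. in_range T (4 * s) (2 * s) v \<longleftrightarrow> v \<in> Y) \<and>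
     (\<forall>v. blocked E T (4 * s + 2 * s) s v \<longleftrightarrow> (\<exists>(x, y)\<in>P. v < x \<and> (E v x \<or> E v y)))" ..
  note T = T'[THEN conjunct1] T'[THEN conjunct2, THEN conjunct1] T'[THEN conjunct2, THEN conjunct2, THEN conjunct1]
    T'[THEN conjunct2, THEN conjunct2, THEN conjunct2]
  let ?U = "in_range T 0 (4 * s)" and ?B = "blocked E T (4 * s + 2 * s) s"
  \<comment> \<open>The padding value \<open>n\<close> may occur in the guessed range but has no
    neighbours, so it does not affect thinness.\<close>
  have thin: "thin E {u. u < L \<and> ?U u} v \<longleftrightarrow> thin E U v" for v
  proof -
    have "x \<in> {u. u < L \<and> ?U u} \<longleftrightarrow> x \<in> U" if "E v x" for x
      using bound[OF that] T(2) \<open>n < L\<close> by auto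
    then show ?thesis unfolding thin_def by blast
  qed
  have J_greedy: "v \<in> J \<longleftrightarrow> v < n \<and> \<not> ?U v \<and> thin E {u. u < L \<and> ?U u} v \<and> \<not> ?B v \<and> (\<forall>u\<in>J. u < v \<longrightarrow> \<not> E u v)" for v
    using J_eq[of v] T(2,4) thin[of v] by (auto simp: W_def)
  have greedy: "iter_array L (greedy_step L n E ?U ?B) v \<noteq> 0 \<longleftrightarrow> v \<in> J" for v
    by (rule greedy_eq[OF _ J_greedy]) (use \<open>n < L\<close> in simp)
  have "v \<in> Z' \<longleftrightarrow> v < n \<and> \<not> ?U v \<and> (v \<notin> J \<or> in_range T (4 * s) (2 * s) v)" for v
    using T(2,3) Y(1) J(2) Y_sub by (auto simp: Z'_def R_def X_def W_def)
  then have "candidate L n E ?U (in_range T (4 * s) (2 * s)) ?B = (\<lambda>v. of_bool (v \<in> Z'))"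
    using candidate_eq[of n L] greedy \<open>n < L\<close> by (auto simp: fun_eq_iff)
  moreover have "\<forall>j<4 * s + 2 * s + 2 * s. T j < L" using T(1) \<open>n < L\<close> by (meson le_less_trans)
  ultimately show ?thesis using Z' acyclic card Y(3) unfolding Z'_def by blast
qed

section \<open>Reading back an encoded instance\<close>

lemma sum_lessThan_if:
  fixes f :: "nat \<Rightarrow> nat"
  assumes "a \<le> N"
  shows "(\<Sum>i<N. if i < a then f i else 0) = (\<Sum>i<a. f i)"
  by (rule sum.mono_neutral_cong_right) (use assms in auto)

lemma powers_of_two:
  assumes "v < N"
  shows "iter_array N (\<lambda>v P. if v = 0 then 1 else P (v - 1) + P (v - 1)) v = 2 ^ v"
  using assms
proof (induction v)
  case 0
  then show ?case by (subst iter_array_rec) auto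
next
  case (Suc v)
  then show ?case by (subst iter_array_rec) auto
qed

lemma decode_k_bits:
  assumes bits: "\<And>i. A (Suc p + i) = (if i < l then of_bool (bit m i) else 0)" and "l \<le> N" "m < 2 ^ l"
  shows "decode_k N p A = m"
proof -
  have "decode_k N p A = (\<Sum>i<N. if i < l then of_bool (bit m i) * 2 ^ i else 0)"
    unfolding decode_k_def Let_def by (rule sum.cong) (auto simp: powers_of_two bits simp del: add_Suc)
  also have "\<dots> = (\<Sum>i<l. of_bool (bit m i) * 2 ^ i)"
    using assms(2) by (rule sum_lessThan_if)
  also have "\<dots> = take_bit l m"
    by (simp add: take_bit_sum push_bit_eq_mult atLeast0LessThan)
  also have "\<dots> = m" using assms(3) by (rule take_bit_nat_eq_self)
  finally show ?thesis .
qed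

context
  fixes G :: "nat graph" and k :: int and n L :: nat and A :: "nat \<Rightarrow> nat"
  assumes G: "simple_graph G" and n: "verts G = {..<n}"
    and L: "L = length (encode_instance (G, k))"
    and A: "A = (\<lambda>i. if i < L then of_bool (encode_instance (G, k) ! i) else 0)"
begin

lemma length_encoding: "L = Suc (Suc (n + n * n + floorlog 2 (nat \<bar>k\<bar>)))"
  by (simp add: L n encode_instance_def encode_graph_def encode_int_def Let_def)

lemma encoding_unary: "i < n \<Longrightarrow> A i = 1" "A n = 0"
  using length_encoding
  by (auto simp: A n encode_instance_def encode_graph_def encode_int_def Let_def nth_append)

lemma encoding_matrix:
  assumes "u < n" "v < n"
  shows "A (Suc n + u * n + v) = of_bool (adj G u v)"
proof -
  have lt: "u * n + v < n * n"
  proof -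
    have "u * n + v < Suc u * n" using assms(2) by simp
    also have "\<dots> \<le> n * n" using assms(1) by (intro mult_le_mono) auto
    finally show ?thesis .
  qed
  have "List.product [0..<n] [0..<n] ! (u * n + v) = (u, v)"
    using product_nth[of "u * n + v" "[0..<n]" "[0..<n]"] lt assms by simp
  then show ?thesis
    using length_encoding lt
    by (auto simp: A n encode_instance_def encode_graph_def encode_int_def Let_def nth_append adj_def)
qed

lemma encoding_sign: "A (Suc n + n * n) = of_bool (k < 0)"
  using length_encoding
  by (auto simp: A n encode_instance_def encode_graph_def encode_int_def Let_def nth_append)

lemma encoding_bits:
  "A (Suc (Suc n + n * n) + i) = (if i < floorlog 2 (nat \<bar>k\<bar>) then of_bool (bit (nat \<bar>k\<bar>) i) else 0)"
  using length_encoding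
  by (auto simp: A n encode_instance_def encode_graph_def encode_int_def Let_def nth_append)

lemma n_less_L: "n < L"
  by (simp add: length_encoding)

lemma decode_n_encoding: "decode_n L A = n"
proof -
  have "(\<forall>j<L. j \<le> i \<longrightarrow> A j \<noteq> 0) \<longleftrightarrow> i < n" if "i < L" for i
    using encoding_unary n_less_L that
    by (metis One_nat_def le_less_trans not_less zero_neq_one)
  then have "decode_n L A = (\<Sum>i<L. if i < n then 1 else 0)"
    unfolding decode_n_def by (intro sum.cong) auto
  then show ?thesis using sum_lessThan_if[of n L "\<lambda>_. 1"] n_less_L by simp
qed

lemma sign_position_encoding: "sign_position L n = Suc n + n * n"
  using sum_lessThan_if[of n L "\<lambda>_. n"] n_less_L by (simp add: sign_position_def)

lemma decode_k_encoding: "decode_k L (Suc n + n * n) A = nat \<bar>k\<bar>"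
proof (rule decode_k_bits[OF encoding_bits])
  show "nat \<bar>k\<bar> < 2 ^ floorlog 2 (nat \<bar>k\<bar>)" by (rule floorlog_leD) auto
qed (simp add: length_encoding)

lemma edge_at_encoding: "edge_at L n A = adj G"
proof (intro ext)
  fix u v
  show "edge_at L n A u v = adj G u v"
  proof (cases "u < n \<and> v < n")
    case True
    then show ?thesis
      using encoding_matrix[of u v] sum_lessThan_if[of u L "\<lambda>_. n"] n_less_L by (simp add: edge_at_def)
  next
    case False
    then show ?thesis using adj_verts[OF G] n by (auto simp: edge_at_def)
  qed
qed

text \<open>Acceptance is sound for every tuple, because the verdict tests the candidate itself;
  freeness enters in the converse, where \<open>candidate_complete\<close> supplies a tuple.\<close>

lemma accepts_encoding:
  assumes free: "sP2_free s G"
  shows "accepts conn (4 * s) (2 * s) s L A \<longleftrightarrow>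
    (\<exists>S\<subseteq>verts G. forest (delete_verts G S) \<and> (conn \<longrightarrow> connected_graph (induced_subgraph G S)) \<and> int (card S) \<le> k)"
proof -
  let ?E = "adj G"
  have E: "sym_graph ?E" using G by (rule sym_graph_adj)
  have iff: "acyclic_on ?E ({..<n} - Z) \<and> (conn \<longrightarrow> conn_on ?E Z) \<longleftrightarrow>
      forest (delete_verts G Z) \<and> (conn \<longrightarrow> connected_graph (induced_subgraph G Z))" if "Z \<subseteq> {..<n}" for Z
    using that forest_delete_verts[OF G] connected_graph_induced[OF G] by (simp add: n)
  have acc: "accepts conn (4 * s) (2 * s) s L A \<longleftrightarrow> \<not> k < 0 \<and> (\<exists>T. (\<forall>j<4 * s + 2 * s + 2 * s. T j < L) \<and>
      verdict conn L n ?E (nat \<bar>k\<bar>) (candidate L n ?E (in_range T 0 (4 * s)) (in_range T (4 * s) (2 * s))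
        (blocked ?E T (4 * s + 2 * s) s)))"
    by (simp add: accepts_def Let_def decode_n_encoding sign_position_encoding decode_k_encoding
        edge_at_encoding encoding_sign del: add_Suc)
  show ?thesis
  proof
    assume "accepts conn (4 * s) (2 * s) s L A"
    then obtain T where k: "\<not> k < 0" and T: "verdict conn L n ?E (nat \<bar>k\<bar>) (candidate L n ?E (in_range T 0 (4 * s))
        (in_range T (4 * s) (2 * s)) (blocked ?E T (4 * s + 2 * s) s))"
      using acc by blast
    \<comment> \<open>Whatever the tuple, the candidate is the indicator of a set of vertices, the
      form that \<open>verdict_correct\<close> expects.\<close>
    obtain Z where Z: "Z \<subseteq> {..<n}" "candidate L n ?E (in_range T 0 (4 * s)) (in_range T (4 * s) (2 * s))
        (blocked ?E T (4 * s + 2 * s) s) = (\<lambda>v. of_bool (v \<in> Z))"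
    proof (rule that)
      let ?Z = "{v. v < n \<and> \<not> in_range T 0 (4 * s) v \<and> (iter_array L (greedy_step L n ?E (in_range T 0 (4 * s))
        (blocked ?E T (4 * s + 2 * s) s)) v = 0 \<or> in_range T (4 * s) (2 * s) v)}"
      show "?Z \<subseteq> {..<n}" by auto
      show "candidate L n ?E (in_range T 0 (4 * s)) (in_range T (4 * s) (2 * s))
        (blocked ?E T (4 * s + 2 * s) s) = (\<lambda>v. of_bool (v \<in> ?Z))"
        using n_less_L by (subst candidate_eq) auto
    qed
    then have "acyclic_on ?E ({..<n} - Z) \<and> (conn \<longrightarrow> conn_on ?E Z) \<and> card Z \<le> nat \<bar>k\<bar>"
      using verdict_correct[OF E _ Z(2,1)] T n_less_L by auto
    then show "\<exists>S\<subseteq>verts G. forest (delete_verts G S) \<and> (conn \<longrightarrow> connected_graph (induced_subgraph G S)) \<and> int (card S) \<le> k"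
      using iff[OF Z(1)] Z(1) k n by (intro exI[of _ Z]) auto
  next
    assume "\<exists>S\<subseteq>verts G. forest (delete_verts G S) \<and> (conn \<longrightarrow> connected_graph (induced_subgraph G S)) \<and> int (card S) \<le> k"
    then obtain S where S: "S \<subseteq> {..<n}" "forest (delete_verts G S)" "conn \<longrightarrow> connected_graph (induced_subgraph G S)"
        "int (card S) \<le> k" using n by auto
    have "\<exists>T Z'. (\<forall>j<4 * s + 2 * s + 2 * s. T j < L) \<and> Z' \<subseteq> {..<n} \<and> acyclic_on ?E ({..<n} - Z') \<and>
      (conn \<longrightarrow> conn_on ?E Z') \<and> card Z' \<le> card S \<and>
      candidate L n ?E (in_range T 0 (4 * s)) (in_range T (4 * s) (2 * s)) (blocked ?E T (4 * s + 2 * s) s) =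
        (\<lambda>v. of_bool (v \<in> Z'))"
    proof (rule candidate_complete[OF E _ n_less_L _ S(1)])
      show "u < n \<and> v < n" if "?E u v" for u v using adj_verts[OF G that] n by auto
      show "card M \<le> s" if "M \<subseteq> {..<n} \<times> {..<n}" "induced_matching ?E M" for M
        using card_le_induced_matching[OF G free, of M] that n by simp
    qed (use iff[OF S(1)] S(2,3) in auto)
    then obtain T Z' where *: "\<forall>j<4 * s + 2 * s + 2 * s. T j < L" "Z' \<subseteq> {..<n}" "acyclic_on ?E ({..<n} - Z')"
      "conn \<longrightarrow> conn_on ?E Z'" "card Z' \<le> card S"
      "candidate L n ?E (in_range T 0 (4 * s)) (in_range T (4 * s) (2 * s)) (blocked ?E T (4 * s + 2 * s) s) =
        (\<lambda>v. of_bool (v \<in> Z'))" by blast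
    have "card Z' \<le> nat \<bar>k\<bar>" using *(5) S(4) by linarith
    then have "verdict conn L n ?E (nat \<bar>k\<bar>) (candidate L n ?E (in_range T 0 (4 * s)) (in_range T (4 * s) (2 * s))
        (blocked ?E T (4 * s + 2 * s) s))"
      using verdict_correct[OF E _ *(6,2)] *(3,4) n_less_L by simp
    moreover have "\<not> k < 0" using S(4) by linarith
    ultimately show "accepts conn (4 * s) (2 * s) s L A" using *(1) acc by blast
  qed
qed

end

text \<open>The flag \<open>conn\<close> switches between the two problems, so that a single
  argument covers both.\<close>

lemma poly_time_solvable_accepts:
  "poly_time_solvable encode_instance (sP2_free_instances s)
     {(G, k). \<exists>S\<subseteq>verts G. forest (delete_verts G S) \<and>
        (conn \<longrightarrow> connected_graph (induced_subgraph G S)) \<and> int (card S) \<le> k}"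
proof (rule ptime_imp_poly_time_solvable[OF ptime_pred_accepts[of conn "4 * s" "2 * s" s]])
  fix x assume "x \<in> sP2_free_instances s"
  then obtain G k n where x: "x = (G, k)" and G: "simple_graph G" "verts G = {..<n}" "sP2_free s G"
    by (auto simp: sP2_free_instances_def input_graph_def)
  define L where "L = length (encode_instance x)"
  define A where "A = (\<lambda>i. if i < L then of_bool (encode_instance x ! i) else 0 :: nat)"
  have "fst (init_state (encode_instance x)) 0 = L" "snd (init_state (encode_instance x)) 0 = A"
    by (auto simp: init_state_def L_def A_def fun_eq_iff)
  then show "accepts conn (4 * s) (2 * s) s (fst (init_state (encode_instance x)) 0) (snd (init_state (encode_instance x)) 0)
      \<longleftrightarrow> x \<in> {(G, k). \<exists>S\<subseteq>verts G. forest (delete_verts G S) \<and>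
        (conn \<longrightarrow> connected_graph (induced_subgraph G S)) \<and> int (card S) \<le> k}"
    using accepts_encoding[OF G(1,2) L_def[unfolded x] A_def[unfolded x] G(3)] x by simp
qed

theorem theorem13:
  fixes s :: nat
  assumes "s \<ge> 1"
  shows "poly_time_solvable encode_instance (sP2_free_instances s) FVS \<and>
         poly_time_solvable encode_instance (sP2_free_instances s) CFVS"
proof
  have FVS: "FVS = {(G, k). \<exists>S\<subseteq>verts G. forest (delete_verts G S) \<and>
      (False \<longrightarrow> connected_graph (induced_subgraph G S)) \<and> int (card S) \<le> k}"
    by (auto simp: FVS_def feedback_vertex_set_def)
  show "poly_time_solvable encode_instance (sP2_free_instances s) FVS"
    unfolding FVS by (rule poly_time_solvable_accepts)
  have CFVS: "CFVS = {(G, k). \<exists>S\<subseteq>verts G. forest (delete_verts G S) \<and>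
      (True \<longrightarrow> connected_graph (induced_subgraph G S)) \<and> int (card S) \<le> k}"
    by (auto simp: CFVS_def connected_feedback_vertex_set_def feedback_vertex_set_def)
  show "poly_time_solvable encode_instance (sP2_free_instances s) CFVS"
    unfolding CFVS by (rule poly_time_solvable_accepts)
qed

end
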